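(* Let $n\ge1$ and $w\in\Sigma_{0,1,n}$. Then $w$ lies in the $\mathcal{B}_n$-orbit $\{t_1^\phi:\phi\in\mathcal{B}_n\}$ of $t_1$ if and only if both of the following hold: - the cyclically reduced form of $w$ lies in $\{t_1,\dots,t_n\}$; - $w$ is a planar word.
   Context: $\Sigma_{0,1,n}$ is the free group on $t_1,\dots,t_n$, with $\overline t_k=t_k^{-1}$ and $z_1=(t_1\cdots t_n)^{-1}$. Automorphisms act on the right as exponents. $\mathcal{B}_n$ is the group of automorphisms of $\Sigma_{0,1,n}$ fixing $z_1$ and permuting the conjugacy classes $\{[t_1],\dots,[t_n]\}$. Let $A$ be the set of formal symbols $\overline z_1,t_1,\overline t_1,\dots,t_n,\overline t_n,z_1$, ordered by $\overline z_1<t_1<\overline t_1<\dots<t_n<\overline t_n<z_1$. For a reduced word $a_1\cdots a_m$, its Whitehead expansion is $(c_1,\dots,c_{2m+2})=(\overline z_1,a_1,\overline a_1,\dots,a_m,\overline a_m,z_1)$. Two $2$-element sets of integers $\{a,b\},\{c,d\}$ are nested if $a,b,c,d$ are distinct and either both or neither of $c,d$ lie strictly between $a$ and $b$. A $2M$-tuple $(c_1,\dots,c_{2M})$ of elements of $A$ is planar if some permutation $\pi$ of $\{1,\dots,2M\}$ satisfies three conditions: - $\pi(i)<\pi(j)\Rightarrow c_i\le c_j$; - the sets $\{\pi(2i-1),\pi(2i)\}$, $1\le i\le M$, are pairwise nested; - the sets $\{\pi(2i),\pi(2i+1)\}$, $1\le i\le M-1$, are pairwise nested. A word $w$ is planar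 if the Whitehead expansion of its reduced word is planar. *)

theory Defs
  imports Main
begin

text \<open>Words in the free group \<Sigma>_{0,1,n} on t_1..t_n.  A letter (k, False) is t_k,
  a letter (k, True) is the inverse t_k^{-1} (written \<open>\<overline>t_k\<close>).\<close>

type_synonym letter = "nat \<times> bool"
type_synonym word = "letter list"

fun inv_letter :: "letter \<Rightarrow> letter" where
  "inv_letter (k, b) = (k, \<not> b)"

definition over :: "nat \<Rightarrow> word \<Rightarrow> bool" where
  "over n w \<longleftrightarrow> (\<forall>a\<in>set w. fst a \<in> {1..n})"

definition reduced :: "word \<Rightarrow> bool" where
  "reduced w \<longleftrightarrow> (\<forall>i. Suc i < length w \<longrightarrow> w ! Suc i \<noteq> inv_letter (w ! i))"

fun red_cons :: "letter \<Rightarrow> word \<Rightarrow> word" where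
  "red_cons a [] = [a]"
| "red_cons a (b # bs) = (if b = inv_letter a then bs else a # b # bs)"

definition reduce :: "word \<Rightarrow> word" where
  "reduce w = foldr red_cons w []"

definition FG :: "nat \<Rightarrow> word set" where
  "FG n = {w. over n w \<and> reduced w}"

definition mult :: "word \<Rightarrow> word \<Rightarrow> word" where
  "mult u v = reduce (u @ v)"

definition winv :: "word \<Rightarrow> word" where
  "winv w = rev (map inv_letter w)"

definition gen :: "nat \<Rightarrow> word" where
  "gen k = [(k, False)]"

definition z1 :: "nat \<Rightarrow> word" where
  "z1 n = rev (map (\<lambda>k. (k, True)) [1..<n+1])"

definition conjugate :: "nat \<Rightarrow> word \<Rightarrow> word \<Rightarrow> bool" where
  "conjugate n u v \<longleftrightarrow> (\<exists>g\<in>FG n. v = mult (mult (winv g) u) g)"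

text \<open>Automorphisms of the free group (as maps on its elements; values outside FG n are irrelevant).\<close>
definition is_aut :: "nat \<Rightarrow> (word \<Rightarrow> word) \<Rightarrow> bool" where
  "is_aut n \<phi> \<longleftrightarrow> bij_betw \<phi> (FG n) (FG n) \<and>
     (\<forall>u\<in>FG n. \<forall>v\<in>FG n. \<phi> (mult u v) = mult (\<phi> u) (\<phi> v))"

definition Bn :: "nat \<Rightarrow> (word \<Rightarrow> word) set" where
  "Bn n = {\<phi>. is_aut n \<phi> \<and> \<phi> (z1 n) = z1 n \<and>
     (\<forall>k\<in>{1..n}. \<exists>j\<in>{1..n}. conjugate n (\<phi> (gen k)) (gen j))}"

function cyc_red :: "word \<Rightarrow> word" where
  "cyc_red w = (if 2 \<le> length w \<and> last w = inv_letter (hd w)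
                then cyc_red (butlast (tl w)) else w)"
  by pat_completeness auto
termination by (relation "measure length") auto

text \<open>Alphabet A encoded in nat, respecting the order
  \<overline>z_1 < t_1 < \<overline>t_1 < ... < t_n < \<overline>t_n < z_1:
  \<overline>z_1 = 0, t_k = 2k-1, \<overline>t_k = 2k, z_1 = 2n+1.\<close>
fun code :: "letter \<Rightarrow> nat" where
  "code (k, b) = (if b then 2 * k else 2 * k - 1)"

definition whitehead_exp :: "nat \<Rightarrow> word \<Rightarrow> nat list" where
  "whitehead_exp n w =
     [0] @ concat (map (\<lambda>a. [code a, code (inv_letter a)]) w) @ [2 * n + 1]"

definition between :: "nat \<Rightarrow> nat \<Rightarrow> nat \<Rightarrow> bool" where
  "between a b x \<longleftrightarrow> min a b < x \<and> x < max a b"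

definition nested :: "nat \<Rightarrow> nat \<Rightarrow> nat \<Rightarrow> nat \<Rightarrow> bool" where
  "nested a b c d \<longleftrightarrow> distinct [a, b, c, d] \<and> (between a b c \<longleftrightarrow> between a b d)"

text \<open>Planarity of a 2M-tuple (c_1,...,c_{2M}) given as a list, c_i = c ! (i-1).\<close>
definition planar_tuple :: "nat list \<Rightarrow> bool" where
  "planar_tuple c \<longleftrightarrow> (let L = length c; M = L div 2 in
     (\<exists>\<pi>. bij_betw \<pi> {1..L} {1..L} \<and>
       (\<forall>i\<in>{1..L}. \<forall>j\<in>{1..L}. \<pi> i < \<pi> j \<longrightarrow> c ! (i - 1) \<le> c ! (j - 1)) \<and>
       (\<forall>i\<in>{1..M}. \<forall>i'\<in>{1..M}. i \<noteq> i' \<longrightarrow>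
          nested (\<pi> (2*i - 1)) (\<pi> (2*i)) (\<pi> (2*i' - 1)) (\<pi> (2*i'))) \<and>
       (\<forall>i\<in>{1..M-1}. \<forall>i'\<in>{1..M-1}. i \<noteq> i' \<longrightarrow>
          nested (\<pi> (2*i)) (\<pi> (2*i + 1)) (\<pi> (2*i')) (\<pi> (2*i' + 1)))))"

definition planar :: "nat \<Rightarrow> word \<Rightarrow> bool" where
  "planar n w \<longleftrightarrow> planar_tuple (whitehead_exp n (reduce w))"

end

theory Submission
  imports Defs
begin

text \<open>
  Planarity of a word says that it is represented by a simple loop in the disc with \<open>n\<close> punctures: the
  Whitehead expansion lists the successive crossings with \<open>n\<close> cuts, and the permutation places these
  crossings along the boundary of the cut disc so that neither the arcs between consecutive crossings nor
  the crossings themselves are linked.  Inserting strands, mirroring, and removing innermost cancelling pairs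
  show that planarity is preserved by the elementary braid automorphisms and their inverses.

  For the forward direction, Artin's argument writes every element of \<open>Bn n\<close> as a product of elementary braids:
  the images of the generators are conjugates of generators with product \<open>t_1 ... t_n\<close>, and unless all
  conjugators are trivial, some elementary braid shortens them.

  For the converse, a planar word is simplified by braids.  Consider a shortest arc which does not join the
  inverse of a letter \<open>t_k\<close> to the letter \<open>t_{k+1}\<close>.  All arcs below it are of this standard form, and so either
  some braid decreases the length of the word (or the sum of the numbers \<open>n + 1 - k\<close> over its letters \<open>t_k\<close>, at no greater length), or
  the strands below the arc form a closed loop, which is impossible since the drawing is a single path.
  When all arcs are standard, the word is positive; as braids preserve the exponent sum, which is \<open>1\<close>, it is a
  single generator.
\<close>

section \<open>Words and endomorphisms of the free group\<close>

text \<open>Substituting a braid into a reduced word gives an unreduced word, which is drawn before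
  it is reduced; hence drawings are defined for arbitrary words. A cancelling pair can be deleted
  from a drawing only if no other strand lies between its two strands, hence the choice of an
  innermost one.

  In the converse direction every move is a Whitehead automorphism: it changes the length by at most
  the number of arcs leaving a cut minus the number of occurrences of one generator. Below a
  shortest nonstandard arc the standard arcs match half-edges of neighbouring blocks, so that the
  two numbers nearly agree, and the nonstandard arc itself supplies the unit that makes an
  inequality strict. Sorting may keep the length, since it can merely exchange how often two
  neighbouring generators occur; the second measure is there for this case. Planarity alone does not
  single out generators, as \<open>t_1 t_2\<close> is planar too; it is the exponent sum, read off
  from the cyclic reduction, that excludes such words.\<close>

lemma inv_letter_inv_letter [simp]: "inv_letter (inv_letter a) = a"
  by (cases a) simp

lemma inv_letter_neq [simp]: "inv_letter a \<noteq> a" "a \<noteq> inv_letter a"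
  by (cases a; simp)+

lemma fst_inv_letter [simp]: "fst (inv_letter a) = fst a"
  by (cases a) simp

lemma inv_letter_eq_iff [simp]: "inv_letter a = inv_letter b \<longleftrightarrow> a = b"
  by (cases a; cases b) auto

lemma reduced_iff_successively: "reduced w \<longleftrightarrow> successively (\<lambda>a b. b \<noteq> inv_letter a) w"
  by (simp add: reduced_def successively_conv_nth)

lemma reduced_Nil [simp]: "reduced []" and reduced_single [simp]: "reduced [a]"
  by (simp_all add: reduced_iff_successively)

lemma reduced_Cons2 [simp]: "reduced (a # b # w) \<longleftrightarrow> b \<noteq> inv_letter a \<and> reduced (b # w)"
  by (simp add: reduced_iff_successively)

lemma reduced_append_iff:
  "reduced (u @ v) \<longleftrightarrow> reduced u \<and> reduced v \<and> (u = [] \<or> v = [] \<or> hd v \<noteq> inv_letter (last u))"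
  by (auto simp: reduced_iff_successively successively_append_iff)

lemma reduced_ConsD: "reduced (a # w) \<Longrightarrow> reduced w"
  by (cases w) auto

lemma reduced_Cons: "reduced (a # w) \<longleftrightarrow> reduced w \<and> (w = [] \<or> hd w \<noteq> inv_letter a)"
  by (cases w) auto

lemma reduced_red_cons: "reduced w \<Longrightarrow> reduced (red_cons a w)"
  by (cases w) (auto dest: reduced_ConsD)

lemma red_cons_cancel: "reduced w \<Longrightarrow> red_cons a (red_cons (inv_letter a) w) = w"
proof (cases w)
  case (Cons b bs)
  assume "reduced w"
  with Cons show ?thesis by (cases bs) auto
qed simp

lemma reduce_Nil [simp]: "reduce [] = []"
  by (simp add: reduce_def)

lemma reduce_Cons: "reduce (a # w) = red_cons a (reduce w)"
  by (simp add: reduce_def)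

lemma reduced_reduce [simp]: "reduced (reduce w)"
  by (induction w) (auto simp: reduce_Cons reduced_red_cons)

lemma reduce_reduced [simp]: "reduced w \<Longrightarrow> reduce w = w"
proof (induction w)
  case (Cons a w)
  then show ?case by (cases w) (auto simp: reduce_Cons dest: reduced_ConsD)
qed simp

lemma reduce_append: "reduce (u @ v) = foldr red_cons u (reduce v)"
  by (simp add: reduce_def)

lemma foldr_red_cons_reduced: "reduced v \<Longrightarrow> reduced (foldr red_cons u v)"
  by (induction u) (auto simp: reduced_red_cons)

text \<open>Van der Waerden's argument: a letter acts on reduced words through
  \<open>red_cons\<close>, and inverse letters act as inverse maps by
  \<open>red_cons_cancel\<close>. Cancellation inside \<open>u\<close> therefore does not change the
  action of \<open>u\<close>, which makes \<open>reduce\<close> compatible with concatenation and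
  \<open>mult\<close> associative.\<close>

lemma foldr_red_cons_reduce:
  assumes "reduced v"
  shows "foldr red_cons (reduce u) v = foldr red_cons u v"
proof (induction u)
  case (Cons a u)
  have "foldr red_cons (red_cons a w) v = red_cons a (foldr red_cons w v)" for w
  proof (cases w)
    case (Cons b bs)
    then show ?thesis
      using red_cons_cancel[of "foldr red_cons bs v" a] foldr_red_cons_reduced[OF assms]
      by auto
  qed simp
  with Cons show ?case by (simp add: reduce_Cons)
qed simp

lemma reduce_append_left [simp]: "reduce (reduce u @ v) = reduce (u @ v)"
  by (simp add: reduce_append foldr_red_cons_reduce)

lemma reduce_append_right [simp]: "reduce (u @ reduce v) = reduce (u @ v)"
  by (simp add: reduce_append)

lemma reduce_append_cong:
  "reduce u = reduce u' \<Longrightarrow> reduce v = reduce v' \<Longrightarrow> reduce (u @ v) = reduce (u' @ v')"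
  by (metis reduce_append_left reduce_append_right)

lemma reduce_cancel_pair: "reduce (u @ a # inv_letter a # v) = reduce (u @ v)"
proof -
  have "reduce (a # inv_letter a # v) = reduce v"
    by (simp add: reduce_Cons red_cons_cancel)
  then show ?thesis by (metis reduce_append_right)
qed

lemma winv_Nil [simp]: "winv [] = []" by (simp add: winv_def)
lemma winv_Cons [simp]: "winv (a # w) = winv w @ [inv_letter a]" by (simp add: winv_def)
lemma winv_append [simp]: "winv (u @ v) = winv v @ winv u" by (simp add: winv_def)
lemma winv_winv [simp]: "winv (winv w) = w" by (induction w) auto
lemma winv_eq_Nil_iff [simp]: "winv w = [] \<longleftrightarrow> w = []" by (simp add: winv_def)
lemma length_winv [simp]: "length (winv w) = length w" by (simp add: winv_def)

lemma reduce_winv_left [simp]: "reduce (winv u @ u @ v) = reduce v"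
proof (induction u)
  case (Cons a u)
  then show ?case
    using reduce_cancel_pair[of "winv u" "inv_letter a" "u @ v"] by simp
qed simp

lemma reduce_winv_right [simp]: "reduce (u @ winv u @ v) = reduce v"
  using reduce_winv_left[of "winv u" v] by simp

lemma reduce_winv_self [simp]: "reduce (winv u @ u) = []" "reduce (u @ winv u) = []"
  using reduce_winv_left[of u "[]"] reduce_winv_right[of u "[]"] by simp_all

lemma reduced_winv [simp]: "reduced (winv w) \<longleftrightarrow> reduced w"
proof -
  have "reduced (winv w)" if "reduced w" for w
    using that
  proof (induction w)
    case (Cons a w)
    then show ?case by (cases w) (auto simp: reduced_append_iff)
  qed simp
  from this[of w] this[of "winv w"] show ?thesis by auto
qed

lemma reduce_winv: "reduce (winv w) = winv (reduce w)"
proof -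
  have "reduce (winv w) = reduce (winv (reduce w) @ reduce w @ winv w)" by simp
  also have "\<dots> = reduce (winv (reduce w) @ w @ winv w)"
    by (metis reduce_append_left reduce_append_right)
  also have "\<dots> = reduce (winv (reduce w))"
    by (metis append_Nil2 reduce_append_right reduce_winv_self(2) reduce_Nil)
  finally show ?thesis by simp
qed

lemma reduce_append_mid [simp]: "reduce (u @ reduce v @ w) = reduce (u @ v @ w)"
  by (metis reduce_append_left reduce_append_right)

lemma over_Nil [simp]: "over n []"
  and over_Cons [simp]: "over n (a # w) \<longleftrightarrow> fst a \<in> {1..n} \<and> over n w"
  and over_append [simp]: "over n (u @ v) \<longleftrightarrow> over n u \<and> over n v"
  by (auto simp: over_def)

lemma over_winv [simp]: "over n (winv w) \<longleftrightarrow> over n w"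
  by (auto simp: over_def winv_def)

text \<open>Stated for weights because both the length and the height of a word must not grow under
  reduction.\<close>

lemma sum_list_reduce_le:
  fixes f :: "letter \<Rightarrow> nat"
  shows "sum_list (map f (reduce w)) \<le> sum_list (map f w)"
proof (induction w)
  case (Cons a w)
  have "sum_list (map f (red_cons a v)) \<le> f a + sum_list (map f v)" for v
    by (cases v) auto
  with Cons show ?case by (force simp: reduce_Cons intro: order_trans)
qed simp

lemma set_reduce: "set (reduce w) \<subseteq> set w"
proof (induction w)
  case (Cons a w)
  have "set (red_cons a v) \<subseteq> insert a (set v)" for v
    by (cases v) auto
  with Cons show ?case by (force simp: reduce_Cons)
qed simp

lemma over_reduce: "over n w \<Longrightarrow> over n (reduce w)"
  using set_reduce by (fastforce simp: over_def)

lemma FG_D: "w \<in> FG n \<Longrightarrow> over n w" "w \<in> FG n \<Longrightarrow> reduced w"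
  by (auto simp: FG_def)

lemma Nil_in_FG [simp]: "[] \<in> FG n" by (simp add: FG_def)

lemma reduce_in_FG: "over n w \<Longrightarrow> reduce w \<in> FG n"
  by (simp add: FG_def over_reduce)

lemma mult_in_FG: "u \<in> FG n \<Longrightarrow> v \<in> FG n \<Longrightarrow> mult u v \<in> FG n"
  by (simp add: mult_def reduce_in_FG FG_D)

lemma winv_in_FG [simp]: "winv w \<in> FG n \<longleftrightarrow> w \<in> FG n"
  by (simp add: FG_def)

lemma gen_in_FG: "k \<in> {1..n} \<Longrightarrow> gen k \<in> FG n"
  by (simp add: FG_def gen_def)

section \<open>Endomorphisms given by substitution\<close>

definition subst_letter :: "(nat \<Rightarrow> word) \<Rightarrow> letter \<Rightarrow> word" where
  "subst_letter h a = (if snd a then winv (h (fst a)) else h (fst a))"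

definition subst :: "(nat \<Rightarrow> word) \<Rightarrow> word \<Rightarrow> word" where
  "subst h w = concat (map (subst_letter h) w)"

definition endo :: "(nat \<Rightarrow> word) \<Rightarrow> word \<Rightarrow> word" where
  "endo h w = reduce (subst h w)"

lemma subst_Nil [simp]: "subst h [] = []"
  and subst_Cons: "subst h (a # w) = subst_letter h a @ subst h w"
  and subst_append [simp]: "subst h (u @ v) = subst h u @ subst h v"
  by (simp_all add: subst_def)

lemma subst_letter_inv [simp]: "subst_letter h (inv_letter a) = winv (subst_letter h a)"
  by (cases a) (simp add: subst_letter_def)

lemma subst_winv: "subst h (winv w) = winv (subst h w)"
  by (induction w) (auto simp: subst_Cons)

text \<open>A cancelling pair is replaced by a word followed by its formal inverse and cancels
  again. So \<open>endo h\<close> is the homomorphism that the universal property of the free group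
  attaches to the images \<open>h\<close>.\<close>

lemma endo_reduce [simp]: "endo h (reduce w) = endo h w"
proof (induction w)
  case (Cons a w)
  have "reduce (subst h (red_cons a v)) = reduce (subst_letter h a @ subst h v)" for v
  proof (cases v)
    case (Cons b bs)
    then show ?thesis by (auto simp: subst_Cons)
  qed (simp add: subst_Cons)
  with Cons show ?case
    unfolding endo_def reduce_Cons subst_Cons by (metis reduce_append_right)
qed simp

lemma endo_Nil [simp]: "endo h [] = []" by (simp add: endo_def)

lemma endo_append: "endo h (u @ v) = mult (endo h u) (endo h v)"
  by (simp add: endo_def mult_def)

lemma endo_mult: "endo h (mult u v) = mult (endo h u) (endo h v)"
  by (simp add: mult_def endo_append[unfolded mult_def])

lemma endo_winv: "endo h (winv w) = winv (endo h w)"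
  by (simp add: endo_def subst_winv reduce_winv)

lemma endo_gen: "endo h (gen k) = reduce (h k)"
  by (simp add: endo_def gen_def subst_Cons subst_letter_def)

lemma over_subst:
  assumes "\<And>k. k \<in> {1..n} \<Longrightarrow> over n (h k)" "over n w"
  shows "over n (subst h w)"
  using assms(2) by (induction w) (auto simp: subst_Cons subst_letter_def assms(1))

lemma endo_in_FG:
  assumes "\<And>k. k \<in> {1..n} \<Longrightarrow> over n (h k)" "over n w"
  shows "endo h w \<in> FG n"
  unfolding endo_def using assms by (intro reduce_in_FG over_subst)

lemma reduce_subst_cong:
  assumes "\<And>k. k \<in> {1..n} \<Longrightarrow> reduce (f k) = reduce (g k)" "over n w"
  shows "reduce (subst f w) = reduce (subst g w)"
  using assms(2)
proof (induction w)
  case (Cons a w)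
  then have "reduce (subst_letter f a) = reduce (subst_letter g a)"
    using assms(1)[of "fst a"] by (simp add: subst_letter_def reduce_winv)
  with Cons show ?case
    by (simp add: subst_Cons) (metis reduce_append_cong)
qed simp

lemma endo_endo:
  assumes "\<And>k. k \<in> {1..n} \<Longrightarrow> endo h (g k) = reduce (f k)" "over n w"
  shows "endo h (endo g w) = endo f w"
proof -
  have "subst h (subst g w) = subst (\<lambda>k. subst h (g k)) w"
    by (induction w) (auto simp: subst_Cons subst_letter_def subst_winv)
  then have "endo h (endo g w) = reduce (subst (\<lambda>k. subst h (g k)) w)"
    by (simp add: endo_def[of g] ) (simp add: endo_def)
  also have "\<dots> = endo f w"
    unfolding endo_def using assms by (intro reduce_subst_cong[where n = n]) (auto simp: endo_def)
  finally show ?thesis .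
qed

lemma subst_gen [simp]: "subst gen w = w"
  by (induction w) (auto simp: subst_Cons subst_letter_def gen_def split: prod.splits)

section \<open>Planar words as drawings\<close>

text \<open>
  A decorated letter \<open>(a, p, q)\<close> records the positions \<open>p\<close> of the half-edge \<open>a\<close> and \<open>q\<close> of the half-edge
  \<open>inv_letter a\<close> of the Whitehead expansion; \<open>s\<close> and \<open>t\<close> below are the positions of the two ends.  Positions are
  arbitrary integers rather than ranks, so that strands can be inserted and deleted freely.
\<close>

type_synonym dletter = "letter \<times> int \<times> int"

fun arcs :: "int \<Rightarrow> dletter list \<Rightarrow> int \<Rightarrow> (int \<times> int) list" where
  "arcs s [] t = [(s, t)]"
| "arcs s ((a, p, q) # d) t = (s, p) # arcs q d t"

definition endpoints :: "dletter list \<Rightarrow> int list" where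
  "endpoints d = concat (map (\<lambda>(a, p, q). [p, q]) d)"

definition labels :: "nat \<Rightarrow> int \<Rightarrow> dletter list \<Rightarrow> int \<Rightarrow> (int \<times> nat) set" where
  "labels n s d t = {(s, 0), (t, 2 * n + 1)} \<union>
     (\<Union>(a, p, q)\<in>set d. {(p, code a), (q, code (inv_letter a))})"

text \<open>Betweenness as an exclusive or: for \<open>c\<close> different from \<open>a\<close> and
  \<open>b\<close> it says that \<open>c\<close> lies between them. This form is symmetric in
  \<open>a\<close> and \<open>b\<close> and additive along adjacent intervals, which is what joining
  two arcs relies on.\<close>

definition separates :: "int \<Rightarrow> int \<Rightarrow> int \<Rightarrow> bool" where
  "separates a b c \<longleftrightarrow> (a < c) \<noteq> (b < c)"

definition noncrossing :: "(int \<times> int) set \<Rightarrow> bool" where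
  "noncrossing E \<longleftrightarrow> (\<forall>(a, b)\<in>E. \<forall>(c, d)\<in>E. (a, b) \<noteq> (c, d) \<longrightarrow> separates a b c = separates a b d)"

text \<open>The condition on labels makes half-edges with equal code occupy consecutive places, a
  block; the order inside a block is the free choice of the drawing.\<close>

definition drawing :: "nat \<Rightarrow> int \<Rightarrow> dletter list \<Rightarrow> int \<Rightarrow> bool" where
  "drawing n s d t \<longleftrightarrow> distinct (s # endpoints d @ [t]) \<and>
     (\<forall>(p, c)\<in>labels n s d t. \<forall>(p', c')\<in>labels n s d t. p < p' \<longrightarrow> c \<le> c') \<and>
     noncrossing (set (arcs s d t)) \<and> noncrossing (snd ` set d)"

definition drawable :: "nat \<Rightarrow> word \<Rightarrow> bool" where
  "drawable n w \<longleftrightarrow> (\<exists>s d t. map fst d = w \<and> drawing n s d t)"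

lemma endpoints_Nil [simp]: "endpoints [] = []"
  and endpoints_Cons [simp]: "endpoints ((a, p, q) # d) = p # q # endpoints d"
  and endpoints_append [simp]: "endpoints (d @ d') = endpoints d @ endpoints d'"
  by (simp_all add: endpoints_def)

lemma arcs_snoc: "arcs s (d @ [(a, p, q)]) t = arcs s d p @ [(q, t)]"
  by (induction s d p rule: arcs.induct) auto

text \<open>Intermediate form between the permutation in \<open>planar_tuple\<close> and a decorated
  word. Half-edges are numbered from 0, so arcs are the pairs \<open>2 * i\<close>,
  \<open>2 * i + 1\<close> and crossings the pairs \<open>2 * i + 1\<close>,
  \<open>2 * i + 2\<close>. The analysis of reduced words without moves is carried out on these
  indices.\<close>

definition index_drawing :: "nat \<Rightarrow> word \<Rightarrow> (nat \<Rightarrow> int) \<Rightarrow> bool" where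
  "index_drawing n w q \<longleftrightarrow>
     inj_on q {..<2 * length w + 2} \<and>
     (\<forall>i<2 * length w + 2. \<forall>j<2 * length w + 2. q i < q j \<longrightarrow> whitehead_exp n w ! i \<le> whitehead_exp n w ! j) \<and>
     (\<forall>i\<le>length w. \<forall>j\<le>length w. i \<noteq> j \<longrightarrow>
        separates (q (2 * i)) (q (2 * i + 1)) (q (2 * j)) = separates (q (2 * i)) (q (2 * i + 1)) (q (2 * j + 1))) \<and>
     (\<forall>i<length w. \<forall>j<length w. i \<noteq> j \<longrightarrow>
        separates (q (2 * i + 1)) (q (2 * i + 2)) (q (2 * j + 1)) = separates (q (2 * i + 1)) (q (2 * i + 2)) (q (2 * j + 2)))"

definition decorate :: "word \<Rightarrow> (nat \<Rightarrow> int) \<Rightarrow> dletter list" where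
  "decorate w q = map (\<lambda>i. (w ! i, q (2 * i + 1), q (2 * i + 2))) [0..<length w]"

lemma map_fst_decorate [simp]: "map fst (decorate w q) = w"
  by (simp add: decorate_def comp_def map_nth)

lemma endpoints_decorate:
  "q 0 # endpoints (decorate w q) @ [q (2 * length w + 1)] = map q [0..<2 * length w + 2]"
proof -
  have "endpoints (map (\<lambda>i. (w ! i, q (2 * i + 1), q (2 * i + 2))) [0..<m]) = map (\<lambda>i. q (i + 1)) [0..<2 * m]" for m
    by (induction m) auto
  moreover have "map q [0..<2 * length w + 2] = q 0 # map (\<lambda>i. q (i + 1)) [0..<2 * length w + 1]"
    by (subst upt_conv_Cons) (simp_all add: comp_def map_Suc_upt[symmetric] del: upt_Suc)
  ultimately show ?thesis
    by (simp add: decorate_def)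
qed

lemma arcs_decorate:
  "arcs (q 0) (decorate w q) (q (2 * length w + 1)) = map (\<lambda>i. (q (2 * i), q (2 * i + 1))) [0..<length w + 1]"
proof -
  have "arcs (q 0) (map (\<lambda>i. (w ! i, q (2 * i + 1), q (2 * i + 2))) [0..<m]) x
      = map (\<lambda>i. (q (2 * i), q (2 * i + 1))) [0..<m] @ [(q (2 * m), x)]" for m x
    by (induction m arbitrary: x) (auto simp: arcs_snoc)
  then show ?thesis by (simp add: decorate_def)
qed

lemma nth_concat_pairs:
  assumes "i < length w"
  shows "concat (map (\<lambda>a. [f a, g a]) w) ! (2 * i) = f (w ! i)"
    and "concat (map (\<lambda>a. [f a, g a]) w) ! (2 * i + 1) = g (w ! i)"
  using assms
proof (induction w arbitrary: i)
  case (Cons a w)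
  { case 1 with Cons show ?case by (cases i) auto }
  { case 2 with Cons show ?case by (cases i) auto }
qed simp_all

lemma length_concat_pairs [simp]: "length (concat (map (\<lambda>a. [f a, g a]) w)) = 2 * length w"
  by (induction w) auto

lemma length_whitehead_exp [simp]: "length (whitehead_exp n w) = 2 * length w + 2"
  by (simp add: whitehead_exp_def)

lemma whitehead_exp_nth:
  "whitehead_exp n w ! 0 = 0"
  "whitehead_exp n w ! (2 * length w + 1) = 2 * n + 1"
  "i < length w \<Longrightarrow> whitehead_exp n w ! (2 * i + 1) = code (w ! i)"
  "i < length w \<Longrightarrow> whitehead_exp n w ! (2 * i + 2) = code (inv_letter (w ! i))"
  using nth_concat_pairs[of i w code "\<lambda>a. code (inv_letter a)"]
  by (auto simp: whitehead_exp_def nth_append)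

lemma half_edge_cases:
  assumes "i < 2 * m + (2 :: nat)"
  obtains "i = 0" | "i = 2 * m + 1" | j where "j < m" "i = 2 * j + 1" | j where "j < m" "i = 2 * j + 2"
proof (cases "even i")
  case True
  then obtain j where "i = 2 * j" by (elim evenE)
  with assms that show ?thesis by (cases j) auto
next
  case False
  then obtain j where "i = 2 * j + 1" by (elim oddE)
  with assms that show ?thesis by (cases "j = m") auto
qed

lemma labels_decorate:
  "labels n (q 0) (decorate w q) (q (2 * length w + 1)) = (\<lambda>i. (q i, whitehead_exp n w ! i)) ` {..<2 * length w + 2}"
    (is "?L = ?R")
proof -
  have "?L = {(q 0, 0), (q (2 * length w + 1), 2 * n + 1)} \<union>
    (\<Union>i<length w. {(q (2 * i + 1), code (w ! i)), (q (2 * i + 2), code (inv_letter (w ! i)))})"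
    by (simp add: labels_def decorate_def atLeast0LessThan)
  also have "\<dots> = ?R"
  proof (rule set_eqI, rule iffI)
    fix x assume "x \<in> ?R"
    then obtain i where i: "i < 2 * length w + 2" "x = (q i, whitehead_exp n w ! i)" by auto
    from i(1) show "x \<in> {(q 0, 0), (q (2 * length w + 1), 2 * n + 1)} \<union>
      (\<Union>i<length w. {(q (2 * i + 1), code (w ! i)), (q (2 * i + 2), code (inv_letter (w ! i)))})"
      by (rule half_edge_cases) (use i(2) whitehead_exp_nth in auto)
  next
    fix x assume "x \<in> {(q 0, 0), (q (2 * length w + 1), 2 * n + 1)} \<union>
      (\<Union>i<length w. {(q (2 * i + 1), code (w ! i)), (q (2 * i + 2), code (inv_letter (w ! i)))})"
    then consider "x = (q 0, 0)" | "x = (q (2 * length w + 1), 2 * n + 1)"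
      | i where "i < length w" "x = (q (2 * i + 1), code (w ! i))"
      | i where "i < length w" "x = (q (2 * i + 2), code (inv_letter (w ! i)))"
      by auto
    then show "x \<in> ?R"
    proof cases
      case 1 then show ?thesis by (intro image_eqI[of _ _ 0]) (auto simp: whitehead_exp_nth)
    next
      case 2 then show ?thesis by (intro image_eqI[of _ _ "2 * length w + 1"]) (use whitehead_exp_nth in auto)
    next
      case (3 i) then show ?thesis by (intro image_eqI[of _ _ "2 * i + 1"]) (use whitehead_exp_nth in auto)
    next
      case (4 i) then show ?thesis by (intro image_eqI[of _ _ "2 * i + 2"]) (use whitehead_exp_nth in auto)
    qed
  qed
  finally show ?thesis .
qed

lemma noncrossing_image:
  assumes "inj_on f I"
  shows "noncrossing (f ` I) \<longleftrightarrow> (\<forall>i\<in>I. \<forall>j\<in>I. i \<noteq> j \<longrightarrow>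
    separates (fst (f i)) (snd (f i)) (fst (f j)) = separates (fst (f i)) (snd (f i)) (snd (f j)))"
  unfolding noncrossing_def split_beta by (auto simp: inj_on_eq_iff[OF assms])

text \<open>\<open>noncrossing\<close> speaks of distinct pairs and \<open>index_drawing\<close> of
  distinct indices; the two agree if \<open>q\<close> is injective, and otherwise both sides
  fail.\<close>

lemma index_drawing_iff:
  "index_drawing n w q \<longleftrightarrow> drawing n (q 0) (decorate w q) (q (2 * length w + 1))"
proof (cases "inj_on q {..<2 * length w + 2}")
  case True
  have 1: "noncrossing (set (arcs (q 0) (decorate w q) (q (2 * length w + 1)))) \<longleftrightarrow>
    (\<forall>i\<le>length w. \<forall>j\<le>length w. i \<noteq> j \<longrightarrow>
        separates (q (2 * i)) (q (2 * i + 1)) (q (2 * j)) = separates (q (2 * i)) (q (2 * i + 1)) (q (2 * j + 1)))"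
  proof -
    have "inj_on (\<lambda>i. (q (2 * i), q (2 * i + 1))) {..<length w + 1}"
      by (rule inj_onI) (use inj_on_eq_iff[OF True] in fastforce)
    then show ?thesis
      unfolding arcs_decorate set_map set_upt atLeast0LessThan
      by (subst noncrossing_image) (auto simp: less_Suc_eq_le)
  qed
  have 2: "noncrossing (snd ` set (decorate w q)) \<longleftrightarrow>
    (\<forall>i<length w. \<forall>j<length w. i \<noteq> j \<longrightarrow>
        separates (q (2 * i + 1)) (q (2 * i + 2)) (q (2 * j + 1)) = separates (q (2 * i + 1)) (q (2 * i + 2)) (q (2 * j + 2)))"
  proof -
    have "inj_on (\<lambda>i. (q (2 * i + 1), q (2 * i + 2))) {..<length w}"
      by (rule inj_onI) (use inj_on_eq_iff[OF True] in fastforce)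
    moreover have "snd ` set (decorate w q) = (\<lambda>i. (q (2 * i + 1), q (2 * i + 2))) ` {..<length w}"
      by (simp add: decorate_def image_image atLeast0LessThan)
    ultimately show ?thesis by (simp add: noncrossing_image Ball_def)
  qed
  have 3: "distinct (q 0 # endpoints (decorate w q) @ [q (2 * length w + 1)])"
    unfolding endpoints_decorate using True by (simp add: distinct_map atLeast0LessThan del: upt_Suc)
  have 4: "(\<forall>(p, c)\<in>labels n (q 0) (decorate w q) (q (2 * length w + 1)).
      \<forall>(p', c')\<in>labels n (q 0) (decorate w q) (q (2 * length w + 1)). p < p' \<longrightarrow> c \<le> c') \<longleftrightarrow>
    (\<forall>i<2 * length w + 2. \<forall>j<2 * length w + 2. q i < q j \<longrightarrow> whitehead_exp n w ! i \<le> whitehead_exp n w ! j)"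
    unfolding labels_decorate by auto
  show ?thesis
    unfolding index_drawing_def drawing_def using True 1 2 3 4 by blast
next
  case False
  then have "\<not> distinct (q 0 # endpoints (decorate w q) @ [q (2 * length w + 1)])"
    unfolding endpoints_decorate by (simp add: distinct_map atLeast0LessThan del: upt_Suc)
  with False show ?thesis by (auto simp: index_drawing_def drawing_def)
qed

lemma drawable_iff_index_drawing: "drawable n w \<longleftrightarrow> (\<exists>q. index_drawing n w q)"
proof
  assume "drawable n w"
  then obtain s d t where d: "map fst d = w" "drawing n s d t" by (auto simp: drawable_def)
  define q where "q i = (s # endpoints d @ [t]) ! i" for i
  have w: "w ! i = fst (d ! i)" if "i < length d" for i using d(1) that by auto
  have len: "length w = length d" using d(1) by auto
  have endp: "endpoints d = concat (map (\<lambda>a. [fst (snd a), snd (snd a)]) d)"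
    by (induction d) auto
  have "decorate w q = d"
  proof (rule nth_equalityI)
    fix i assume "i < length (decorate w q)"
    then have i: "i < length d" by (simp add: decorate_def len)
    have "q (2 * i + 1) = fst (snd (d ! i))" "q (2 * i + 2) = snd (snd (d ! i))"
      using nth_concat_pairs[OF i, of "\<lambda>a. fst (snd a)" "\<lambda>a. snd (snd a)"] i
      by (simp_all add: q_def endp nth_append)
    then show "decorate w q ! i = d ! i"
      using i w by (simp add: decorate_def len)
  qed (simp add: decorate_def len)
  moreover have "q 0 = s" "q (2 * length w + 1) = t"
    by (simp_all add: q_def endp len nth_append)
  ultimately show "\<exists>q. index_drawing n w q"
    using d(2) by (auto simp: index_drawing_iff)
next
  assume "\<exists>q. index_drawing n w q"
  then show "drawable n w"
    unfolding drawable_def index_drawing_iff using map_fst_decorate by blast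
qed

lemma between_iff_separates:
  "c \<noteq> a \<Longrightarrow> c \<noteq> b \<Longrightarrow> between a b c \<longleftrightarrow> separates (int a) (int b) (int c)"
  by (auto simp: between_def separates_def)

text \<open>Only the relative order of the positions enters the conditions, so integer positions may
  be replaced by their ranks and conversely.\<close>

lemma planar_tuple_iff_index_drawing:
  "planar_tuple (whitehead_exp n w) \<longleftrightarrow> (\<exists>q. index_drawing n w q)"
proof
  let ?m = "length w" and ?c = "whitehead_exp n w"
  assume "planar_tuple (whitehead_exp n w)"
  then obtain \<pi> where bij: "bij_betw \<pi> {1..2 * ?m + 2} {1..2 * ?m + 2}"
    and mono: "\<forall>i\<in>{1..2 * ?m + 2}. \<forall>j\<in>{1..2 * ?m + 2}. \<pi> i < \<pi> j \<longrightarrow> ?c ! (i - 1) \<le> ?c ! (j - 1)"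
    and arcs: "\<forall>i\<in>{1..?m + 1}. \<forall>i'\<in>{1..?m + 1}. i \<noteq> i' \<longrightarrow>
          nested (\<pi> (2*i - 1)) (\<pi> (2*i)) (\<pi> (2*i' - 1)) (\<pi> (2*i'))"
    and cuts: "\<forall>i\<in>{1..?m}. \<forall>i'\<in>{1..?m}. i \<noteq> i' \<longrightarrow>
          nested (\<pi> (2*i)) (\<pi> (2*i + 1)) (\<pi> (2*i')) (\<pi> (2*i' + 1))"
    unfolding planar_tuple_def by (auto simp: Let_def)
  define q where "q i = int (\<pi> (i + 1))" for i
  have "inj_on q {..<2 * ?m + 2}"
  proof (rule inj_onI)
    fix i j assume "i \<in> {..<2 * ?m + 2}" "j \<in> {..<2 * ?m + 2}" "q i = q j"
    then show "i = j"
      using inj_onD[OF bij_betw_imp_inj_on[OF bij], of "i + 1" "j + 1"] by (auto simp: q_def)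
  qed
  moreover have "?c ! i \<le> ?c ! j" if "i < 2 * ?m + 2" "j < 2 * ?m + 2" "q i < q j" for i j
    using mono[rule_format, of "i + 1" "j + 1"] that by (auto simp: q_def)
  moreover have "separates (q (2 * i)) (q (2 * i + 1)) (q (2 * j)) = separates (q (2 * i)) (q (2 * i + 1)) (q (2 * j + 1))"
    if "i \<le> ?m" "j \<le> ?m" "i \<noteq> j" for i j
  proof -
    have "nested (\<pi> (2*i + 1)) (\<pi> (2*i + 2)) (\<pi> (2*j + 1)) (\<pi> (2*j + 2))"
      using arcs[rule_format, of "i + 1" "j + 1"] that by (auto simp: eval_nat_numeral)
    then show ?thesis
      using between_iff_separates by (auto simp: nested_def q_def)
  qed
  moreover have "separates (q (2 * i + 1)) (q (2 * i + 2)) (q (2 * j + 1)) = separates (q (2 * i + 1)) (q (2 * i + 2)) (q (2 * j + 2))"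
    if "i < ?m" "j < ?m" "i \<noteq> j" for i j
  proof -
    have "nested (\<pi> (2*i + 2)) (\<pi> (2*i + 3)) (\<pi> (2*j + 2)) (\<pi> (2*j + 3))"
      using cuts[rule_format, of "i + 1" "j + 1"] that by (auto simp: eval_nat_numeral)
    then show ?thesis
      using between_iff_separates by (auto simp: nested_def q_def eval_nat_numeral)
  qed
  ultimately have "index_drawing n w q"
    unfolding index_drawing_def by blast
  then show "\<exists>q. index_drawing n w q" by blast
next
  let ?m = "length w" and ?c = "whitehead_exp n w"
  assume "\<exists>q. index_drawing n w q"
  then obtain q where q: "index_drawing n w q" by blast
  define L where "L = 2 * ?m + 2"
  have inj: "inj_on q {..<L}" using q by (simp add: index_drawing_def L_def)
  \<comment> \<open>The rank of the position; the index is shifted because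
    \<open>planar_tuple\<close> counts from 1.\<close>
  define \<pi> where "\<pi> i = card {j. j < L \<and> q j \<le> q (i - 1)}" for i
  have less: "\<pi> i < \<pi> j \<longleftrightarrow> q (i - 1) < q (j - 1)" if "i \<in> {1..L}" "j \<in> {1..L}" for i j
  proof -
    have *: "\<pi> i < \<pi> j" if "q (i - 1) < q (j - 1)" "i \<in> {1..L}" "j \<in> {1..L}" for i j
      unfolding \<pi>_def
    proof (rule psubset_card_mono)
      have "j - 1 \<in> {k. k < L \<and> q k \<le> q (j - 1)} - {k. k < L \<and> q k \<le> q (i - 1)}"
        using that by auto
      moreover have "{k. k < L \<and> q k \<le> q (i - 1)} \<subseteq> {k. k < L \<and> q k \<le> q (j - 1)}"
        using that by auto
      ultimately show "{k. k < L \<and> q k \<le> q (i - 1)} \<subset> {k. k < L \<and> q k \<le> q (j - 1)}" by blast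
    qed simp
    have "\<pi> i = \<pi> j" if "q (i - 1) = q (j - 1)" for i j using that by (simp add: \<pi>_def)
    with * that show ?thesis by (metis less_asym linorder_neqE)
  qed
  have eq: "\<pi> i = \<pi> j \<longleftrightarrow> i = j" if "i \<in> {1..L}" "j \<in> {1..L}" for i j
  proof
    assume "\<pi> i = \<pi> j"
    then have "q (i - 1) = q (j - 1)" using less[OF that] less[OF that(2,1)] by auto
    then have "i - 1 = j - 1" using inj_onD[OF inj, of "i - 1" "j - 1"] that by auto
    with that show "i = j" by auto
  qed simp
  have bij: "bij_betw \<pi> {1..L} {1..L}"
  proof -
    have inj\<pi>: "inj_on \<pi> {1..L}" using eq by (auto simp: inj_on_def)
    have "\<pi> ` {1..L} \<subseteq> {1..L}"
    proof
      fix x assume "x \<in> \<pi> ` {1..L}"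
      then obtain i where i: "i \<in> {1..L}" "x = \<pi> i" by auto
      have "card {j. j < L \<and> q j \<le> q (i - 1)} \<le> card {..<L}" by (rule card_mono) auto
      moreover have "0 < card {j. j < L \<and> q j \<le> q (i - 1)}"
        using i by (subst card_gt_0_iff) (auto intro!: exI[of _ "i - 1"])
      ultimately show "x \<in> {1..L}" using i by (auto simp: \<pi>_def)
    qed
    with inj\<pi> show ?thesis by (simp add: bij_betw_def card_image card_subset_eq)
  qed
  have nested: "nested (\<pi> (a + 1)) (\<pi> (b + 1)) (\<pi> (c + 1)) (\<pi> (d + 1))"
    if "a < L" "b < L" "c < L" "d < L" "distinct [a, b, c, d]"
      "separates (q a) (q b) (q c) = separates (q a) (q b) (q d)" for a b c d
    using that unfolding nested_def
    by (simp add: eq between_iff_separates separates_def) (simp add: less)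
  have "\<forall>i\<in>{1..L}. \<forall>j\<in>{1..L}. \<pi> i < \<pi> j \<longrightarrow> ?c ! (i - 1) \<le> ?c ! (j - 1)"
  proof (intro ballI impI)
    fix i j assume "i \<in> {1..L}" "j \<in> {1..L}" "\<pi> i < \<pi> j"
    then show "?c ! (i - 1) \<le> ?c ! (j - 1)" using q less[of i j] unfolding index_drawing_def L_def[symmetric] by auto
  qed
  moreover have "\<forall>i\<in>{1..?m + 1}. \<forall>i'\<in>{1..?m + 1}. i \<noteq> i' \<longrightarrow>
          nested (\<pi> (2*i - 1)) (\<pi> (2*i)) (\<pi> (2*i' - 1)) (\<pi> (2*i'))"
  proof (intro ballI impI)
    fix i j assume i: "i \<in> {1..?m + 1}" and j: "j \<in> {1..?m + 1}" and "i \<noteq> j"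
    obtain i' where "i = i' + 1" using i by (metis atLeastAtMost_iff le_add_diff_inverse2)
    moreover obtain j' where "j = j' + 1" using j by (metis atLeastAtMost_iff le_add_diff_inverse2)
    moreover have "separates (q (2 * i')) (q (2 * i' + 1)) (q (2 * j')) = separates (q (2 * i')) (q (2 * i' + 1)) (q (2 * j' + 1))"
      using q calculation i j \<open>i \<noteq> j\<close> unfolding index_drawing_def by auto
    moreover have "distinct [2 * i', 2 * i' + 1, 2 * j', 2 * j' + 1]"
      using \<open>i \<noteq> j\<close> calculation by simp
    ultimately show "nested (\<pi> (2*i - 1)) (\<pi> (2*i)) (\<pi> (2*j - 1)) (\<pi> (2*j))"
      using nested[of "2 * i'" "2 * i' + 1" "2 * j'" "2 * j' + 1"] i j by (simp add: L_def)
  qed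
  moreover have "\<forall>i\<in>{1..?m}. \<forall>i'\<in>{1..?m}. i \<noteq> i' \<longrightarrow>
          nested (\<pi> (2*i)) (\<pi> (2*i + 1)) (\<pi> (2*i')) (\<pi> (2*i' + 1))"
  proof (intro ballI impI)
    fix i j assume i: "i \<in> {1..?m}" and j: "j \<in> {1..?m}" and "i \<noteq> j"
    obtain i' where "i = i' + 1" using i by (metis atLeastAtMost_iff le_add_diff_inverse2)
    moreover obtain j' where "j = j' + 1" using j by (metis atLeastAtMost_iff le_add_diff_inverse2)
    moreover have "separates (q (2 * i' + 1)) (q (2 * i' + 2)) (q (2 * j' + 1)) = separates (q (2 * i' + 1)) (q (2 * i' + 2)) (q (2 * j' + 2))"
      using q calculation i j \<open>i \<noteq> j\<close> unfolding index_drawing_def by auto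
    moreover have "distinct [2 * i' + 1, 2 * i' + 2, 2 * j' + 1, 2 * j' + 2]"
      using \<open>i \<noteq> j\<close> calculation by simp
    ultimately show "nested (\<pi> (2*i)) (\<pi> (2*i + 1)) (\<pi> (2*j)) (\<pi> (2*j + 1))"
      using nested[of "2 * i' + 1" "2 * i' + 2" "2 * j' + 1" "2 * j' + 2"] i j by (simp add: L_def)
  qed
  ultimately show "planar_tuple ?c"
    unfolding planar_tuple_def Let_def using bij
    by (intro exI[of _ \<pi>]) (simp add: L_def)
qed

lemma planar_iff_drawable: "planar n w \<longleftrightarrow> drawable n (reduce w)"
  by (simp add: planar_def planar_tuple_iff_index_drawing drawable_iff_index_drawing)

section \<open>Removing cancelling pairs\<close>

declare code.simps [simp del] inv_letter.simps [simp del]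

text \<open>Flattening lets a single \<open>distinct\<close> say that all endpoints of all pairs
  differ.\<close>

definition pts :: "(int \<times> int) list \<Rightarrow> int list" where
  "pts xs = concat (map (\<lambda>(a, b). [a, b]) xs)"

lemma pts_simps [simp]: "pts [] = []" "pts ((a, b) # xs) = a # b # pts xs" "pts (xs @ ys) = pts xs @ pts ys"
  by (simp_all add: pts_def)

lemma in_set_pts: "(a, b) \<in> set xs \<Longrightarrow> a \<in> set (pts xs) \<and> b \<in> set (pts xs)"
  by (induction xs) auto

lemma in_set_ptsD: "x \<in> set (pts xs) \<Longrightarrow> \<exists>y. (x, y) \<in> set xs \<or> (y, x) \<in> set xs"
proof (induction xs)
  case (Cons e xs)
  obtain a b where "e = (a, b)" by (cases e)
  with Cons consider "x = a" | "x = b" | "\<exists>y. (x, y) \<in> set xs \<or> (y, x) \<in> set xs" by auto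
  then show ?case using \<open>e = (a, b)\<close> by cases auto
qed simp

lemma distinct_pts_pair: "distinct (pts xs) \<Longrightarrow> (a, b) \<in> set xs \<Longrightarrow> a \<noteq> b"
  by (induction xs) auto

lemma distinct_pts_unique:
  assumes "distinct (pts xs)" "(a, b) \<in> set xs" "(c, d) \<in> set xs" "(a, b) \<noteq> (c, d)"
  shows "distinct [a, b, c, d]"
  using assms
proof (induction xs)
  case (Cons e xs)
  then show ?case using in_set_pts[of a b xs] in_set_pts[of c d xs] distinct_pts_pair[of xs]
    by (cases e) auto
qed simp

lemma pts_arcs: "pts (arcs s d t) = s # endpoints d @ [t]"
  by (induction s d t rule: arcs.induct) auto

lemma endpoints_eq_pts: "endpoints d = pts (map snd d)"
  by (induction d) auto

lemma arcs_append: "\<exists>A b. \<forall>d' t. arcs s (d @ d') t = A @ arcs b d' t"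
proof (induction d arbitrary: s)
  case Nil
  show ?case by (auto intro: exI[of _ "[]"])
next
  case (Cons e d)
  obtain a p q where e: "e = (a, p, q)" by (cases e)
  from Cons[of q] obtain A b where A: "\<forall>d' t. arcs q (d @ d') t = A @ arcs b d' t" by auto
  show ?case
    by (intro exI[of _ "(s, p) # A"] exI[of _ b]) (simp add: e A)
qed

lemma arcs_first: "\<exists>c A. \<forall>s. arcs s d t = (s, c) # A"
  by (cases d) auto

text \<open>Away from the two ends, every arc joins two consecutive letters; this is how an arc
  inside one block is recognised as a cancelling pair.\<close>

lemma arcs_cases:
  assumes "(g, h) \<in> set (arcs s d t)"
  obtains "g = s" | "h = t" | d1 a p b q d2 where "d = d1 @ (a, p, g) # (b, h, q) # d2"
proof -
  have "g = s \<and> (\<exists>b q d2. d = (b, h, q) # d2) \<or> h = t \<or> (\<exists>d1 a p b q d2. d = d1 @ (a, p, g) # (b, h, q) # d2)"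
    using assms
  proof (induction d arbitrary: s)
    case (Cons e d)
    obtain a p q where e: "e = (a, p, q)" by (cases e)
    consider "g = s" "h = p" | "(g, h) \<in> set (arcs q d t)" using Cons.prems e by auto
    then show ?case
    proof cases
      case 2
      from Cons.IH[OF this] consider b q' d2 where "g = q" "d = (b, h, q') # d2" | "h = t"
        | d1 a p b q d2 where "d = d1 @ (a, p, g) # (b, h, q) # d2"
        by blast
      then show ?thesis
      proof cases
        case (1 b q' d2)
        then have "e # d = [] @ (a, p, g) # (b, h, q') # d2" by (simp add: e)
        then show ?thesis by blast
      next
        case (3 d1 a p b q d2)
        then have "e # d = (e # d1) @ (a, p, g) # (b, h, q) # d2" by simp
        then show ?thesis by blast
      qed auto
    qed (use e in auto)
  qed auto
  then show ?thesis using that by blast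
qed

lemma labels_eq_zip: "labels n s d t = set (zip (s # endpoints d @ [t]) (whitehead_exp n (map fst d)))"
proof -
  have "set (zip (endpoints d @ [t]) (concat (map (\<lambda>a. [code a, code (inv_letter a)]) (map fst d)) @ [c]))
     = insert (t, c) (\<Union>(a, p, q)\<in>set d. {(p, code a), (q, code (inv_letter a))})" for c
    by (induction d) (auto simp del: map_map)
  then show ?thesis by (simp add: labels_def whitehead_exp_def insert_commute del: map_map)
qed

lemma labels_unique:
  assumes "distinct (s # endpoints d @ [t])" "(p, c) \<in> labels n s d t" "(p, c') \<in> labels n s d t"
  shows "c = c'"
  using assms unfolding labels_eq_zip by (metis eq_key_imp_eq_value map_fst_zip_take distinct_take distinct_map)

lemma code_eq_iff:
  "fst a \<ge> 1 \<Longrightarrow> fst b \<ge> 1 \<Longrightarrow> code a = code b \<longleftrightarrow> a = b"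
  by (cases a; cases b; auto simp: code.simps; presburger)

lemma code_bounds: "fst a \<in> {1..n} \<Longrightarrow> 1 \<le> code a \<and> code a \<le> 2 * n"
  by (cases a) (auto simp: code.simps)

lemma drawing_label_mono:
  "drawing n s d t \<Longrightarrow> (p, c) \<in> labels n s d t \<Longrightarrow> (p', c') \<in> labels n s d t \<Longrightarrow> p < p' \<Longrightarrow> c \<le> c'"
  unfolding drawing_def by fast

lemma noncrossingD:
  "noncrossing E \<Longrightarrow> (a, b) \<in> E \<Longrightarrow> (c, d) \<in> E \<Longrightarrow> (a, b) \<noteq> (c, d) \<Longrightarrow> separates a b c = separates a b d"
  unfolding noncrossing_def by fast

lemma noncrossingI:
  assumes "\<And>a b c d. (a, b) \<in> E \<Longrightarrow> (c, d) \<in> E \<Longrightarrow> (a, b) \<noteq> (c, d) \<Longrightarrow> separates a b c = separates a b d"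
  shows "noncrossing E"
  unfolding noncrossing_def using assms by (auto split: prod.splits)

lemma noncrossing_mono: "noncrossing E \<Longrightarrow> E' \<subseteq> E \<Longrightarrow> noncrossing E'"
  by (rule noncrossingI) (meson noncrossingD subsetD)

lemma noncrossing_insert:
  assumes "noncrossing E"
    and "\<And>g h. (g, h) \<in> E \<Longrightarrow> separates a b g = separates a b h \<and> separates g h a = separates g h b"
  shows "noncrossing (insert (a, b) E)"
proof (rule noncrossingI)
  fix u v x y assume "(u, v) \<in> insert (a, b) E" "(x, y) \<in> insert (a, b) E" "(u, v) \<noteq> (x, y)"
  then consider "(u, v) = (a, b)" "(x, y) \<in> E" | "(u, v) \<in> E" "(x, y) = (a, b)" | "(u, v) \<in> E" "(x, y) \<in> E" by blast
  then show "separates u v x = separates u v y"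
    by cases (use assms(2) noncrossingD[OF assms(1), of u v x y] \<open>(u, v) \<noteq> (x, y)\<close> in auto)
qed

lemma labels_letter:
  "(a, p, q) \<in> set d \<Longrightarrow> (p, code a) \<in> labels n s d t \<and> (q, code (inv_letter a)) \<in> labels n s d t"
  by (force simp: labels_def)

lemma labels_ends: "(s, 0) \<in> labels n s d t" "(t, 2 * n + 1) \<in> labels n s d t"
  by (simp_all add: labels_def)

lemma labels_position: "x \<in> set (s # endpoints d @ [t]) \<Longrightarrow> \<exists>c. (x, c) \<in> labels n s d t"
  unfolding labels_def endpoints_def by fastforce

text \<open>Take a cancelling pair whose connecting arc from \<open>q\<close> to \<open>p'\<close>
  has least span. A position between \<open>q\<close> and \<open>p'\<close> would carry the same
  label as these, and so would the other end of its arc, which gives a cancelling pair of smaller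
  span. Nor does anything lie between \<open>p\<close> and \<open>q'\<close>, since its crossing
  would end between \<open>q\<close> and \<open>p'\<close>. The arcs at \<open>p\<close> and
  \<open>q'\<close> thus end side by side and can be joined.\<close>

lemma drawing_remove_cancelling_pair:
  assumes dr: "drawing n s d t" and ov: "over n (map fst d)" and "\<not> reduced (map fst d)"
  shows "\<exists>d'. length d' < length d \<and> drawing n s d' t \<and> over n (map fst d') \<and>
           reduce (map fst d') = reduce (map fst d)"
proof -
  let ?E = "set (arcs s d t)"
  \<comment> \<open>\<open>C\<close> describes the places of cancelling pairs, and \<open>m\<close>
    is the span of the arc joining the two letters.\<close>
  define C where "C = (\<lambda>(d1, a, p, q, p', q', d2). d = d1 @ (a, p, q) # (inv_letter a, p', q') # d2)"
  define m where "m = (\<lambda>(d1 :: dletter list, a :: letter, p :: int, q, p', q' :: int, d2 :: dletter list). nat \<bar>q - p'\<bar>)"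
  have "\<exists>x. C x"
  proof -
    obtain i where i: "Suc i < length d" "fst (d ! Suc i) = inv_letter (fst (d ! i))"
      using assms(3) by (auto simp: reduced_def)
    have "d = take i d @ d ! i # d ! Suc i # drop (Suc (Suc i)) d"
      using i by (metis Cons_nth_drop_Suc Suc_lessD append_take_drop_id)
    moreover obtain a p q where "d ! i = (a, p, q)" by (cases "d ! i")
    moreover obtain b p' q' where "d ! Suc i = (b, p', q')" by (cases "d ! Suc i")
    ultimately have "C (take i d, a, p, q, p', q', drop (Suc (Suc i)) d)"
      using i by (simp add: C_def)
    then show ?thesis by blast
  qed
  then obtain x1 where "C x1" by blast
  from ex_has_least_nat[of C, OF this, of m]
  obtain x0 where x0: "C x0" and min: "\<And>y. C y \<Longrightarrow> m x0 \<le> m y" by blast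
  obtain d1 a p q p' q' d2 where x0_def: "x0 = (d1, a, p, q, p', q', d2)" by (cases x0)
  have d: "d = d1 @ (a, p, q) # (inv_letter a, p', q') # d2" using x0 by (simp add: x0_def C_def)
  let ?L = "labels n s d t"
  have dist: "distinct (s # endpoints d @ [t])" using dr by (simp add: drawing_def)
  obtain A1 b where A1: "\<And>d' t. arcs s (d1 @ d') t = A1 @ arcs b d' t"
    using arcs_append by metis
  obtain c A2 where A2: "\<And>s. arcs s d2 t = (s, c) # A2"
    using arcs_first by metis
  have E: "arcs s d t = A1 @ [(b, p), (q, p'), (q', c)] @ A2"
    unfolding d A1 by (simp add: A2)
  have distE: "distinct (pts (A1 @ [(b, p), (q, p'), (q', c)] @ A2))"
    using dist pts_arcs[of s d t] E by simp
  have ncE: "noncrossing ?E" and ncd: "noncrossing (snd ` set d)"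
    using dr by (simp_all add: drawing_def)
  have mono: "\<And>x c y c'. (x, c) \<in> ?L \<Longrightarrow> (y, c') \<in> ?L \<Longrightarrow> x < y \<Longrightarrow> c \<le> c'"
    using drawing_label_mono[OF dr] .
  have fa: "fst a \<in> {1..n}" using ov d by simp
  have lab: "(p, code a) \<in> ?L" "(q, code (inv_letter a)) \<in> ?L"
     "(p', code (inv_letter a)) \<in> ?L" "(q', code a) \<in> ?L"
    using labels_letter[of a p q d n s t] labels_letter[of "inv_letter a" p' q' d n s t]
    by (auto simp: d)
  have fst_ge: "fst a' \<in> {1..n}" if "(a', x, y) \<in> set d" for a' x y
    using ov that by (force simp: over_def)
  have no_between: False if g: "g \<in> set (s # endpoints d @ [t])" "(q < g \<and> g < p') \<or> (p' < g \<and> g < q)" for g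
  proof -
    obtain h where h: "(g, h) \<in> ?E \<or> (h, g) \<in> ?E"
      using g(1) in_set_ptsD[of g "arcs s d t"] unfolding pts_arcs by blast
    have *: "(q, p') \<in> ?E" using E by simp
    have "h \<noteq> q \<and> h \<noteq> p' \<and> separates q p' g = separates q p' h"
      using h
    proof
      assume gh: "(g, h) \<in> ?E"
      have "(q, p') \<noteq> (g, h)" using g(2) by auto
      with distinct_pts_unique[OF _ * gh] noncrossingD[OF ncE * gh] dist show ?thesis
        by (simp add: pts_arcs)
    next
      assume hg: "(h, g) \<in> ?E"
      have "(q, p') \<noteq> (h, g)" using g(2) by auto
      with distinct_pts_unique[OF _ * hg] noncrossingD[OF ncE * hg] dist show ?thesis
        by (simp add: pts_arcs)
    qed
    then have h2: "(q < h \<and> h < p') \<or> (p' < h \<and> h < q)"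
      using g(2) by (auto simp: separates_def)
    have lab_between: "c' = code (inv_letter a)" if "(x, c') \<in> ?L" "(q < x \<and> x < p') \<or> (p' < x \<and> x < q)" for x c'
      using that(2) mono[OF that(1) lab(2)] mono[OF that(1) lab(3)] mono[OF lab(2) that(1)] mono[OF lab(3) that(1)]
      by linarith
    have code_ne: "1 \<le> code (inv_letter a)" "code (inv_letter a) \<le> 2 * n"
      using code_bounds[of "inv_letter a" n] fa by auto
    obtain u v where uv: "(u, v) \<in> ?E" "(q < u \<and> u < p') \<or> (p' < u \<and> u < q)" "(q < v \<and> v < p') \<or> (p' < v \<and> v < q)"
      using h h2 g(2) by blast
    from uv(1) show False
    proof (cases rule: arcs_cases)
      case 1
      then show False using lab_between[of s 0] uv(2) code_ne labels_ends(1)[of s n d t] labels_ends(2)[of t n s d] by auto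
    next
      case 2
      then show False using lab_between[of t "2 * n + 1"] uv(3) code_ne labels_ends(1)[of s n d t] labels_ends(2)[of t n s d] by auto
    next
      case (3 d1' a1 p1 b1 q1 d2')
      then have m: "(a1, p1, u) \<in> set d" "(b1, v, q1) \<in> set d" by auto
      then have "code (inv_letter a1) = code (inv_letter a)" "code b1 = code (inv_letter a)"
        using lab_between uv(2,3) labels_letter by blast+
      then have "code b1 = code (inv_letter a1)" by simp
      then have "b1 = inv_letter a1"
        using fst_ge[OF m(1)] fst_ge[OF m(2)] by (subst (asm) code_eq_iff) auto
      then have "C (d1', a1, p1, u, v, q1, d2')" using 3 by (simp add: C_def)
      from min[OF this] show False using uv(2,3) by (auto simp: x0_def m_def)
    qed
  qed
  have no_between': False if g: "g \<in> set (s # endpoints d @ [t])" "(p < g \<and> g < q') \<or> (q' < g \<and> g < p)" for g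
  proof -
    have lab_between: "c' = code a" if "(g, c') \<in> ?L" for c'
      using g(2) mono[OF that lab(1)] mono[OF that lab(4)] mono[OF lab(1) that] mono[OF lab(4) that]
      by linarith
    have code_ne: "1 \<le> code a" "code a \<le> 2 * n"
      using code_bounds[of a n] fa by auto
    have "g \<noteq> s" "g \<noteq> t" using lab_between labels_ends(1)[of s n d t] labels_ends(2)[of t n s d] code_ne by fastforce+
    then have "g \<in> set (pts (map snd d))" using g(1) by (simp add: endpoints_eq_pts)
    then obtain h where h: "(g, h) \<in> set (map snd d) \<or> (h, g) \<in> set (map snd d)" using in_set_ptsD by blast
    have distd: "distinct (pts (map snd d))" using dist by (simp add: endpoints_eq_pts)
    have hlab: "(h, code (inv_letter a)) \<in> ?L"
      using h
    proof
      assume "(g, h) \<in> set (map snd d)"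
      then obtain b' where b': "(b', g, h) \<in> set d" by auto
      have "code b' = code a" using labels_letter[OF b'] lab_between by blast
      then have "b' = a" using fst_ge[OF b'] fa by (subst (asm) code_eq_iff) auto
      then show ?thesis using labels_letter[OF b'] by auto
    next
      assume "(h, g) \<in> set (map snd d)"
      then obtain b' where b': "(b', h, g) \<in> set d" by auto
      have "code (inv_letter b') = code a" using labels_letter[OF b'] lab_between by blast
      then have "inv_letter b' = a" using fst_ge[OF b'] fa by (subst (asm) code_eq_iff) auto
      then have "b' = inv_letter a" by auto
      then show ?thesis using labels_letter[OF b'] by auto
    qed
    have glab: "(g, code a) \<in> ?L" using labels_position[OF g(1)] lab_between by blast
    have h_pos: "h \<in> set (s # endpoints d @ [t])" 
      using h in_set_pts[of g h "map snd d"] in_set_pts[of h g "map snd d"]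
      by (auto simp: endpoints_eq_pts simp del: set_map)
    have ne: "code a \<noteq> code (inv_letter a)" using fa by (subst code_eq_iff) auto
    have g_ne: "g \<noteq> p" "g \<noteq> q" "g \<noteq> p'" "g \<noteq> q'"
      using g(2) lab_between lab(2,3) ne by auto
    have m1: "(p, q) \<in> snd ` set d" "(p', q') \<in> snd ` set d" by (auto simp: d image_iff)
    have pair: "distinct [x, y, u, v] \<and> separates x y u = separates x y v"
      if "(x, y) \<in> snd ` set d" "(u, v) \<in> snd ` set d" "(x, y) \<noteq> (u, v)" for x y u v
      using distinct_pts_unique[OF distd, of x y u v] noncrossingD[OF ncd that] that by simp
    have *: "distinct [p, q, g, h] \<and> distinct [p', q', g, h] \<and> separates p q g = separates p q h \<and> separates p' q' g = separates p' q' h"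
      using h
    proof
      assume gh: "(g, h) \<in> set (map snd d)"
      have "(p, q) \<noteq> (g, h)" "(p', q') \<noteq> (g, h)" using g_ne by auto
      with pair[OF m1(1), of g h] pair[OF m1(2), of g h] gh show ?thesis by simp
    next
      assume hg: "(h, g) \<in> set (map snd d)"
      have "(p, q) \<noteq> (h, g)" "(p', q') \<noteq> (h, g)" using g_ne by auto
      with pair[OF m1(1), of h g] pair[OF m1(2), of h g] hg show ?thesis by auto
    qed
    have order: "(x < y) = (code a < code (inv_letter a))" if "(x, code a) \<in> ?L" "(y, code (inv_letter a)) \<in> ?L" for x y
    proof -
      have "x \<noteq> y" using labels_unique[OF dist that(1)] that(2) ne by blast
      then show ?thesis using mono[OF that] mono[OF that(2,1)] ne by linarith
    qed
    \<comment> \<open>The blocks of \<open>a\<close> and of its inverse are disjoint intervals, so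
      crossings between them are nested about the gap: one that starts between \<open>p\<close> and
      \<open>q'\<close> ends between \<open>q\<close> and \<open>p'\<close>.\<close>
    have "(q < h \<and> h < p') \<or> (p' < h \<and> h < q)"
      using g(2) * order[OF glab lab(2)] order[OF glab lab(3)] order[OF glab hlab]
        order[OF lab(1) lab(2)] order[OF lab(1) lab(3)] order[OF lab(1) hlab]
        order[OF lab(4) lab(2)] order[OF lab(4) lab(3)] order[OF lab(4) hlab]
      unfolding separates_def by (cases "code a < code (inv_letter a)") (simp, smt (verit))+
    with no_between[OF h_pos] show False by blast
  qed
  have "drawing n s (d1 @ d2) t"
    unfolding drawing_def
  proof (intro conjI)
    show "distinct (s # endpoints (d1 @ d2) @ [t])" using dist by (auto simp: d)
    have "labels n s (d1 @ d2) t \<subseteq> ?L" by (auto simp: labels_def d)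
    then show "\<forall>(x, c)\<in>labels n s (d1 @ d2) t. \<forall>(x', c')\<in>labels n s (d1 @ d2) t. x < x' \<longrightarrow> c \<le> c'"
      using mono by blast
    show "noncrossing (snd ` set (d1 @ d2))"
      by (rule noncrossing_mono[OF ncd]) (auto simp: d)
    have E': "set (arcs s (d1 @ d2) t) = insert (b, c) (set A1 \<union> set A2)"
      by (simp add: A1 A2)
    have key: "separates b c g = separates b c h \<and> separates g h b = separates g h c"
      if "(g, h) \<in> set A1 \<union> set A2" for g h
    proof -
      have gh: "(g, h) \<in> ?E" using that E by auto
      have bp: "(b, p) \<in> ?E" "(q', c) \<in> ?E" using E by auto
      have ne: "g \<notin> {b, p, q', c}" "h \<notin> {b, p, q', c}"
        using distE that in_set_pts[of g h A1] in_set_pts[of g h A2] by auto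
      have pos: "g \<in> set (s # endpoints d @ [t])" "h \<in> set (s # endpoints d @ [t])"
        using in_set_pts[OF gh] unfolding pts_arcs by auto
      have side: "(g < p) = (g < q')" "(h < p) = (h < q')"
        using no_between'[OF pos(1)] no_between'[OF pos(2)] ne
        by (metis insertI1 insertI2 linorder_neqE)+
      have "(g, h) \<noteq> (b, p)" "(g, h) \<noteq> (q', c)" using ne by auto
      then have *: "separates b p g = separates b p h" "separates q' c g = separates q' c h"
        "separates g h b = separates g h p" "separates g h q' = separates g h c"
        using noncrossingD[OF ncE bp(1) gh] noncrossingD[OF ncE bp(2) gh]
          noncrossingD[OF ncE gh bp(1)] noncrossingD[OF ncE gh bp(2)] by auto
      \<comment> \<open>Additivity of \<open>separates\<close>: the gap between \<open>p\<close> and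
        \<open>q'\<close> contributes nothing because \<open>x\<close> is not in it.\<close>
      have merge: "separates b c x \<longleftrightarrow> separates b p x \<noteq> separates q' c x" if "(x < p) = (x < q')" "x \<notin> {b, p, q', c}" for x
      proof -
        have "(p < x) = (q' < x)" using that by auto
        then show ?thesis unfolding separates_def by blast
      qed
      have "separates b c g = separates b c h"
        using merge[OF side(1) ne(1)] merge[OF side(2) ne(2)] *(1,2) by simp
      moreover have "separates g h p = separates g h q'" by (simp add: separates_def side)
      ultimately show ?thesis using *(3,4) by simp
    qed
    have "noncrossing (set A1 \<union> set A2)"
      by (rule noncrossing_mono[OF ncE]) (auto simp: E)
    then show "noncrossing (set (arcs s (d1 @ d2) t))"
      unfolding E' by (rule noncrossing_insert) (rule key)
  qed
  moreover have "reduce (map fst (d1 @ d2)) = reduce (map fst d)"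
    using reduce_cancel_pair[of "map fst d1" a "map fst d2"] by (simp add: d)
  moreover have "over n (map fst (d1 @ d2))" using ov by (simp add: d)
  moreover have "length (d1 @ d2) < length d" by (simp add: d)
  ultimately show ?thesis by blast
qed

lemma drawable_reduce:
  assumes "over n w" "drawable n w"
  shows "drawable n (reduce w)"
proof -
  have "drawable n (reduce (map fst d))" if "drawing n s d t" "over n (map fst d)" for s d t
    using that
  proof (induction "length d" arbitrary: d rule: less_induct)
    case less
    show ?case
    proof (cases "reduced (map fst d)")
      case True
      then show ?thesis using less.prems unfolding drawable_def by auto
    next
      case False
      then show ?thesis using drawing_remove_cancelling_pair[OF less.prems] less.hyps by metis
    qed
  qed
  with assms show ?thesis by (auto simp: drawable_def)
qed

section \<open>Elementary braids act on drawings\<close>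

text \<open>Artin's generator of the braid group: the images of \<open>t_i\<close> and
  \<open>t_{i+1}\<close> have the product \<open>t_i t_{i+1}\<close> again, which keeps
  \<open>z1\<close> fixed.\<close>

definition sig :: "nat \<Rightarrow> nat \<Rightarrow> word" where
  "sig i k = (if k = i then gen (i + 1)
     else if k = i + 1 then [(i + 1, True), (i, False), (i + 1, False)] else gen k)"

definition sig_inv :: "nat \<Rightarrow> nat \<Rightarrow> word" where
  "sig_inv i k = (if k = i then [(i, False), (i + 1, False), (i, True)]
     else if k = i + 1 then gen i else gen k)"

lemma labels_finite: "finite (labels n s d t)"
  by (auto simp: labels_def)

lemma separates_commute: "separates a b c = separates b a c"
  by (auto simp: separates_def)

text \<open>All pairs \<open>x\<close>, \<open>2 * N - x\<close> have the midpoint \<open>N\<close>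
  and are therefore nested. The inserted arcs have this form; the concentric version below serves
  the crossings with midpoint \<open>2 * N\<close>.\<close>

lemma separates_reflect:
  "x < N \<Longrightarrow> y < N \<Longrightarrow> x \<noteq> y \<Longrightarrow> separates x (2 * N - x) y = separates x (2 * N - x) (2 * N - y)"
  by (auto simp: separates_def)

lemma separates_concentric:
  fixes x y M :: int
  shows "0 < x \<Longrightarrow> 0 < y \<Longrightarrow> x \<noteq> y \<Longrightarrow> separates (M + x) (M - x) (M + y) = separates (M + x) (M - x) (M - y)"
  by (auto simp: separates_def)

lemma code_simps:
  "code (k, False) = 2 * k - 1" "code (k, True) = 2 * k"
  by (simp_all add: code.simps)

text \<open>
  All positions from the block \<open>t_i\<close> onwards are shifted by \<open>2N\<close>, and the freed interval takes the new
  crossings: the position \<open>x\<close> (measured from \<open>T\<close>) of a half-edge \<open>t_{i+1}\<close> or of its inverse is copied to \<open>x\<close>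
  in the new blocks of the \<open>i\<close>-th generator and reflected to \<open>2N - x\<close> in the new block \<open>t_{i+1}\<close>.
\<close>

lemma drawable_sig:
  assumes i: "1 \<le> i" "i < n" and ov: "over n w" and dw: "drawable n w"
  shows "drawable n (subst (sig i) w)"
proof -
  obtain s d t where w: "map fst d = w" and dr: "drawing n s d t"
    using dw by (auto simp: drawable_def)
  let ?L = "labels n s d t"
  have dist: "distinct (s # endpoints d @ [t])" using dr by (simp add: drawing_def)
  have ncE: "noncrossing (set (arcs s d t))" and ncd: "noncrossing (snd ` set d)"
    using dr by (simp_all add: drawing_def)
  have mono: "\<And>x c y c'. (x, c) \<in> ?L \<Longrightarrow> (y, c') \<in> ?L \<Longrightarrow> x < y \<Longrightarrow> c \<le> c'"
    using drawing_label_mono[OF dr] .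
  have fst_ge: "fst a \<in> {1..n}" if "(a, x, y) \<in> set d" for a x y
    using ov that unfolding w[symmetric] by (force simp: over_def)
  \<comment> \<open>\<open>T\<close> is going to be the last position before the block of
    \<open>t_i\<close>; the set is nonempty because it contains \<open>s\<close>.\<close>
  define lower where "lower = fst ` {(p, c) \<in> ?L. c < 2 * i - 1}"
  have fin: "finite lower" unfolding lower_def
    by (intro finite_imageI finite_subset[OF _ labels_finite]) auto
  have sl: "s \<in> lower" using i by (force simp: lower_def labels_def)
  define T where "T = Max lower"
  have T: "p \<le> T \<longleftrightarrow> c < 2 * i - 1" if pc: "(p, c) \<in> ?L" for p c
  proof
    assume "c < 2 * i - 1"
    then have "p \<in> lower" using pc by (force simp: lower_def)
    then show "p \<le> T" using fin by (simp add: T_def)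
  next
    assume pT: "p \<le> T"
    have "T \<in> lower" using fin sl Max_in T_def by blast
    then obtain c' where c': "(T, c') \<in> ?L" "c' < 2 * i - 1" by (auto simp: lower_def)
    show "c < 2 * i - 1"
    proof (cases "p = T")
      case True
      then show ?thesis using labels_unique[OF dist pc] c' by auto
    next
      case False
      then show ?thesis using mono[OF pc c'(1)] c'(2) pT by auto
    qed
  qed
  \<comment> \<open>\<open>N\<close> exceeds every relative position, so the copies of half-edges
    beyond \<open>T\<close> lie strictly between 0 and \<open>N\<close>, and their reflections
    strictly between \<open>N\<close> and \<open>2 * N\<close>.\<close>
  define N where "N = Max ((\<lambda>(p, c). p - T) ` ?L) + 1"
  have N: "p - T < N" if "(p, c) \<in> ?L" for p c
  proof -
    have "p - T \<le> Max ((\<lambda>(p, c). p - T) ` ?L)"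
      using that labels_finite by (intro Max_ge) force+
    then show ?thesis by (simp add: N_def)
  qed
  define ext where "ext p = (if p \<le> T then p - T else p - T + 2 * N)" for p
  define r where "r p = p - T" for p
  \<comment> \<open>Both signs of \<open>t_{i+1}\<close> yield the same outer letters. The sign sits
    on the middle letter, whose crossing is a copy of the old one, while the outer crossings join a
    shifted position to its own reflection.\<close>
  define F :: "dletter \<Rightarrow> dletter list" where
    "F = (\<lambda>(a, p, q). if fst a = i + 1
        then [((i + 1, True), ext p, 2 * N - r p), ((i, snd a), r p, r q), ((i + 1, False), 2 * N - r q, ext q)]
        else if fst a = i then [((i + 1, snd a), ext p, ext q)] else [(a, ext p, ext q)])"
  define d' where "d' = concat (map F d)"
  define B where "B = {p. \<exists>c. (p, c) \<in> ?L \<and> (c = 2 * i + 1 \<or> c = 2 * i + 2)}"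
  have B: "T < p" "0 < r p" "r p < N" if "p \<in> B" for p
    using that T N by (force simp: B_def r_def)+
  have NT: "0 < N" using N[OF labels_ends(2)] T[OF labels_ends(2)] i by auto
  have BI: "p \<in> B \<and> q \<in> B" if "(a, p, q) \<in> set d" "fst a = i + 1" for a p q
    using labels_letter[OF that(1), of n s t] that(2) unfolding B_def
    by (cases a; cases "snd a") (auto simp: code_simps inv_letter.simps)
  have ext_less [simp]: "ext x < ext y \<longleftrightarrow> x < y" for x y
    using NT by (auto simp: ext_def)
  have ext_eq [simp]: "ext x = ext y \<longleftrightarrow> x = y" for x y
    using ext_less[of x y] ext_less[of y x] by linarith
  have sep_ext [simp]: "separates (ext a) (ext b) (ext c) = separates a b c" for a b c
    by (simp add: separates_def)
  have ext_low: "ext x < y \<longleftrightarrow> x \<le> T" "y < ext x \<longleftrightarrow> T < x" "ext x \<noteq> y" if "0 < y" "y < 2 * N" for x y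
    using that by (auto simp: ext_def)
  have Bext: "ext p = 2 * N + r p" if "p \<in> B" for p
    using B[OF that] by (simp add: ext_def r_def)
  have word: "map fst d' = subst (sig i) w"
  proof -
    have "map fst (F e) = subst_letter (sig i) (fst e)" for e
      by (cases e; cases "fst e"; cases "snd (fst e)")
        (auto simp: F_def subst_letter_def sig_def gen_def inv_letter.simps)
    then show ?thesis
      unfolding d'_def w[symmetric] subst_def by (simp add: map_concat comp_def)
  qed
  have arcs': "set (arcs (ext s') (concat (map F e)) (ext t)) = (\<lambda>(a, b). (ext a, ext b)) ` set (arcs s' e t) \<union>
     (\<Union>(a, p, q)\<in>{x \<in> set e. fst (fst x) = i + 1}. {(2 * N - r p, r p), (r q, 2 * N - r q)})" for e s'
    by (induction s' e t rule: arcs.induct) (auto simp: F_def)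
  have cross': "\<exists>a p q. (a, p, q) \<in> set d \<and> (if fst a = i + 1
      then e = (ext p, 2 * N - r p) \<or> e = (r p, r q) \<or> e = (2 * N - r q, ext q) else e = (ext p, ext q))"
    if "e \<in> snd ` set d'" for e
  proof -
    from that obtain x y where x: "x \<in> set d" "y \<in> set (F x)" "e = snd y" by (auto simp: d'_def)
    obtain a p q where apq: "x = (a, p, q)" by (cases x)
    show ?thesis
      using x unfolding apq by (intro exI[of _ a] exI[of _ p] exI[of _ q]) (auto simp: F_def split: if_splits)
  qed
  \<comment> \<open>\<open>g\<close> relabels the shifted old half-edges: \<open>t_i\<close> is
    renamed to \<open>t_{i+1}\<close>, and both sides of an old \<open>t_{i+1}\<close> now carry the
    inverse of \<open>t_{i+1}\<close>, because the image begins with that inverse and ends with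
    \<open>t_{i+1}\<close>.\<close>
  define g where "g c = (if c < 2 * i - 1 then c else if c = 2 * i - 1 then 2 * i + 1
          else if c \<le> 2 * i + 2 then 2 * i + 2 else c)" for c
  have g_val: "g (2 * i - 1) = 2 * i + 1" "g (2 * i) = 2 * i + 2" "g (2 * i + 1) = 2 * i + 2" "g (2 * i + 2) = 2 * i + 2"
    "\<And>c. c < 2 * i - 1 \<Longrightarrow> g c = c" "\<And>c. c > 2 * i + 2 \<Longrightarrow> g c = c"
    using i by (auto simp: g_def)
  define new_label where "new_label p' c' \<longleftrightarrow> (\<exists>p c. (p, c) \<in> ?L \<and> (p' = ext p \<and> c' = g c \<or>
      (c = 2 * i + 1 \<or> c = 2 * i + 2) \<and> (p' = r p \<and> c' = c - 2 \<or> p' = 2 * N - r p \<and> c' = 2 * i + 1)))" for p' c'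
  let ?A = "set (arcs (ext s) d' (ext t))"
  have labels': "new_label p' c'" if new: "(p', c') \<in> labels n (ext s) d' (ext t)" for p' c'
  proof -
    have extI: "new_label (ext p) c'" if "(p, c) \<in> ?L" "c' = g c" for p c c'
      using that unfolding new_label_def by blast
    have intI: "new_label (r p) (c - 2)" "new_label (2 * N - r p) (2 * i + 1)"
      if "(p, c) \<in> ?L" "c = 2 * i + 1 \<or> c = 2 * i + 2" for p c
      using that unfolding new_label_def by blast+
    have letters: "new_label p (code a) \<and> new_label q (code (inv_letter a))"
      if "(a, p, q) \<in> set (F (b, x, y))" "(b, x, y) \<in> set d" for a p q b x y
    proof -
      have lab: "(x, code b) \<in> ?L" "(y, code (inv_letter b)) \<in> ?L"
        using labels_letter[OF that(2)] by auto
      obtain k c where b: "b = (k, c)" by (cases b)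
      consider "k = i + 1" | "k = i" | "k < i" | "k > i + 1" by linarith
      then show ?thesis
      proof cases
        case 1
        have lab': "(x, if c then 2 * i + 2 else 2 * i + 1) \<in> ?L" "(y, if c then 2 * i + 1 else 2 * i + 2) \<in> ?L"
          using lab b 1 by (auto simp: code_simps inv_letter.simps)
        have ex: "new_label (ext x) (2 * i + 2)" "new_label (ext y) (2 * i + 2)"
          using extI[OF lab'(1)] extI[OF lab'(2)] g_val by (cases c; simp)+
        show ?thesis
          using that(1) 1 b ex intI[OF lab'(1)] intI[OF lab'(2)]
          by (cases c) (auto simp: F_def code_simps inv_letter.simps)
      next
        case 2
        have "g (code b) = code (i + 1, c)" "g (code (inv_letter b)) = code (inv_letter (i + 1, c))"
          using 2 b g_val by (cases c; simp add: code_simps inv_letter.simps)+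
        then show ?thesis using that(1) b 2 extI[OF lab(1)] extI[OF lab(2)] by (auto simp: F_def)
      next
        case 3
        have "g (code b) = code b" "g (code (inv_letter b)) = code (inv_letter b)"
          using 3 b by (cases c; auto intro!: g_val(5) simp: code_simps inv_letter.simps)+
        then show ?thesis using that(1) b 3 extI[OF lab(1)] extI[OF lab(2)] by (auto simp: F_def)
      next
        case 4
        have "g (code b) = code b" "g (code (inv_letter b)) = code (inv_letter b)"
          using 4 b by (cases c; auto intro!: g_val(6) simp: code_simps inv_letter.simps)+
        then show ?thesis using that(1) b 4 extI[OF lab(1)] extI[OF lab(2)] by (auto simp: F_def)
      qed
    qed
    consider "(p', c') = (ext s, 0)" | "(p', c') = (ext t, 2 * n + 1)"
      | a p q where "(a, p, q) \<in> set d'" "(p', c') = (p, code a) \<or> (p', c') = (q, code (inv_letter a))"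
      using new unfolding labels_def by blast
    then show ?thesis
    proof cases
      case 1
      then show ?thesis using extI[OF labels_ends(1)] i by (simp add: g_def)
    next
      case 2
      then show ?thesis using extI[OF labels_ends(2)] i g_val(6)[of "2 * n + 1"] by simp
    next
      case (3 a p q)
      then obtain b x y where "(b, x, y) \<in> set d" "(a, p, q) \<in> set (F (b, x, y))" unfolding d'_def by auto
      from letters[OF this(2,1)] 3(2) show ?thesis by auto
    qed
  qed
  have g_mono: "c \<le> c' \<Longrightarrow> g c \<le> g c'" for c c' using i unfolding g_def by auto
  have order': "c1 \<le> c2" if nl: "new_label p1 c1" "new_label p2 c2" and less: "p1 < p2" for p1 c1 p2 c2
  proof -
    define mid where "mid p c p' c' \<longleftrightarrow> (p, c) \<in> ?L \<and>
      (c = 2 * i + 1 \<or> c = 2 * i + 2) \<and> (p' = r p \<and> c' = c - 2 \<or> p' = 2 * N - r p \<and> c' = 2 * i + 1)" for p c p' c'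
    have mid_range: "0 < p' \<and> p' < 2 * N \<and> 2 * i - 1 \<le> c' \<and> c' \<le> 2 * i + 1" if "mid p c p' c'" for p c p' c'
    proof -
      have "p \<in> B" using that by (auto simp: B_def mid_def)
      from B[OF this] that show ?thesis by (auto simp: mid_def)
    qed
    from nl(1) consider (e1) p c where "(p, c) \<in> ?L" "p1 = ext p" "c1 = g c" | (m1) p c where "mid p c p1 c1"
      unfolding new_label_def mid_def by blast
    then show ?thesis
    proof cases
      case (e1 p c)
      from nl(2) consider (e2) p' c' where "(p', c') \<in> ?L" "p2 = ext p'" "c2 = g c'" | (m2) p' c' where "mid p' c' p2 c2"
        unfolding new_label_def mid_def by blast
      then show ?thesis
      proof cases
        case (e2 p' c')
        then show ?thesis using e1 less mono[OF e1(1) e2(1)] g_mono by auto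
      next
        case (m2 p' c')
        from mid_range[OF this] have "p \<le> T" using ext_low(1)[of p2 p] less e1 by auto
        then have "c < 2 * i - 1" using T[OF e1(1)] by simp
        then show ?thesis using e1 mid_range[OF m2] by (simp add: g_def)
      qed
    next
      case (m1 p c)
      from nl(2) consider (e2) p' c' where "(p', c') \<in> ?L" "p2 = ext p'" "c2 = g c'" | (m2) p' c' where "mid p' c' p2 c2"
        unfolding new_label_def mid_def by blast
      then show ?thesis
      proof cases
        case (e2 p' c')
        from mid_range[OF m1] have "T < p'" using ext_low(2)[of p1 p'] less e2 by auto
        then have "\<not> c' < 2 * i - 1" using T[OF e2(1)] by simp
        then have "2 * i + 1 \<le> g c'" by (simp add: g_def)
        then show ?thesis using e2 mid_range[OF m1] by simp
      next
        case (m2 p' c')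
        have "p \<in> B" "p' \<in> B" using m1 m2 by (auto simp: B_def mid_def)
        then have "r p < N" "r p' < N" using B by auto
        then consider "p1 = r p" "p2 = r p'" "c1 = c - 2" "c2 = c' - 2" | "c2 = 2 * i + 1" | "c1 = 2 * i + 1" "p1 = 2 * N - r p" "p2 = r p'"
          using m1 m2 by (auto simp: mid_def)
        then show ?thesis
        proof cases
          case 1
          then have "p < p'" using less by (simp add: r_def)
          moreover have "(p, c) \<in> ?L" "(p', c') \<in> ?L" using m1 m2 by (auto simp: mid_def)
          ultimately have "c \<le> c'" using mono by blast
          then show ?thesis using 1 by simp
        next
          case 2
          then show ?thesis using mid_range[OF m1] by simp
        next
          case 3
          then show ?thesis using less \<open>r p < N\<close> \<open>r p' < N\<close> by simp
        qed
      qed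
    qed
  qed
  have sub: "\<exists>y\<in>set (endpoints e). x = ext y \<or> y \<in> B \<and> (x = r y \<or> x = 2 * N - r y)"
    if "x \<in> set (endpoints (concat (map F e)))" "set e \<subseteq> set d" for x e
    using that
  proof (induction e)
    case (Cons h e)
    obtain a p q where h: "h = (a, p, q)" by (cases h)
    consider "x \<in> set (endpoints (F h))" | "x \<in> set (endpoints (concat (map F e)))" using Cons.prems(1) by auto
    then show ?case
    proof cases
      case 1
      have "fst a = i + 1 \<Longrightarrow> p \<in> B \<and> q \<in> B" using BI[of a p q] Cons.prems(2) h by auto
      with 1 show ?thesis unfolding h by (auto simp: F_def split: if_splits)
    next
      case 2
      then obtain y where "y \<in> set (endpoints e)" "x = ext y \<or> y \<in> B \<and> (x = r y \<or> x = 2 * N - r y)"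
        using Cons by auto
      then show ?thesis unfolding h by auto
    qed
  qed simp
  have val: "ext x \<noteq> r y" "ext x \<noteq> 2 * N - r y" "r y \<noteq> ext x" "2 * N - r y \<noteq> ext x" if "y \<in> B" for x y
    using ext_low(3)[of "r y" x] ext_low(3)[of "2 * N - r y" x] B[OF that] by auto
  have val2: "r x \<noteq> 2 * N - r y" "2 * N - r y \<noteq> r x" if "x \<in> B" "y \<in> B" for x y
    using B[OF that(1)] B[OF that(2)] by auto
  have r_eq: "r x = r y \<longleftrightarrow> x = y" for x y by (simp add: r_def)
  have dist': "distinct (endpoints (concat (map F e)))" if "distinct (endpoints e)" "set e \<subseteq> set d" for e
    using that
  proof (induction e)
    case (Cons h e)
    obtain a p q where h: "h = (a, p, q)" by (cases h)
    let ?T = "set (endpoints (concat (map F e)))"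
    have pq: "p \<noteq> q" "p \<notin> set (endpoints e)" "q \<notin> set (endpoints e)" using Cons.prems h by auto
    have IH: "distinct (endpoints (concat (map F e)))" using Cons h by auto
    have tail: "\<exists>y\<in>set (endpoints e). x = ext y \<or> y \<in> B \<and> (x = r y \<or> x = 2 * N - r y)"
      if "x \<in> ?T" for x
      using sub[OF that] Cons.prems by auto
    have ne_ext: "ext x \<notin> ?T" if "x \<in> {p, q}" for x
      using tail[of "ext x"] val pq that by auto
    show ?case
    proof (cases "fst a = i + 1")
      case True
      then have B': "p \<in> B" "q \<in> B" using BI[of a p q] Cons.prems h by auto
      have ne: "r x \<notin> ?T" "2 * N - r x \<notin> ?T" if "x \<in> {p, q}" for x
      proof -
        have "x \<in> B" "x \<notin> set (endpoints e)" using that B' pq by auto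
        then show "r x \<notin> ?T" "2 * N - r x \<notin> ?T"
          using tail[of "r x"] tail[of "2 * N - r x"] val val2 r_eq by fastforce+
      qed
      have F: "F h = [((i + 1, True), ext p, 2 * N - r p), ((i, snd a), r p, r q), ((i + 1, False), 2 * N - r q, ext q)]"
        using True by (simp add: F_def h)
      have "distinct [ext p, 2 * N - r p, r p, r q, 2 * N - r q, ext q]"
        by (simp add: r_eq pq(1) pq(1)[symmetric] val[OF B'(1)] val[OF B'(2)] val2[OF B'] val2[OF B'(2,1)]
            val2[OF B'(1) B'(1)] val2[OF B'(2) B'(2)])
      moreover have "set [ext p, 2 * N - r p, r p, r q, 2 * N - r q, ext q] \<inter> ?T = {}"
        using ne[of p] ne[of q] ne_ext[of p] ne_ext[of q] by simp
      moreover have "endpoints (concat (map F (h # e))) =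
          [ext p, 2 * N - r p, r p, r q, 2 * N - r q, ext q] @ endpoints (concat (map F e))"
        by (simp add: F)
      ultimately show ?thesis using IH by (simp only: distinct_append simp_thms)
    next
      case False
      then have "endpoints (F h) = [ext p, ext q]" by (simp add: F_def h)
      then show ?thesis using IH ne_ext pq by simp
    qed
  qed simp
  \<comment> \<open>Entering positions differ from leaving ones; this keeps apart the two families
    of reflected pairs, one at entering and one at leaving positions.\<close>
  have inout: "p \<noteq> q'" "q' \<noteq> p" if "(a, p, q) \<in> set d" "(a', p', q') \<in> set d" for a p q a' p' q'
  proof -
    have dd: "distinct (pts (map snd d))" using dist by (simp add: endpoints_eq_pts)
    have m: "(p, q) \<in> set (map snd d)" "(p', q') \<in> set (map snd d)" using that by force+
    show "p \<noteq> q'" using distinct_pts_unique[OF dd m] distinct_pts_pair[OF dd m(1)] by auto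
    then show "q' \<noteq> p" by simp
  qed
  have nc_arcs: "noncrossing (?A)"
  proof (rule noncrossingI)
    define mid where "mid a b \<longleftrightarrow> (\<exists>l p q. (l, p, q) \<in> set d \<and> fst l = i + 1 \<and>
      ((a, b) = (2 * N - r p, r p) \<or> (a, b) = (r q, 2 * N - r q)))" for a b
    fix a b c e assume ab: "(a, b) \<in> ?A" and ce: "(c, e) \<in> ?A"
      and ne: "(a, b) \<noteq> (c, e)"
    have split: "(\<exists>a' b'. (a', b') \<in> set (arcs s d t) \<and> a = ext a' \<and> b = ext b') \<or> mid a b"
      if "(a, b) \<in> ?A" for a b
      using that unfolding d'_def arcs' mid_def by fastforce
    have midD: "0 < a" "a < 2 * N" "0 < b" "b < 2 * N" if "mid a b" for a b
      using that B BI by (fastforce simp: mid_def)+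
    from split[OF ab] split[OF ce]
    consider a' b' c' e' where "(a', b') \<in> set (arcs s d t)" "a = ext a'" "b = ext b'"
        "(c', e') \<in> set (arcs s d t)" "c = ext c'" "e = ext e'"
      | a' b' where "a = ext a'" "b = ext b'" "mid c e"
      | c' e' where "c = ext c'" "e = ext e'" "mid a b"
      | "mid a b" "mid c e" by blast
    then show "separates a b c = separates a b e"
    proof cases
      case 1
      then show ?thesis using noncrossingD[OF ncE 1(1,4)] ne by simp
    next
      case 2
      then show ?thesis using midD[OF 2(3)] by (simp add: separates_def ext_low)
    next
      case 3
      then show ?thesis using midD[OF 3(3)] by (simp add: separates_def ext_low)
    next
      case 4
      obtain l p q where 1: "(l, p, q) \<in> set d" "fst l = i + 1"
        "(a, b) = (2 * N - r p, r p) \<or> (a, b) = (r q, 2 * N - r q)" using 4(1) by (auto simp: mid_def)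
      obtain l' p' q' where 2: "(l', p', q') \<in> set d" "fst l' = i + 1"
        "(c, e) = (2 * N - r p', r p') \<or> (c, e) = (r q', 2 * N - r q')" using 4(2) by (auto simp: mid_def)
      have ranges: "r p < N" "r q < N" "r p' < N" "r q' < N" using BI[OF 1(1,2)] BI[OF 2(1,2)] B by auto
      have "r p \<noteq> r q'" "r p' \<noteq> r q" using inout[OF 1(1) 2(1)] inout[OF 2(1) 1(1)] by (simp_all add: r_eq)
      moreover have "r p \<noteq> r p'" if "(a, b) = (2 * N - r p, r p)" "(c, e) = (2 * N - r p', r p')" using ne that by auto
      moreover have "r q \<noteq> r q'" if "(a, b) = (r q, 2 * N - r q)" "(c, e) = (r q', 2 * N - r q')" using ne that by auto
      ultimately show ?thesis
        using 1(3) 2(3) separates_reflect[of _ N] ranges separates_commute by (elim disjE) (metis Pair_inject)+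
    qed
  qed
  \<comment> \<open>A crossing of another generator has both ends on one side of \<open>T\<close>
    and, beyond \<open>T\<close>, on one side of all of \<open>B\<close>; so it cannot cross an
    inserted strand.\<close>
  have far: "p \<le> T \<and> q \<le> T \<or> T < p \<and> T < q \<and> ((\<forall>x\<in>B. p < x \<and> q < x) \<or> (\<forall>x\<in>B. x < p \<and> x < q))"
    if apq: "(a, p, q) \<in> set d" and a: "fst a \<noteq> i + 1" for a p q
  proof -
    note lab = labels_letter[OF apq, of n s t]
    have below: "y < x" if "x \<in> B" "(y, c) \<in> ?L" "c < 2 * i + 1" for x y c
    proof -
      obtain c' where c': "(x, c') \<in> ?L" "2 * i + 1 \<le> c'" using \<open>x \<in> B\<close> by (auto simp: B_def)
      then have "x \<noteq> y" using labels_unique[OF dist _ that(2)] that(3) by force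
      then show ?thesis using mono[OF c'(1) that(2)] c'(2) that(3) by linarith
    qed
    have above: "x < y" if "x \<in> B" "(y, c) \<in> ?L" "2 * i + 2 < c" for x y c
    proof -
      obtain c' where c': "(x, c') \<in> ?L" "c' \<le> 2 * i + 2" using \<open>x \<in> B\<close> by (auto simp: B_def)
      then have "x \<noteq> y" using labels_unique[OF dist _ that(2)] that(3) by force
      then show ?thesis using mono[OF that(2) c'(1)] c'(2) that(3) by linarith
    qed
    obtain k b where kb: "a = (k, b)" by (cases a)
    consider "k < i" | "k = i" | "k > i + 1" using a kb by force
    then show ?thesis
    proof cases
      case 1
      then have "code a < 2 * i - 1" "code (inv_letter a) < 2 * i - 1"
        using kb by (cases b; simp add: code_simps inv_letter.simps)+
      then show ?thesis using T lab by blast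
    next
      case 2
      then have c: "code a < 2 * i + 1" "code (inv_letter a) < 2 * i + 1" "\<not> code a < 2 * i - 1" "\<not> code (inv_letter a) < 2 * i - 1"
        using kb by (cases b; simp add: code_simps inv_letter.simps)+
      then have "\<not> p \<le> T" "\<not> q \<le> T" using T lab by blast+
      moreover have "\<forall>x\<in>B. p < x \<and> q < x" using below lab c by blast
      ultimately show ?thesis by auto
    next
      case 3
      then have c: "2 * i + 2 < code a" "2 * i + 2 < code (inv_letter a)"
        using kb by (cases b; simp add: code_simps inv_letter.simps)+
      then have "\<not> p \<le> T" "\<not> q \<le> T" using T lab by fastforce+
      moreover have "\<forall>x\<in>B. x < p \<and> x < q" using above lab c by blast
      ultimately show ?thesis by auto
    qed
  qed
  have nc_cross: "noncrossing (snd ` set d')"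
  proof (rule noncrossingI)
    \<comment> \<open>Three kinds of crossings: shifted ones, copies, and those joining a shifted
      half-edge to its reflection. The last kind is concentric about \<open>2 * N\<close>, since
      \<open>ext z = 2 * N + r z\<close> on \<open>B\<close>.\<close>
    define outer where "outer x y \<longleftrightarrow> (\<exists>a p q. (a, p, q) \<in> set d \<and> fst a \<noteq> i + 1 \<and> x = ext p \<and> y = ext q)" for x y
    define inner where "inner x y \<longleftrightarrow> (\<exists>a p q. (a, p, q) \<in> set d \<and> fst a = i + 1 \<and> x = r p \<and> y = r q)" for x y
    define refl where "refl x y \<longleftrightarrow> (\<exists>a p q. (a, p, q) \<in> set d \<and> fst a = i + 1 \<and>
      (x = ext p \<and> y = 2 * N - r p \<or> x = 2 * N - r q \<and> y = ext q))" for x y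
    have split: "outer x y \<or> inner x y \<or> refl x y" if xy: "(x, y) \<in> snd ` set d'" for x y
    proof -
      obtain a p q where apq: "(a, p, q) \<in> set d" and *: "if fst a = i + 1
        then (x, y) = (ext p, 2 * N - r p) \<or> (x, y) = (r p, r q) \<or> (x, y) = (2 * N - r q, ext q) else (x, y) = (ext p, ext q)"
        using cross'[OF xy] by blast
      show ?thesis
      proof (cases "fst a = i + 1")
        case True
        then show ?thesis using * apq unfolding inner_def refl_def prod.inject by (simp only: if_True simp_thms) blast
      next
        case False
        then show ?thesis using * apq unfolding outer_def prod.inject by (simp only: if_False simp_thms) blast
      qed
    qed
    have reflD: "\<exists>z\<in>B. (x = ext z \<and> y = 2 * N - r z) \<or> (x = 2 * N - r z \<and> y = ext z)" if "refl x y" for x y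
      using that BI unfolding refl_def by blast
    have innerD: "0 < x" "x < N" "0 < y" "y < N" if "inner x y" for x y
      using that BI B unfolding inner_def by blast+
    fix a b c e assume ab: "(a, b) \<in> snd ` set d'" and ce: "(c, e) \<in> snd ` set d'" and ne: "(a, b) \<noteq> (c, e)"
    consider "outer a b" "outer c e" | "outer a b" "inner c e" | "outer a b" "refl c e"
      | "inner a b" "outer c e" | "inner a b" "inner c e" | "inner a b" "refl c e"
      | "refl a b" "outer c e" | "refl a b" "inner c e" | "refl a b" "refl c e"
      using split[OF ab] split[OF ce] by blast
    then show "separates a b c = separates a b e"
    proof cases
      case 1
      then obtain l p q l' p' q' where 2: "(l, p, q) \<in> set d" "a = ext p" "b = ext q" "(l', p', q') \<in> set d" "c = ext p'" "e = ext q'"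
        unfolding outer_def by blast
      then show ?thesis using noncrossingD[OF ncd, of p q p' q'] ne by force
    next
      case 2
      then obtain l p q where "(l, p, q) \<in> set d" "fst l \<noteq> i + 1" "a = ext p" "b = ext q" unfolding outer_def by blast
      then show ?thesis using far[of l p q] innerD[OF 2(2)] by (auto simp: separates_def ext_low)
    next
      case 3
      then obtain l p q where 1: "(l, p, q) \<in> set d" "fst l \<noteq> i + 1" "a = ext p" "b = ext q" unfolding outer_def by blast
      obtain z where z: "z \<in> B" "(c = ext z \<and> e = 2 * N - r z) \<or> (c = 2 * N - r z \<and> e = ext z)" using reflD[OF 3(2)] by blast
      have "ext x < 2 * N - r z \<longleftrightarrow> x \<le> T" for x using B[OF z(1)] by (intro ext_low) auto
      then have "separates a b (ext z) = separates a b (2 * N - r z)"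
        using far[OF 1(1,2)] z(1) B(1)[OF z(1)] 1(3,4) by (auto simp: separates_def)
      then show ?thesis using z(2) by auto
    next
      case 4
      then obtain l p q where "(l, p, q) \<in> set d" "fst l \<noteq> i + 1" "c = ext p" "e = ext q" unfolding outer_def by blast
      then show ?thesis using far[of l p q] innerD[OF 4(1)] by (auto simp: separates_def ext_low)
    next
      case 5
      then obtain l p q l' p' q' where 2: "(l, p, q) \<in> set d" "a = r p" "b = r q" "(l', p', q') \<in> set d" "c = r p'" "e = r q'"
        unfolding inner_def by blast
      then have "separates p q p' = separates p q q'" using noncrossingD[OF ncd, of p q p' q'] ne by force
      then show ?thesis using 2 by (simp add: separates_def r_def)
    next
      case 6
      obtain z where z: "z \<in> B" "(c = ext z \<and> e = 2 * N - r z) \<or> (c = 2 * N - r z \<and> e = ext z)" using reflD[OF 6(2)] by blast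
      then show ?thesis using innerD[OF 6(1)] B[OF z(1)] Bext[OF z(1)] by (auto simp: separates_def)
    next
      case 7
      then obtain l p q where 1: "(l, p, q) \<in> set d" "fst l \<noteq> i + 1" "c = ext p" "e = ext q" unfolding outer_def by blast
      obtain z where z: "z \<in> B" "(a = ext z \<and> b = 2 * N - r z) \<or> (a = 2 * N - r z \<and> b = ext z)" using reflD[OF 7(1)] by blast
      have low: "2 * N - r z < ext x \<longleftrightarrow> T < x" for x using B[OF z(1)] by (intro ext_low) auto
      consider "p \<le> T" "q \<le> T" | "T < p" "T < q" "p < z" "q < z" | "T < p" "T < q" "z < p" "z < q"
        using far[OF 1(1,2)] z(1) by blast
      then have "separates (ext z) (2 * N - r z) c = separates (ext z) (2 * N - r z) e"
        by cases (use B(1)[OF z(1)] 1(3,4) in \<open>simp_all add: separates_def low\<close>)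
      then show ?thesis using z(2) separates_commute by blast
    next
      case 8
      obtain z where z: "z \<in> B" "(a = ext z \<and> b = 2 * N - r z) \<or> (a = 2 * N - r z \<and> b = ext z)" using reflD[OF 8(1)] by blast
      then show ?thesis using innerD[OF 8(2)] B[OF z(1)] Bext[OF z(1)] by (auto simp: separates_def)
    next
      case 9
      obtain l p q where 1: "(l, p, q) \<in> set d" "fst l = i + 1"
        "a = ext p \<and> b = 2 * N - r p \<or> a = 2 * N - r q \<and> b = ext q" using 9(1) unfolding refl_def by blast
      obtain l' p' q' where 2: "(l', p', q') \<in> set d" "fst l' = i + 1"
        "c = ext p' \<and> e = 2 * N - r p' \<or> c = 2 * N - r q' \<and> e = ext q'" using 9(2) unfolding refl_def by blast
      have BB: "p \<in> B" "q \<in> B" "p' \<in> B" "q' \<in> B" using BI[OF 1(1,2)] BI[OF 2(1,2)] by auto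
      have "r p \<noteq> r q'" "r p' \<noteq> r q" using inout[OF 1(1) 2(1)] inout[OF 2(1) 1(1)] by (simp_all add: r_eq)
      moreover have "r p \<noteq> r p'" if "a = ext p" "b = 2 * N - r p" "c = ext p'" "e = 2 * N - r p'" using ne that r_eq by auto
      moreover have "r q \<noteq> r q'" if "a = 2 * N - r q" "b = ext q" "c = 2 * N - r q'" "e = ext q'" using ne that r_eq by auto
      ultimately show ?thesis
        using 1(3) 2(3) separates_concentric[of _ _ "2 * N"] BB[THEN B(2)] separates_commute
        unfolding BB[THEN Bext] by (elim disjE) metis+
    qed
  qed
  have "drawing n (ext s) d' (ext t)"
    unfolding drawing_def
  proof (intro conjI)
    have "distinct (endpoints d')" unfolding d'_def using dist by (intro dist') auto
    moreover have "ext x \<notin> set (endpoints d')" if "x \<notin> set (endpoints d)" for x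
      using sub[of "ext x" d] val that unfolding d'_def by auto
    ultimately show "distinct (ext s # endpoints d' @ [ext t])" using dist by auto
  qed (use order' labels' nc_arcs nc_cross in blast)+
  then show ?thesis unfolding drawable_def using word by blast
qed

section \<open>Braids\<close>

definition flip_letter :: "nat \<Rightarrow> letter \<Rightarrow> letter" where
  "flip_letter n a = (n + 1 - fst a, snd a)"

text \<open>The mirror image is an anti-automorphism: it reverses the word but keeps the signs of
  the letters. On half-edges it reverses the alphabet, so that negated positions form a drawing
  again.\<close>

definition flip :: "nat \<Rightarrow> word \<Rightarrow> word" where
  "flip n w = rev (map (flip_letter n) w)"

lemma code_flip_letter:
  "fst a \<in> {1..n} \<Longrightarrow> code (flip_letter n a) = 2 * n + 1 - code (inv_letter a) \<and>
     code (inv_letter (flip_letter n a)) = 2 * n + 1 - code a"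
  by (cases a; cases "snd a") (auto simp: flip_letter_def code_simps inv_letter.simps)

lemma noncrossing_flip:
  assumes "noncrossing (set xs)" "distinct (pts xs)"
  shows "noncrossing ((\<lambda>(a, b). (- b, - a)) ` set xs)"
proof (rule noncrossingI)
  fix a b c d assume "(a, b) \<in> (\<lambda>(a, b). (- b, - a)) ` set xs" "(c, d) \<in> (\<lambda>(a, b). (- b, - a)) ` set xs"
    and ne: "(a, b) \<noteq> (c, d)"
  then have "(- b, - a) \<in> set xs" "(- d, - c) \<in> set xs" by auto
  moreover have "(- b, - a) \<noteq> (- d, - c)" using ne by auto
  ultimately have "separates (- b) (- a) (- d) = separates (- b) (- a) (- c)" "distinct [- b, - a, - d, - c]"
    using noncrossingD[OF assms(1)] distinct_pts_unique[OF assms(2)] by blast+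
  moreover from this(2) have "(- b < - d) = (\<not> b < d)" "(- a < - d) = (\<not> a < d)" "(- b < - c) = (\<not> b < c)" "(- a < - c) = (\<not> a < c)"
    by auto
  ultimately show "separates a b c = separates a b d"
    unfolding separates_def by argo
qed

lemma drawable_flip:
  assumes "over n w" "drawable n w"
  shows "drawable n (flip n w)"
proof -
  obtain s d t where w: "map fst d = w" and dr: "drawing n s d t"
    using assms(2) by (auto simp: drawable_def)
  let ?L = "labels n s d t"
  have dist: "distinct (s # endpoints d @ [t])" using dr by (simp add: drawing_def)
  define m where "m = (\<lambda>(a, p, q). (flip_letter n a, - q :: int, - p :: int))"
  define d' where "d' = rev (map m d)"
  have arcs': "set (arcs (- t) (rev (map m e)) (- s)) = (\<lambda>(a, b). (- b, - a)) ` set (arcs s e t)" for e s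
  proof (induction e arbitrary: s)
    case (Cons h e)
    obtain a p q where h: "h = (a, p, q)" by (cases h)
    show ?case using Cons[of q] by (simp add: h m_def arcs_snoc insert_commute)
  qed simp
  have endp': "endpoints (rev (map m e)) = rev (map uminus (endpoints e))" for e
    by (induction e) (auto simp: m_def)
  have labels': "labels n (- t) d' (- s) \<subseteq> (\<lambda>(p, c). (- p, 2 * n + 1 - c)) ` ?L"
  proof
    fix x assume "x \<in> labels n (- t) d' (- s)"
    then consider "x = (- t, 0)" | "x = (- s, 2 * n + 1)"
      | a p q where "(a, p, q) \<in> set d" "x = (- q, code (flip_letter n a)) \<or> x = (- p, code (inv_letter (flip_letter n a)))"
      unfolding labels_def d'_def by (fastforce simp: m_def)
    then show "x \<in> (\<lambda>(p, c). (- p, 2 * n + 1 - c)) ` ?L"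
    proof cases
      case 1
      then show ?thesis using labels_ends(2)[of t n s d] by force
    next
      case 2
      then show ?thesis using labels_ends(1)[of s n d t] by force
    next
      case (3 a p q)
      have "fst a \<in> {1..n}" using 3(1) assms(1) w by (force simp: over_def)
      from code_flip_letter[OF this] 3(2) labels_letter[OF 3(1), of n s t] show ?thesis by force
    qed
  qed
  have old_label: "\<exists>x. (- p, x) \<in> ?L \<and> c = 2 * n + 1 - x" if "(p, c) \<in> labels n (- t) d' (- s)" for p c
  proof -
    from subsetD[OF labels' that] obtain y x where "(y, x) \<in> ?L" "(p, c) = (- y, 2 * n + 1 - x)" by (elim imageE) (metis (no_types, lifting) case_prod_conv surj_pair)
    then show ?thesis by auto
  qed
  have "drawing n (- t) d' (- s)"
    unfolding drawing_def
  proof (intro conjI)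
    have "- t # endpoints d' @ [- s] = rev (map uminus (s # endpoints d @ [t]))" by (simp add: d'_def endp')
    then show "distinct (- t # endpoints d' @ [- s])"
      using dist by (simp only: distinct_rev distinct_map) (simp add: inj_on_def)
    show "noncrossing (set (arcs (- t) d' (- s)))"
      unfolding d'_def arcs' using dr dist by (intro noncrossing_flip) (simp_all add: drawing_def pts_arcs)
    have "snd ` set d' = (\<lambda>(a, b). (- b, - a)) ` set (map snd d)"
      by (force simp: d'_def m_def image_image)
    then show "noncrossing (snd ` set d')"
      using dr dist noncrossing_flip[of "map snd d"] by (simp add: drawing_def endpoints_eq_pts)
    show "\<forall>(p, c)\<in>labels n (- t) d' (- s). \<forall>(p', c')\<in>labels n (- t) d' (- s). p < p' \<longrightarrow> c \<le> c'"
    proof (clarify)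
      fix p c p' c' assume "(p, c) \<in> labels n (- t) d' (- s)" "(p', c') \<in> labels n (- t) d' (- s)" and less: "p < p'"
      then obtain x y where "(- p, x) \<in> ?L" "c = 2 * n + 1 - x" "(- p', y) \<in> ?L" "c' = 2 * n + 1 - y"
        using old_label by blast
      moreover from this have "y \<le> x" using drawing_label_mono[OF dr, of "- p'" y "- p" x] less by auto
      ultimately show "c \<le> c'" by auto
    qed
  qed
  moreover have "map fst d' = flip n w"
    unfolding d'_def flip_def w[symmetric] rev_map[symmetric] by (simp add: m_def split_beta)
  ultimately show ?thesis unfolding drawable_def by blast
qed

lemma flip_append: "flip n (u @ v) = flip n v @ flip n u"
  by (simp add: flip_def)

text \<open>Conjugation by the mirror image turns \<open>sig (n - i)\<close> into
  \<open>sig_inv i\<close>, so the drawing for an inverse braid is obtained from the one for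
  \<open>sig\<close>.\<close>

lemma subst_sig_inv_eq_flip:
  assumes "1 \<le> i" "i < n" "over n w"
  shows "subst (sig_inv i) w = flip n (subst (sig (n - i)) (flip n w))"
  using assms(3)
proof (induction w)
  case (Cons a w)
  have "flip n (subst_letter (sig (n - i)) (flip_letter n a)) = subst_letter (sig_inv i) a"
  proof -
    obtain k b where a: "a = (k, b)" by (cases a)
    have k: "1 \<le> k" "k \<le> n" using Cons.prems a by auto
    have "k = i \<longleftrightarrow> n + 1 - k = n - i + 1" "k = i + 1 \<longleftrightarrow> n + 1 - k = n - i" "n + 1 - (n + 1 - k) = k"
      "n + 1 - (n - i) = i + 1" "n + 1 - (n - i + 1) = i"
      using k assms(1,2) by auto
    then show ?thesis using a
      by (cases b) (auto simp: flip_def flip_letter_def subst_letter_def sig_def sig_inv_def gen_def inv_letter.simps)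
  qed
  moreover have "flip n (a # w) = flip n w @ [flip_letter n a]" by (simp add: flip_def)
  ultimately show ?case
    using Cons by (simp add: flip_append subst_Cons)
qed (simp add: flip_def)

lemma over_flip: "over n w \<Longrightarrow> over n (flip n w)"
  by (fastforce simp: over_def flip_def flip_letter_def)

lemma over_sig: "1 \<le> i \<Longrightarrow> i < n \<Longrightarrow> k \<in> {1..n} \<Longrightarrow> over n (sig i k)"
  and over_sig_inv: "1 \<le> i \<Longrightarrow> i < n \<Longrightarrow> k \<in> {1..n} \<Longrightarrow> over n (sig_inv i k)"
  by (auto simp: sig_def sig_inv_def gen_def)

lemma drawable_sig_inv:
  assumes "1 \<le> i" "i < n" "over n w" "drawable n w"
  shows "drawable n (subst (sig_inv i) w)"
  unfolding subst_sig_inv_eq_flip[OF assms(1-3)]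
  using assms by (intro drawable_flip drawable_sig over_subst over_flip over_sig) auto

lemma drawable_endo_sig:
  assumes "1 \<le> i" "i < n" "over n w" "drawable n w"
  shows "drawable n (endo (sig i) w)" "drawable n (endo (sig_inv i) w)"
  unfolding endo_def
  using assms by (auto intro!: drawable_reduce over_subst drawable_sig drawable_sig_inv over_sig over_sig_inv)

lemma endo_sig_sig_inv:
  assumes "1 \<le> i" "i < n" "w \<in> FG n"
  shows "endo (sig_inv i) (endo (sig i) w) = w" "endo (sig i) (endo (sig_inv i) w) = w"
proof -
  have w: "over n w" "endo gen w = w" using assms(3) by (simp_all add: FG_def endo_def)
  have "endo (sig_inv i) (sig i k) = reduce (gen k)" "endo (sig i) (sig_inv i k) = reduce (gen k)" for k
    by (auto simp: endo_def sig_def sig_inv_def gen_def subst_Cons subst_letter_def inv_letter.simps reduce_Cons)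
  then show "endo (sig_inv i) (endo (sig i) w) = w" "endo (sig i) (endo (sig_inv i) w) = w"
    using endo_endo[OF _ w(1)] w(2) by metis+
qed

text \<open>Compositions of elementary braids, as maps on all words. They are inverted only on
  \<open>FG n\<close>, since \<open>endo\<close> always returns a reduced word.\<close>

inductive_set braids :: "nat \<Rightarrow> (word \<Rightarrow> word) set" for n where
  id: "(\<lambda>w. w) \<in> braids n"
| sig: "f \<in> braids n \<Longrightarrow> 1 \<le> i \<Longrightarrow> i < n \<Longrightarrow> (\<lambda>w. f (endo (sig i) w)) \<in> braids n"
| sig_inv: "f \<in> braids n \<Longrightarrow> 1 \<le> i \<Longrightarrow> i < n \<Longrightarrow> (\<lambda>w. f (endo (sig_inv i) w)) \<in> braids n"

lemma endo_sig_in_FG: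
  assumes "1 \<le> i" "i < n" "w \<in> FG n"
  shows "endo (sig i) w \<in> FG n" "endo (sig_inv i) w \<in> FG n"
  using assms FG_D(1)[OF assms(3)] by (auto intro!: endo_in_FG over_sig over_sig_inv)

lemma braids_comp: "g \<in> braids n \<Longrightarrow> f \<in> braids n \<Longrightarrow> (\<lambda>w. f (g w)) \<in> braids n"
  by (induction rule: braids.induct) (auto intro: braids.intros)

lemma braids_in_FG: "f \<in> braids n \<Longrightarrow> w \<in> FG n \<Longrightarrow> f w \<in> FG n"
  by (induction arbitrary: w rule: braids.induct) (simp_all add: endo_sig_in_FG)

lemma braids_mult: "f \<in> braids n \<Longrightarrow> u \<in> FG n \<Longrightarrow> v \<in> FG n \<Longrightarrow> f (mult u v) = mult (f u) (f v)"
  by (induction arbitrary: u v rule: braids.induct) (auto simp: endo_mult endo_sig_in_FG)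

lemma braids_winv: "f \<in> braids n \<Longrightarrow> f (winv u) = winv (f u)"
  by (induction arbitrary: u rule: braids.induct) (auto simp: endo_winv)

lemma braids_drawable: "f \<in> braids n \<Longrightarrow> w \<in> FG n \<Longrightarrow> drawable n w \<Longrightarrow> drawable n (f w)"
proof (induction arbitrary: w rule: braids.induct)
  case (sig f i)
  then show ?case using drawable_endo_sig(1) endo_sig_in_FG(1) FG_D(1) by blast
next
  case (sig_inv f i)
  then show ?case using drawable_endo_sig(2) endo_sig_in_FG(2) FG_D(1) by blast
qed simp

lemma braids_inverse:
  assumes "f \<in> braids n"
  shows "\<exists>g\<in>braids n. \<forall>w\<in>FG n. g (f w) = w \<and> f (g w) = w"
  using assms
proof (induction rule: braids.induct)
  case id
  show ?case by (rule bexI[OF _ braids.id]) simp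
next
  case (sig f i)
  then obtain g where g: "g \<in> braids n" "\<forall>w\<in>FG n. g (f w) = w \<and> f (g w) = w" by blast
  have "(\<lambda>w. endo (sig_inv i) w) \<in> braids n"
    using braids.sig_inv[OF braids.id] sig by blast
  from braids_comp[OF g(1) this] show ?case
    using g sig.hyps
    by (intro bexI[of _ "\<lambda>w. endo (sig_inv i) (g w)"]) (auto simp: endo_sig_sig_inv endo_sig_in_FG braids_in_FG)
next
  case (sig_inv f i)
  then obtain g where g: "g \<in> braids n" "\<forall>w\<in>FG n. g (f w) = w \<and> f (g w) = w" by blast
  have "(\<lambda>w. endo (sig i) w) \<in> braids n"
    using braids.sig[OF braids.id] sig_inv by blast
  from braids_comp[OF g(1) this] show ?case
    using g sig_inv.hyps
    by (intro bexI[of _ "\<lambda>w. endo (sig i) (g w)"]) (auto simp: endo_sig_sig_inv endo_sig_in_FG braids_in_FG)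
qed

section \<open>Action of braids on the boundary word and on generators\<close>

definition pos_word :: "nat list \<Rightarrow> word" where
  "pos_word ks = map (\<lambda>k. (k, False)) ks"

lemma reduced_pos_word: "reduced (pos_word ks)"
  by (simp add: reduced_def pos_word_def inv_letter.simps)

lemma z1_eq: "z1 n = winv (pos_word [1..<n+1])"
  by (simp add: z1_def winv_def pos_word_def comp_def inv_letter.simps)

text \<open>Only the two factors \<open>t_i t_{i+1}\<close> are affected, and they change by one
  cancelling pair: in front of them for \<open>sig\<close>, behind them for
  \<open>sig_inv\<close>.\<close>

lemma endo_sig_pos_word:
  assumes "1 \<le> i" "i < n"
  shows "endo (sig i) (pos_word [1..<n+1]) = pos_word [1..<n+1]"
    "endo (sig_inv i) (pos_word [1..<n+1]) = pos_word [1..<n+1]"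
proof -
  have split: "[1..<n+1] = [1..<i] @ [i, i + 1] @ [i + 2..<n+1]"
  proof -
    have "[1..<n+1] = [1..<i] @ [i..<n+1]"
      using upt_add_eq_append[of 1 i "n + 1 - i"] assms by (simp del: upt_Suc)
    moreover have "[i..<n+1] = i # (i + 1) # [i + 2..<n+1]"
      using assms by (simp add: upt_conv_Cons del: upt_Suc)
    ultimately show ?thesis by simp
  qed
  have fix1: "subst h (pos_word ks) = pos_word ks" if "\<And>k. k \<in> set ks \<Longrightarrow> h k = gen k" for h ks
    using that by (induction ks) (auto simp: pos_word_def subst_Cons subst_letter_def gen_def)
  have app: "pos_word (u @ v) = pos_word u @ pos_word v" for u v by (simp add: pos_word_def)
  have fix2: "subst (sig i) (pos_word [1..<i]) = pos_word [1..<i]" "subst (sig i) (pos_word [i + 2..<n+1]) = pos_word [i + 2..<n+1]"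
    "subst (sig_inv i) (pos_word [1..<i]) = pos_word [1..<i]" "subst (sig_inv i) (pos_word [i + 2..<n+1]) = pos_word [i + 2..<n+1]"
    by (intro fix1; auto simp: sig_def sig_inv_def)+
  have mid: "subst (sig i) (pos_word [i, i + 1]) = (i + 1, False) # inv_letter (i + 1, False) # pos_word [i, i + 1]"
    "subst (sig_inv i) (pos_word [i, i + 1]) = pos_word [i, i + 1] @ [inv_letter (i, False), inv_letter (inv_letter (i, False))]"
    by (simp_all add: pos_word_def subst_Cons subst_letter_def sig_def sig_inv_def gen_def inv_letter.simps)
  have "endo (sig i) (pos_word [1..<n+1]) = reduce (pos_word [1..<i] @ (i + 1, False) # inv_letter (i + 1, False) # pos_word [i, i + 1] @ pos_word [i + 2..<n+1])"
    unfolding endo_def split app subst_append fix2 mid by simp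
  also have "\<dots> = pos_word [1..<n+1]"
    unfolding reduce_cancel_pair unfolding split app[symmetric] by (simp add: reduced_pos_word del: upt_Suc)
  finally show "endo (sig i) (pos_word [1..<n+1]) = pos_word [1..<n+1]" .
  have "endo (sig_inv i) (pos_word [1..<n+1]) =
     reduce ((pos_word [1..<i] @ pos_word [i, i + 1]) @ inv_letter (i, False) # inv_letter (inv_letter (i, False)) # pos_word [i + 2..<n+1])"
    unfolding endo_def split app subst_append fix2 mid by simp
  also have "\<dots> = pos_word [1..<n+1]"
    unfolding reduce_cancel_pair unfolding split app[symmetric] by (simp add: reduced_pos_word del: upt_Suc)
  finally show "endo (sig_inv i) (pos_word [1..<n+1]) = pos_word [1..<n+1]" .
qed

lemma endo_sig_z1:
  assumes "1 \<le> i" "i < n"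
  shows "endo (sig i) (z1 n) = z1 n" "endo (sig_inv i) (z1 n) = z1 n"
  unfolding z1_eq endo_winv by (simp_all only: endo_sig_pos_word[OF assms])

lemma braids_z1: "f \<in> braids n \<Longrightarrow> f (z1 n) = z1 n"
  by (induction rule: braids.induct) (simp_all add: endo_sig_z1)

definition gen_conjugate :: "nat \<Rightarrow> word \<Rightarrow> bool" where
  "gen_conjugate n x \<longleftrightarrow> (\<exists>j\<in>{1..n}. conjugate n x (gen j))"

lemma gen_conjugate_gen: "k \<in> {1..n} \<Longrightarrow> gen_conjugate n (gen k)"
  unfolding gen_conjugate_def conjugate_def
  by (intro bexI[of _ k] bexI[of _ "[]"]) (auto simp: mult_def gen_def FG_def)

lemma gen_conjugate_conj:
  assumes "gen_conjugate n x" "h \<in> FG n"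
  shows "gen_conjugate n (mult (mult (winv h) x) h)"
proof -
  obtain j g where j: "j \<in> {1..n}" "g \<in> FG n" "gen j = mult (mult (winv g) x) g"
    using assms(1) by (auto simp: gen_conjugate_def conjugate_def)
  have "gen j = mult (mult (winv (mult (winv h) g)) (mult (mult (winv h) x) h)) (mult (winv h) g)"
  proof -
    have "reduce (winv g @ h @ winv h @ x @ h @ winv h @ g) = reduce (winv g @ x @ g)"
      by (metis reduce_append_right reduce_winv_right)
    then show ?thesis
      unfolding j(3) mult_def reduce_winv[symmetric] by simp
  qed
  then show ?thesis
    using j assms(2) mult_in_FG[of "winv h" n g] unfolding gen_conjugate_def conjugate_def by auto
qed

lemma endo_sig_gen: "endo (sig i) (gen k) = sig i k" "endo (sig_inv i) (gen k) = sig_inv i k"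
  unfolding endo_gen by (rule reduce_reduced; simp add: sig_def sig_inv_def gen_def inv_letter.simps)+

text \<open>An elementary braid sends a generator to a generator or to a conjugate of one by
  another. Since \<open>f\<close> is multiplicative and the property is stable under conjugation, it
  passes through compositions.\<close>

lemma braids_gen_conjugate:
  assumes "f \<in> braids n" "k \<in> {1..n}"
  shows "gen_conjugate n (f (gen k))"
  using assms
proof (induction arbitrary: k rule: braids.induct)
  case id
  then show ?case by (simp add: gen_conjugate_gen)
next
  case (sig f i)
  consider "endo (sig i) (gen k) = gen (i + 1)" | "endo (sig i) (gen k) = mult (mult (winv (gen (i + 1))) (gen i)) (gen (i + 1))"
    | "endo (sig i) (gen k) = gen k"
    unfolding endo_sig_gen by (cases "k = i"; cases "k = i + 1") (simp_all add: sig_def mult_def gen_def reduce_Cons inv_letter.simps)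
  moreover have gi: "gen i \<in> FG n" "gen (i + 1) \<in> FG n" using sig.hyps by (auto intro: gen_in_FG)
  ultimately show ?case
    using sig.IH[of i] sig.IH[of "i + 1"] sig.IH[OF sig.prems] sig.hyps
      gen_conjugate_conj[of n "f (gen i)" "f (gen (i + 1))"]
    by cases (auto simp: braids_mult mult_in_FG braids_winv braids_in_FG)
next
  case (sig_inv f i)
  consider "endo (sig_inv i) (gen k) = gen i" | "endo (sig_inv i) (gen k) = mult (mult (winv (winv (gen i))) (gen (i + 1))) (winv (gen i))"
    | "endo (sig_inv i) (gen k) = gen k"
    unfolding endo_sig_gen by (cases "k = i"; cases "k = i + 1") (simp_all add: sig_inv_def mult_def gen_def reduce_Cons inv_letter.simps)
  moreover have gi: "gen i \<in> FG n" "gen (i + 1) \<in> FG n" using sig_inv.hyps by (auto intro: gen_in_FG)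
  ultimately show ?case
    using sig_inv.IH[of i] sig_inv.IH[of "i + 1"] sig_inv.IH[OF sig_inv.prems] sig_inv.hyps
      gen_conjugate_conj[of n "f (gen (i + 1))" "winv (f (gen i))"]
    by cases (auto simp: braids_mult mult_in_FG braids_winv braids_in_FG)
qed

lemma braids_subset_Bn: "braids n \<subseteq> Bn n"
proof
  fix f assume f: "f \<in> braids n"
  obtain g where g: "g \<in> braids n" "\<forall>w\<in>FG n. g (f w) = w \<and> f (g w) = w"
    using braids_inverse[OF f] by blast
  have "bij_betw f (FG n) (FG n)"
    using f g braids_in_FG by (intro bij_betw_byWitness[where f' = g]) auto
  then show "f \<in> Bn n"
    unfolding Bn_def is_aut_def
    using braids_mult[OF f] braids_z1[OF f] braids_gen_conjugate[OF f] by (auto simp: gen_conjugate_def)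
qed

lemma braids_gen_transitive:
  assumes "k \<in> {1..n}"
  shows "\<exists>f\<in>braids n. f (gen 1) = gen k"
proof -
  have "1 \<le> k \<Longrightarrow> k \<le> n \<Longrightarrow> \<exists>f\<in>braids n. f (gen 1) = gen k"
  proof (induction k rule: nat_induct_at_least)
    case base
    show ?case by (rule bexI[OF _ braids.id]) simp
  next
    case (Suc k)
    then obtain f where f: "f \<in> braids n" "f (gen 1) = gen k" by auto
    have "(\<lambda>w. endo (sig k) w) \<in> braids n" using braids.sig[OF braids.id] Suc by auto
    from braids_comp[OF f(1) this] show ?case
      using f(2) by (intro bexI[of _ "\<lambda>w. endo (sig k) (f w)"]) (simp_all add: endo_sig_gen sig_def)
  qed
  with assms show ?thesis by auto
qed

section \<open>Generation by elementary braids\<close>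

lemma conj_gen_normal_form:
  assumes "reduced g"
  shows "\<exists>u. reduce (g @ [(j, False)] @ winv g) = u @ [(j, False)] @ winv u"
  using assms
proof (induction g rule: rev_induct)
  case Nil
  show ?case by (intro exI[of _ "[]"]) simp
next
  case (snoc a g)
  then have g: "reduced g" by (simp add: reduced_append_iff)
  show ?case
  proof (cases "fst a = j")
    case True
    have "reduce ((g @ [a]) @ [(j, False)] @ winv (g @ [a])) = reduce (g @ [(j, False)] @ winv g)"
    proof (cases "snd a")
      case True
      then have "(j, False) = inv_letter a" using \<open>fst a = j\<close> by (cases a) (simp add: inv_letter.simps)
      then show ?thesis using reduce_cancel_pair[of g a "inv_letter a # winv g"] by simp
    next
      case False
      then have "(j, False) = a" using \<open>fst a = j\<close> by (cases a) simp
      then show ?thesis using reduce_cancel_pair[of "g @ [a]" a "winv g"] by simp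
    qed
    with snoc.IH[OF g] show ?thesis by simp
  next
    case False
    have "(j, False) \<noteq> inv_letter a" "a \<noteq> (j, False)" using False by (metis fst_conv fst_inv_letter)+
    moreover have "reduced (winv (g @ [a]))" using snoc.prems by (simp only: reduced_winv)
    ultimately have "reduced ((g @ [a]) @ [(j, False)] @ winv (g @ [a]))"
      using snoc.prems by (auto simp: reduced_append_iff)
    then show ?thesis by (intro exI[of _ "g @ [a]"]) simp
  qed
qed

lemma gen_conjugate_normal_form:
  assumes "gen_conjugate n x" "x \<in> FG n"
  obtains u j where "j \<in> {1..n}" "x = u @ [(j, False)] @ winv u"
proof -
  obtain j g where j: "j \<in> {1..n}" "g \<in> FG n" "gen j = mult (mult (winv g) x) g"
    using assms(1) by (auto simp: gen_conjugate_def conjugate_def)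
  have "reduce (g @ gen j @ winv g) = reduce (g @ (winv g @ x @ g) @ winv g)"
    unfolding j(3) mult_def by simp
  also have "\<dots> = reduce (x @ g @ winv g)" by simp
  also have "\<dots> = reduce x" by (metis append_Nil2 reduce_append_right reduce_winv_self(2))
  finally have "x = reduce (g @ [(j, False)] @ winv g)" using FG_D(2)[OF assms(2)] by (simp add: gen_def)
  with conj_gen_normal_form[OF FG_D(2)[OF j(2)], of j] j(1) that show ?thesis by metis
qed

lemma cyc_red_conj_gen: "cyc_red (u @ [(j, False)] @ winv u) = gen j"
proof (induction u)
  case Nil
  show ?case by (subst cyc_red.simps) (simp add: gen_def)
next
  case (Cons a u)
  have "cyc_red ((a # u) @ [(j, False)] @ winv (a # u)) = cyc_red (u @ [(j, False)] @ winv u)"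
    by (subst cyc_red.simps) (simp add: butlast_append)
  with Cons show ?case by simp
qed

section \<open>Artin's length argument\<close>

lemma common_prefix:
  "\<exists>c a b. u = c @ a \<and> v = c @ b \<and> (a = [] \<or> b = [] \<or> hd a \<noteq> hd b)"
proof (induction u arbitrary: v)
  case Nil
  show ?case by (intro exI[of _ "[]"] exI[of _ v]) auto
next
  case (Cons x u)
  show ?case
  proof (cases "v \<noteq> [] \<and> hd v = x")
    case True
    then obtain v' where v: "v = x # v'" by (cases v) auto
    obtain c a b where "u = c @ a" "v' = c @ b" "a = [] \<or> b = [] \<or> hd a \<noteq> hd b" using Cons by blast
    then show ?thesis using v by (intro exI[of _ "x # c"] exI[of _ a] exI[of _ b]) auto
  next
    case False
    then show ?thesis by (intro exI[of _ "[]"] exI[of _ "x # u"] exI[of _ v]) auto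
  qed
qed

text \<open>These properties of elements of \<open>Bn n\<close> persist when a braid is applied
  first, which is how the induction on the lengths of the images proceeds.\<close>

definition artin_endo :: "nat \<Rightarrow> (word \<Rightarrow> word) \<Rightarrow> bool" where
  "artin_endo n \<phi> \<longleftrightarrow> (\<forall>u\<in>FG n. \<phi> u \<in> FG n) \<and> (\<forall>u\<in>FG n. \<forall>v\<in>FG n. \<phi> (mult u v) = mult (\<phi> u) (\<phi> v)) \<and>
     \<phi> (z1 n) = z1 n \<and> (\<forall>k\<in>{1..n}. gen_conjugate n (\<phi> (gen k)))"

lemma artin_endo_Nil:
  assumes "artin_endo n \<phi>"
  shows "\<phi> [] = []"
proof -
  have "\<phi> [] \<in> FG n" "\<phi> (mult [] []) = mult (\<phi> []) (\<phi> [])" using assms by (auto simp: artin_endo_def)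
  then have "reduced (\<phi> [])" "\<phi> [] = reduce (\<phi> [] @ \<phi> [])" by (auto simp: mult_def FG_def)
  then have "reduce (winv (\<phi> []) @ \<phi> []) = reduce (winv (\<phi> []) @ \<phi> [] @ \<phi> [])"
    by (metis reduce_append_right)
  then show ?thesis using \<open>reduced (\<phi> [])\<close> by simp
qed

lemma artin_endo_winv:
  assumes "artin_endo n \<phi>" "u \<in> FG n"
  shows "\<phi> (winv u) = winv (\<phi> u)"
proof -
  have F: "\<phi> u \<in> FG n" "\<phi> (winv u) \<in> FG n" using assms by (auto simp: artin_endo_def)
  have "mult (\<phi> (winv u)) (\<phi> u) = \<phi> (mult (winv u) u)" using assms by (simp add: artin_endo_def)
  also have "\<dots> = []" using artin_endo_Nil[OF assms(1)] by (simp add: mult_def)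
  finally have "reduce (\<phi> (winv u) @ \<phi> u) = []" by (simp add: mult_def)
  then have "reduce ((\<phi> (winv u) @ \<phi> u) @ winv (\<phi> u)) = reduce (winv (\<phi> u))"
    by (metis append_Nil reduce_append_left)
  then have "reduce (\<phi> (winv u)) = reduce (winv (\<phi> u))"
    by (metis append_Nil2 append_assoc reduce_append_right reduce_winv_self(2))
  then show ?thesis using F by (simp add: FG_def)
qed

lemma artin_endo_comp:
  assumes "artin_endo n \<phi>" "f \<in> braids n"
  shows "artin_endo n (\<lambda>w. \<phi> (f w))"
proof -
  have hom: "\<And>u v. u \<in> FG n \<Longrightarrow> v \<in> FG n \<Longrightarrow> \<phi> (mult u v) = mult (\<phi> u) (\<phi> v)"
    and FG: "\<And>u. u \<in> FG n \<Longrightarrow> \<phi> u \<in> FG n"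
    using assms(1) by (auto simp: artin_endo_def)
  have "gen_conjugate n (\<phi> (f (gen k)))" if k: "k \<in> {1..n}" for k
  proof -
    obtain j g where j: "j \<in> {1..n}" "g \<in> FG n" "gen j = mult (mult (winv g) (f (gen k))) g"
      using braids_gen_conjugate[OF assms(2) k] by (auto simp: gen_conjugate_def conjugate_def)
    have fk: "f (gen k) \<in> FG n" using braids_in_FG[OF assms(2)] gen_in_FG[OF k] by blast
    have gj: "gen j \<in> FG n" using gen_in_FG[OF j(1)] .
    have "mult (mult g (gen j)) (winv g) = f (gen k)"
    proof -
      have "reduce (g @ (winv g @ f (gen k) @ g) @ winv g) = reduce (f (gen k))"
        by (metis append_Nil2 append_assoc reduce_append_right reduce_winv_right reduce_winv_self(2))
      then show ?thesis unfolding j(3) mult_def using FG_D(2)[OF fk] by simp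
    qed
    then have "\<phi> (f (gen k)) = mult (mult (winv (winv (\<phi> g))) (\<phi> (gen j))) (winv (\<phi> g))"
      using hom[of "mult g (gen j)" "winv g"] hom[of g "gen j"] j gj artin_endo_winv[OF assms(1) j(2)]
      by (simp add: mult_in_FG)
    moreover have "gen_conjugate n (\<phi> (gen j))" using assms(1) j(1) by (simp add: artin_endo_def)
    ultimately show ?thesis using gen_conjugate_conj[of n "\<phi> (gen j)" "winv (\<phi> g)"] FG[OF j(2)] by simp
  qed
  then show ?thesis
    using hom FG braids_in_FG[OF assms(2)] braids_mult[OF assms(2)] braids_z1[OF assms(2)] assms(1)
    by (auto simp: artin_endo_def)
qed

lemma artin_endo_pos_word:
  assumes "artin_endo n \<phi>" "set ks \<subseteq> {1..n}"
  shows "\<phi> (pos_word ks) = reduce (concat (map (\<lambda>k. \<phi> (gen k)) ks))"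
  using assms(2)
proof (induction ks)
  case Nil
  then show ?case using artin_endo_Nil[OF assms(1)] by (simp add: pos_word_def)
next
  case (Cons k ks)
  have "pos_word ks \<in> FG n" using Cons.prems reduced_pos_word by (auto simp: FG_def over_def pos_word_def)
  moreover have "pos_word (k # ks) = mult (gen k) (pos_word ks)"
    using reduced_pos_word[of "k # ks"] by (simp add: mult_def gen_def pos_word_def)
  moreover have "gen k \<in> FG n" using Cons.prems by (auto intro: gen_in_FG)
  ultimately show ?case using Cons assms(1) by (simp add: artin_endo_def mult_def)
qed

lemma artin_endo_product:
  assumes "artin_endo n \<phi>"
  shows "reduce (concat (map (\<lambda>k. \<phi> (gen k)) [1..<n+1])) = pos_word [1..<n+1]"
proof -
  have P: "pos_word [1..<n+1] \<in> FG n" using reduced_pos_word by (auto simp: FG_def over_def pos_word_def)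
  have "winv (\<phi> (pos_word [1..<n+1])) = winv (pos_word [1..<n+1])"
    using assms artin_endo_winv[OF assms P] unfolding artin_endo_def z1_eq by simp
  then have "\<phi> (pos_word [1..<n+1]) = pos_word [1..<n+1]" by (metis winv_winv)
  moreover have "set [1..<n+1] \<subseteq> {1..n}" by auto
  ultimately show ?thesis using artin_endo_pos_word[OF assms] by metis
qed

text \<open>
  If no conjugator swallows the middle letter of a neighbour, then all middle letters survive in the
  reduced product, so that a product of minimal length leaves no room for the conjugators.
\<close>

lemma conj_product_no_cancellation:
  fixes u :: "nat \<Rightarrow> word" and p :: "nat \<Rightarrow> nat"
  defines "x \<equiv> \<lambda>k. u k @ [(p k, False)] @ winv (u k)"
  assumes red: "\<And>k. k \<in> {m..n} \<Longrightarrow> reduced (x k)"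
    and no1: "\<And>k v. m \<le> k \<Longrightarrow> k < n \<Longrightarrow> u k \<noteq> u (k + 1) @ (p (k + 1), False) # v"
    and no2: "\<And>k v. m \<le> k \<Longrightarrow> k < n \<Longrightarrow> u (k + 1) \<noteq> u k @ (p k, True) # v"
    and "m \<le> n"
  shows "\<exists>r. reduce (concat (map x [m..<n+1])) = u m @ (p m, False) # r \<and> n - m \<le> length r \<and>
           (length r = n - m \<longrightarrow> (\<forall>k\<in>{m..n}. u k = []))"
  using \<open>m \<le> n\<close> red no1 no2
proof (induction m rule: inc_induct)
  case base
  show ?case using base(1)[of n] by (intro exI[of _ "winv (u n)"]) (simp add: x_def)
next
  case (step m)
  then obtain r where r: "reduce (concat (map x [Suc m..<n+1])) = u (Suc m) @ (p (Suc m), False) # r"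
    "n - Suc m \<le> length r" "length r = n - Suc m \<longrightarrow> (\<forall>k\<in>{Suc m..n}. u k = [])"
    by fastforce
  \<comment> \<open>At the junction exactly the common prefix \<open>c\<close> of the two
    conjugators cancels; \<open>no1\<close> and \<open>no2\<close> keep the remainders
    \<open>a\<close> and \<open>b\<close> from cancelling against the middle letters.\<close>
  obtain c a b where cab: "u m = c @ a" "u (Suc m) = c @ b" "a = [] \<or> b = [] \<or> hd a \<noteq> hd b"
    using common_prefix by metis
  let ?r = "winv a @ b @ (p (Suc m), False) # r"
  have "reduce (concat (map x [m..<n+1])) = reduce (x m @ u (Suc m) @ (p (Suc m), False) # r)"
    using step.hyps r(1) by (simp add: upt_conv_Cons del: upt_Suc flip: r(1))
  also have "\<dots> = reduce ((u m @ (p m, False) # winv a) @ winv c @ c @ b @ (p (Suc m), False) # r)"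
    by (simp add: x_def cab)
  also have "\<dots> = reduce (u m @ (p m, False) # ?r)"
    by (metis (no_types, lifting) append.assoc append_Cons reduce_append_right reduce_winv_left)
  also have "\<dots> = u m @ (p m, False) # ?r"
  proof (rule reduce_reduced)
    have "reduced (x m)" using step.prems(1)[of m] step.hyps by simp
    moreover have "x m = (u m @ [(p m, False)]) @ winv (u m)" "x m = u m @ ((p m, False) # winv a) @ winv c"
      by (simp_all add: x_def cab)
    ultimately have 1: "reduced (u m @ [(p m, False)])" "reduced ((p m, False) # winv a)"
      by (metis reduced_append_iff)+
    have "reduced (u (Suc m) @ (p (Suc m), False) # r)" using r(1) by (metis reduced_reduce)
    then have 2: "reduced (b @ (p (Suc m), False) # r)" "reduced ((p (Suc m), False) # r)" unfolding cab
      by (auto simp: reduced_append_iff)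
    have 3: "b = [] \<or> hd b \<noteq> (p m, True)" if "a = []"
      using step.prems(3)[of m "tl b"] step.hyps that cab by (cases b) auto
    have 4: "a = [] \<or> hd a \<noteq> (p (Suc m), False)" if "b = []"
      using step.prems(2)[of m "tl a"] step.hyps that cab by (cases a) auto
    have last: "a \<noteq> [] \<Longrightarrow> last (winv a) = inv_letter (hd a)" by (cases a) auto
    have "reduced ((p m, False) # ?r)"
    proof (cases "a = []")
      case True
      then show ?thesis using 2 3 by (cases b) (auto simp: reduced_Cons inv_letter.simps)
    next
      case False
      then have "reduced (((p m, False) # winv a) @ b @ (p (Suc m), False) # r)"
        using 1 2 4 cab(3) last unfolding reduced_append_iff[of "(p m, False) # winv a"] by (cases b) auto
      then show ?thesis by simp
    qed
    then show "reduced (u m @ (p m, False) # ?r)" using 1(1) by (auto simp: reduced_append_iff)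
  qed
  finally have "reduce (concat (map x [m..<n+1])) = u m @ (p m, False) # ?r" .
  moreover have "n - m \<le> length ?r" using r(2) by simp
  \<comment> \<open>A tail of least length leaves room for neither \<open>a\<close> nor
    \<open>b\<close>, and the later conjugators are already known to be empty.\<close>
  moreover have "\<forall>k\<in>{m..n}. u k = []" if "length ?r = n - m"
  proof -
    have "length a + length b + length r + 1 = n - m" using that by simp
    then have "length a = 0 \<and> length b = 0 \<and> length r = n - Suc m" using r(2) step.hyps by linarith
    then have ab: "a = []" "b = []" "length r = n - Suc m" by simp_all
    then have *: "\<forall>k\<in>{Suc m..n}. u k = []" using r(3) by blast
    then have "u (Suc m) = []" using step.hyps by auto
    then have "u m = []" using cab ab by simp
    with * show ?thesis by (metis atLeastAtMost_iff le_antisym not_less_eq_eq)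
  qed
  ultimately show ?case by blast
qed

lemma artin_endo_id:
  assumes "artin_endo n \<phi>" "\<And>k. k \<in> {1..n} \<Longrightarrow> \<phi> (gen k) = gen k" "w \<in> FG n"
  shows "\<phi> w = w"
  using assms(3)
proof (induction w)
  case Nil
  then show ?case using artin_endo_Nil[OF assms(1)] by simp
next
  case (Cons a w)
  have w: "w \<in> FG n" "[a] \<in> FG n" and a: "fst a \<in> {1..n}"
    using Cons.prems by (auto simp: FG_def dest: reduced_ConsD)
  have "\<phi> [a] = [a]"
  proof (cases "snd a")
    case True
    then have "[a] = winv (gen (fst a))" by (cases a) (simp add: gen_def inv_letter.simps)
    then show ?thesis using artin_endo_winv[OF assms(1) gen_in_FG[OF a]] assms(2)[OF a] by simp
  next
    case False
    then have "[a] = gen (fst a)" by (cases a) (simp add: gen_def)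
    then show ?thesis using assms(2)[OF a] by simp
  qed
  moreover have "a # w = mult [a] w" using Cons.prems by (simp add: mult_def FG_def)
  ultimately show ?case using Cons.IH w assms(1) by (simp add: artin_endo_def)
qed

lemma sum_less_at_pair:
  fixes f g :: "nat \<Rightarrow> nat"
  assumes "i \<in> {1..n}" "i + 1 \<in> {1..n}" "\<And>k. k \<noteq> i \<Longrightarrow> k \<noteq> i + 1 \<Longrightarrow> f k = g k" "f i + f (i + 1) < g i + g (i + 1)"
  shows "sum f {1..n} < sum g {1..n}"
proof -
  have *: "sum h {1..n} = h i + (h (i + 1) + sum h ({1..n} - {i} - {i + 1}))" for h :: "nat \<Rightarrow> nat"
    using assms(1,2) by (subst sum.remove[of _ i]; simp; subst sum.remove[of _ "Suc i"]; simp)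
  have "sum f ({1..n} - {i} - {i + 1}) = sum g ({1..n} - {i} - {i + 1})"
    by (rule sum.cong) (auto intro: assms(3))
  then show ?thesis using assms(4) unfolding *[of f] *[of g] by linarith
qed

lemma length_reduce_le: "length (reduce w) \<le> length w"
  using sum_list_reduce_le[of "\<lambda>_. 1" w] by (simp add: sum_list_triv)

text \<open>The measure is the total length of the images of the generators. If a conjugator
  swallows the middle letter of its neighbour, applying \<open>sig k\<close> or
  \<open>sig_inv k\<close> first exchanges the two images and deletes this letter from the longer
  conjugator, so that two letters at least are lost. Afterwards the elementary braid is undone by
  its inverse.\<close>

theorem artin_endo_is_braid:
  assumes "artin_endo n \<phi>"
  shows "\<exists>f\<in>braids n. \<forall>w\<in>FG n. \<phi> w = f w"
  using assms
proof (induction "\<Sum>k\<in>{1..n}. length (\<phi> (gen k))" arbitrary: \<phi> rule: less_induct)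
  case less
  note ar = less.prems
  have hom: "\<And>u v. u \<in> FG n \<Longrightarrow> v \<in> FG n \<Longrightarrow> \<phi> (mult u v) = mult (\<phi> u) (\<phi> v)"
    and FG: "\<And>u. u \<in> FG n \<Longrightarrow> \<phi> u \<in> FG n"
    using ar by (auto simp: artin_endo_def)
  have "\<exists>u j. j \<in> {1..n} \<and> \<phi> (gen k) = u @ [(j, False)] @ winv u" if "k \<in> {1..n}" for k
    using gen_conjugate_normal_form[of n "\<phi> (gen k)"] ar FG gen_in_FG[OF that] that
    unfolding artin_endo_def by metis
  then obtain u p where up: "\<And>k. k \<in> {1..n} \<Longrightarrow> p k \<in> {1..n} \<and> \<phi> (gen k) = u k @ [(p k, False)] @ winv (u k)"
    by metis
  show ?case
  proof (cases "\<exists>k v. 1 \<le> k \<and> k < n \<and> (u k = u (k + 1) @ (p (k + 1), False) # v \<or> u (k + 1) = u k @ (p k, True) # v)")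
    case True
    then obtain k v where k: "1 \<le> k" "k < n" and swallow: "u k = u (k + 1) @ (p (k + 1), False) # v \<or> u (k + 1) = u k @ (p k, True) # v"
      by blast
    note gk = gen_in_FG[of k n] gen_in_FG[of "k + 1" n]
    have kk: "k \<in> {1..n}" "k + 1 \<in> {1..n}" using k by auto
    note x1 = up[OF kk(1), THEN conjunct2] and x2 = up[OF kk(2), THEN conjunct2]
    from swallow show ?thesis
    proof
      assume pos: "u k = u (k + 1) @ (p (k + 1), False) # v"
      have s: "(\<lambda>w. endo (sig k) w) \<in> braids n" using braids.sig[OF braids.id] k by blast
      let ?\<psi> = "\<lambda>w. \<phi> (endo (sig k) w)"
      have new: "?\<psi> (gen k) = \<phi> (gen (k + 1))" "?\<psi> (gen (k + 1)) = mult (mult (winv (\<phi> (gen (k + 1)))) (\<phi> (gen k))) (\<phi> (gen (k + 1)))"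
        "\<And>j. j \<noteq> k \<Longrightarrow> j \<noteq> k + 1 \<Longrightarrow> ?\<psi> (gen j) = \<phi> (gen j)"
      proof -
        have "sig k (k + 1) = mult (mult (winv (gen (k + 1))) (gen k)) (gen (k + 1))"
          by (simp add: sig_def mult_def gen_def reduce_Cons inv_letter.simps)
        then show "?\<psi> (gen (k + 1)) = mult (mult (winv (\<phi> (gen (k + 1)))) (\<phi> (gen k))) (\<phi> (gen (k + 1)))"
          using kk gk by (simp add: endo_sig_gen hom mult_in_FG artin_endo_winv[OF ar])
      qed (simp_all add: endo_sig_gen sig_def)
      \<comment> \<open>Conjugation by the neighbour deletes its middle letter from the conjugator:
        \<open>u (k + 1) @ v\<close> is left.\<close>
      have "?\<psi> (gen (k + 1)) = reduce ((u (k + 1) @ v) @ [(p k, False)] @ winv (u (k + 1) @ v))"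
      proof -
        let ?U = "u (k + 1)" and ?t = "(p (k + 1), False)"
        have "?\<psi> (gen (k + 1)) = reduce ((?U @ [inv_letter ?t]) @ winv ?U @ ?U @ (?t # v @ (p k, False) # winv v @ [inv_letter ?t] @ winv ?U @ ?U @ [?t] @ winv ?U))"
          unfolding new(2) x1 x2 pos mult_def by simp
        also have "\<dots> = reduce (?U @ inv_letter ?t # inv_letter (inv_letter ?t) # v @ (p k, False) # winv v @ [inv_letter ?t] @ winv ?U @ ?U @ [?t] @ winv ?U)"
          by (metis (no_types, lifting) append_Cons append_Nil append_assoc inv_letter_inv_letter reduce_append_right reduce_winv_left)
        also have "\<dots> = reduce ((?U @ v @ (p k, False) # winv v @ [inv_letter ?t]) @ winv ?U @ ?U @ [?t] @ winv ?U)"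
          unfolding reduce_cancel_pair by simp
        also have "\<dots> = reduce ((?U @ v @ (p k, False) # winv v) @ inv_letter ?t # inv_letter (inv_letter ?t) # winv ?U)"
          by (metis (no_types, lifting) append_Cons append_Nil append_assoc inv_letter_inv_letter reduce_append_right reduce_winv_left)
        also have "\<dots> = reduce ((u (k + 1) @ v) @ [(p k, False)] @ winv (u (k + 1) @ v))"
          unfolding reduce_cancel_pair by simp
        finally show ?thesis .
      qed
      then have "length (?\<psi> (gen (k + 1))) < length (\<phi> (gen k))"
        using length_reduce_le[of "(u (k + 1) @ v) @ [(p k, False)] @ winv (u (k + 1) @ v)"] unfolding x1 pos by simp
      then have "(\<Sum>j\<in>{1..n}. length (?\<psi> (gen j))) < (\<Sum>j\<in>{1..n}. length (\<phi> (gen j)))"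
        using kk new(1,3) by (intro sum_less_at_pair[of k]) auto
      from less.hyps[OF this artin_endo_comp[OF ar s]] obtain f where f: "f \<in> braids n" "\<forall>w\<in>FG n. ?\<psi> w = f w" by blast
      then have "\<forall>w\<in>FG n. \<phi> w = f (endo (sig_inv k) w)"
        using endo_sig_sig_inv(2)[OF k] endo_sig_in_FG(2)[OF k] by metis
      then show ?thesis using braids.sig_inv[OF f(1) k] by (intro bexI[of _ "\<lambda>w. f (endo (sig_inv k) w)"]) auto
    next
      assume neg: "u (k + 1) = u k @ (p k, True) # v"
      have s: "(\<lambda>w. endo (sig_inv k) w) \<in> braids n" using braids.sig_inv[OF braids.id] k by blast
      let ?\<psi> = "\<lambda>w. \<phi> (endo (sig_inv k) w)"
      have new: "?\<psi> (gen (k + 1)) = \<phi> (gen k)" "?\<psi> (gen k) = mult (mult (\<phi> (gen k)) (\<phi> (gen (k + 1)))) (winv (\<phi> (gen k)))"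
        "\<And>j. j \<noteq> k \<Longrightarrow> j \<noteq> k + 1 \<Longrightarrow> ?\<psi> (gen j) = \<phi> (gen j)"
      proof -
        have "sig_inv k k = mult (mult (gen k) (gen (k + 1))) (winv (gen k))"
          by (simp add: sig_inv_def mult_def gen_def reduce_Cons inv_letter.simps)
        then show "?\<psi> (gen k) = mult (mult (\<phi> (gen k)) (\<phi> (gen (k + 1)))) (winv (\<phi> (gen k)))"
          using kk gk by (simp add: endo_sig_gen hom mult_in_FG artin_endo_winv[OF ar])
      qed (simp_all add: endo_sig_gen sig_inv_def)
      have "?\<psi> (gen k) = reduce ((u k @ v) @ [(p (k + 1), False)] @ winv (u k @ v))"
      proof -
        let ?U = "u k" and ?t = "(p k, False)"
        have t: "(p k, True) = inv_letter ?t" by (simp add: inv_letter.simps)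
        have "?\<psi> (gen k) = reduce ((?U @ [?t]) @ winv ?U @ ?U @ (inv_letter ?t # v @ (p (k + 1), False) # winv v @ [?t] @ winv ?U @ ?U @ [inv_letter ?t] @ winv ?U))"
          unfolding new(2) x1 x2 neg mult_def t by simp
        also have "\<dots> = reduce (?U @ ?t # inv_letter ?t # v @ (p (k + 1), False) # winv v @ [?t] @ winv ?U @ ?U @ [inv_letter ?t] @ winv ?U)"
          by (metis (no_types, lifting) append_Cons append_Nil append_assoc reduce_append_right reduce_winv_left)
        also have "\<dots> = reduce ((?U @ v @ (p (k + 1), False) # winv v @ [?t]) @ winv ?U @ ?U @ [inv_letter ?t] @ winv ?U)"
          unfolding reduce_cancel_pair by simp
        also have "\<dots> = reduce ((?U @ v @ (p (k + 1), False) # winv v) @ ?t # inv_letter ?t # winv ?U)"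
          by (metis (no_types, lifting) append_Cons append_Nil append_assoc reduce_append_right reduce_winv_left)
        also have "\<dots> = reduce ((u k @ v) @ [(p (k + 1), False)] @ winv (u k @ v))"
          unfolding reduce_cancel_pair by simp
        finally show ?thesis .
      qed
      then have "length (?\<psi> (gen k)) < length (\<phi> (gen (k + 1)))"
        using length_reduce_le[of "(u k @ v) @ [(p (k + 1), False)] @ winv (u k @ v)"] unfolding x2 neg by simp
      then have "(\<Sum>j\<in>{1..n}. length (?\<psi> (gen j))) < (\<Sum>j\<in>{1..n}. length (\<phi> (gen j)))"
        using kk new(1,3) by (intro sum_less_at_pair[of k]) auto
      from less.hyps[OF this artin_endo_comp[OF ar s]] obtain f where f: "f \<in> braids n" "\<forall>w\<in>FG n. ?\<psi> w = f w" by blast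
      then have "\<forall>w\<in>FG n. \<phi> w = f (endo (sig k) w)"
        using endo_sig_sig_inv(1)[OF k] endo_sig_in_FG(1)[OF k] by metis
      then show ?thesis using braids.sig[OF f(1) k] by (intro bexI[of _ "\<lambda>w. f (endo (sig k) w)"]) auto
    qed
  next
    case False
    have "\<phi> w = w" if "w \<in> FG n" for w
    proof (cases "n = 0")
      case True
      then show ?thesis using artin_endo_id[OF ar _ that] by simp
    next
      case n: False
      let ?x = "\<lambda>k. u k @ [(p k, False)] @ winv (u k)"
      have "map (\<lambda>k. \<phi> (gen k)) [1..<n+1] = map ?x [1..<n+1]" 
        by (rule map_cong[OF refl]) (use up in \<open>auto simp del: upt_Suc\<close>)
      then have prod: "reduce (concat (map ?x [1..<n+1])) = pos_word [1..<n+1]"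
        using artin_endo_product[OF ar] by (simp only:)
      have red: "reduced (?x k)" if "k \<in> {1..n}" for k using up[OF that] FG[OF gen_in_FG[OF that]] FG_D(2) by metis
      obtain r where r: "pos_word [1..<n+1] = u 1 @ (p 1, False) # r" "n - 1 \<le> length r"
          "length r = n - 1 \<longrightarrow> (\<forall>k\<in>{1..n}. u k = [])"
      proof -
        have "1 \<le> n" using n by simp
        with conj_product_no_cancellation[of 1 n u p, OF red] False show ?thesis unfolding prod using that by blast
      qed
      \<comment> \<open>The product has \<open>n\<close> letters, exactly the number of middle
        letters that survive, so all conjugators are empty.\<close>
      have "length (pos_word [1..<n+1]) = n" by (simp add: pos_word_def)
      then have "length r = n - 1" using r(1,2) by (simp del: upt_Suc)
      then have nil: "\<forall>k\<in>{1..n}. u k = []" using r(3) by blast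
      have "map ?x [1..<n+1] = map (\<lambda>k. [(p k, False)]) [1..<n+1]" 
        by (rule map_cong[OF refl]) (use nil in \<open>auto simp del: upt_Suc\<close>)
      moreover have "concat (map (\<lambda>k. [(p k, False)]) ks) = pos_word (map p ks)" for ks
        by (induction ks) (auto simp: pos_word_def)
      ultimately have "concat (map ?x [1..<n+1]) = pos_word (map p [1..<n+1])" by (simp only:)
      then have "pos_word (map p [1..<n+1]) = pos_word [1..<n+1]" 
        using prod reduce_reduced[OF reduced_pos_word[of "map p [1..<n+1]"]] by (simp only:)
      then have "map fst (pos_word (map p [1..<n+1])) = map fst (pos_word [1..<n+1])" by simp
      then have "map p [1..<n+1] = [1..<n+1]" by (simp add: pos_word_def comp_def del: upt_Suc)
      then have "p k = k" if "k \<in> {1..n}" for k 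
        using that map_eq_conv[of p "[1..<n+1]" "\<lambda>k. k"] by (auto simp del: upt_Suc)
      then show ?thesis using artin_endo_id[OF ar _ that] up nil by (auto simp: gen_def)
    qed
    then show ?thesis by (intro bexI[OF _ braids.id]) auto
  qed
qed

lemma Bn_artin_endo:
  assumes "\<phi> \<in> Bn n"
  shows "artin_endo n \<phi>"
  using assms bij_betwE[of \<phi> "FG n" "FG n"] unfolding Bn_def is_aut_def artin_endo_def gen_conjugate_def by blast

section \<open>Planar words without simplifying moves\<close>

text \<open>On half-edge indices, \<open>mate\<close> follows an arc and \<open>twin\<close> a
  crossing. The ends have no crossing: truncated subtraction gives \<open>twin 0 = 0\<close>, and
  the twin of the last index \<open>2 * length w + 1\<close> is out of range.\<close>

definition mate :: "nat \<Rightarrow> nat" where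
  "mate i = (if even i then i + 1 else i - 1)"

definition twin :: "nat \<Rightarrow> nat" where
  "twin i = (if odd i then i + 1 else i - 1)"

text \<open>A letter of index \<open>k\<close> contributes one half-edge to each of the two blocks
  of \<open>k\<close>, whatever its sign; so these blocks are equally large.\<close>

lemma card_code_block:
  assumes "over n w" "k \<in> {1..n}"
  shows "card {i. i < 2 * length w + 2 \<and> whitehead_exp n w ! i = 2 * k} = length (filter (\<lambda>a. fst a = k) w)"
    "card {i. i < 2 * length w + 2 \<and> whitehead_exp n w ! i = 2 * k - 1} = length (filter (\<lambda>a. fst a = k) w)"
proof -
  let ?e = "\<lambda>a. [code a, code (inv_letter a)]"
  have *: "length (filter (\<lambda>x. x = 2 * k) (concat (map ?e w))) = length (filter (\<lambda>a. fst a = k) w) \<and>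
      length (filter (\<lambda>x. x = 2 * k - 1) (concat (map ?e w))) = length (filter (\<lambda>a. fst a = k) w)"
    using assms(1)
  proof (induction w)
    case (Cons a w)
    have "code a = 2 * k \<longleftrightarrow> a = (k, True)" "code a = 2 * k - 1 \<longleftrightarrow> a = (k, False)"
      "code (inv_letter a) = 2 * k \<longleftrightarrow> a = (k, False)" "code (inv_letter a) = 2 * k - 1 \<longleftrightarrow> a = (k, True)"
      using Cons.prems assms(2) by (cases a; cases "snd a"; auto simp: code_simps inv_letter.simps; presburger)+
    then show ?case using Cons by (cases a; cases "snd a") auto
  qed simp
  show "card {i. i < 2 * length w + 2 \<and> whitehead_exp n w ! i = 2 * k} = length (filter (\<lambda>a. fst a = k) w)"
    using * length_filter_conv_card[of "\<lambda>x. x = 2 * k" "whitehead_exp n w"] assms(2)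
    by (simp only: length_whitehead_exp) (auto simp: whitehead_exp_def)
  have ne: "Suc (2 * n) \<noteq> 2 * k - Suc 0" using assms(2) by auto
  show "card {i. i < 2 * length w + 2 \<and> whitehead_exp n w ! i = 2 * k - 1} = length (filter (\<lambda>a. fst a = k) w)"
    using * length_filter_conv_card[of "\<lambda>x. x = 2 * k - 1" "whitehead_exp n w"] assms(2) ne
    by (simp only: length_whitehead_exp) (auto simp: whitehead_exp_def)
qed

section \<open>Half-edge combinatorics of a reduced planar word\<close>

locale reduced_drawing =
  fixes n :: nat and w :: word and q :: "nat \<Rightarrow> int"
  assumes over_w: "over n w" and reduced_w: "reduced w" and draw: "index_drawing n w q"
begin

definition V :: "nat set" where "V = {..<2 * length w + 2}"

definition c :: "nat \<Rightarrow> nat" where "c i = whitehead_exp n w ! i"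

definition blk :: "nat \<Rightarrow> nat set" where "blk x = {i \<in> V. c i = x}"

lemma finite_V [simp]: "finite V" "finite (blk x)"
  by (simp_all add: V_def blk_def)

lemma c_0: "c 0 = 0" and c_last: "c (2 * length w + 1) = 2 * n + 1"
  and c_in: "j < length w \<Longrightarrow> c (2 * j + 1) = code (w ! j)"
  and c_out: "j < length w \<Longrightarrow> c (2 * j + 2) = code (inv_letter (w ! j))"
  using whitehead_exp_nth by (simp_all add: c_def)

lemma letter_range: "j < length w \<Longrightarrow> fst (w ! j) \<in> {1..n}"
  using over_w by (auto simp: over_def)

lemma c_pos: "i \<in> V \<Longrightarrow> i \<noteq> 0 \<Longrightarrow> 1 \<le> c i"
proof -
  assume "i \<in> V" "i \<noteq> 0"
  then have "i < 2 * length w + 2" by (simp add: V_def)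
  then show "1 \<le> c i"
    by (cases rule: half_edge_cases)
      (use \<open>i \<noteq> 0\<close> c_last c_in c_out code_bounds[OF letter_range] code_bounds[of "inv_letter (w ! _)" n] letter_range in auto)
qed

lemma c_le: "i \<in> V \<Longrightarrow> i \<noteq> 2 * length w + 1 \<Longrightarrow> c i \<le> 2 * n"
proof -
  assume "i \<in> V" "i \<noteq> 2 * length w + 1"
  then have "i < 2 * length w + 2" by (simp add: V_def)
  then show "c i \<le> 2 * n"
    by (cases rule: half_edge_cases)
      (use \<open>i \<noteq> 2 * length w + 1\<close> c_0 c_in c_out code_bounds[OF letter_range] code_bounds[of "inv_letter (w ! _)" n] letter_range in auto)
qed

lemma c_le_max: "i \<in> V \<Longrightarrow> c i \<le> 2 * n + 1"
  using c_le[of i] c_last by (cases "i = 2 * length w + 1") auto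

lemma mate_V [simp]: "i \<in> V \<Longrightarrow> mate i \<in> V"
  unfolding V_def mate_def lessThan_iff by presburger

lemma mate_mate [simp]: "mate (mate i) = i"
  by (auto simp: mate_def)

lemma mate_eq_iff [simp]: "mate i = mate j \<longleftrightarrow> i = j"
  by (metis mate_mate)

lemma mate_neq [simp]: "mate i \<noteq> i" "i \<noteq> mate i"
  by (auto simp: mate_def elim: oddE)

lemma q_eq_iff: "i \<in> V \<Longrightarrow> j \<in> V \<Longrightarrow> q i = q j \<longleftrightarrow> i = j"
  using draw unfolding index_drawing_def V_def by (auto dest: inj_onD)

lemma q_less_code: "i \<in> V \<Longrightarrow> j \<in> V \<Longrightarrow> q i < q j \<Longrightarrow> c i \<le> c j"
  using draw unfolding index_drawing_def V_def c_def by auto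

lemma code_less_q: "i \<in> V \<Longrightarrow> j \<in> V \<Longrightarrow> c i < c j \<Longrightarrow> q i < q j"
  using q_less_code[of j i] q_eq_iff[of i j] by (metis leD less_irrefl linorder_neqE)

text \<open>Reducedness enters here: an arc inside one block would be a cancelling pair. At the two
  ends, no letter has the code \<open>0\<close> or \<open>2 * n + 1\<close>.\<close>

lemma c_mate_neq: "i \<in> V \<Longrightarrow> c (mate i) \<noteq> c i"
proof -
  have *: "c (2 * j + 1) \<noteq> c (2 * j)" if "j \<le> length w" for j
  proof (cases j)
    case 0
    then show ?thesis using c_pos[of 1] c_0 by (simp add: V_def)
  next
    case (Suc k)
    show ?thesis
    proof (cases "j = length w")
      case True
      then show ?thesis using c_last c_le[of "2 * j"] by (simp add: V_def)
    next
      case False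
      then have "w ! Suc k \<noteq> inv_letter (w ! k)" using reduced_w that Suc by (simp add: reduced_def)
      then have "code (w ! Suc k) \<noteq> code (inv_letter (w ! k))"
        using letter_range[of k] letter_range[of "Suc k"] that False Suc by (subst code_eq_iff) auto
      then show ?thesis using c_in[of j] c_out[of k] that False Suc by simp
    qed
  qed
  assume "i \<in> V"
  then have "i div 2 \<le> length w" by (auto simp: V_def)
  from *[OF this] show ?thesis
    by (cases "even i") (auto simp: mate_def elim!: evenE oddE)
qed

lemma arcs_nested:
  assumes "i \<in> V" "j \<in> V" "j \<noteq> i" "j \<noteq> mate i"
  shows "separates (q i) (q (mate i)) (q j) = separates (q i) (q (mate i)) (q (mate j))"
proof -
  define x y where "x = i div 2" and "y = j div 2"
  have i: "i = 2 * x \<and> mate i = 2 * x + 1 \<or> i = 2 * x + 1 \<and> mate i = 2 * x"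
    unfolding x_def mate_def by auto
  have j: "j = 2 * y \<and> mate j = 2 * y + 1 \<or> j = 2 * y + 1 \<and> mate j = 2 * y"
    unfolding y_def mate_def by auto
  have "x \<noteq> y" using i j assms(3,4) by auto
  moreover have "x \<le> length w" "y \<le> length w" using assms(1,2) by (auto simp: V_def x_def y_def)
  ultimately have "separates (q (2 * x)) (q (2 * x + 1)) (q (2 * y)) = separates (q (2 * x)) (q (2 * x + 1)) (q (2 * y + 1))"
    using draw by (simp add: index_drawing_def)
  then show ?thesis using i j separates_commute by auto
qed

lemma twin_props:
  assumes "i \<in> V" "1 \<le> c i" "c i \<le> 2 * n"
  shows "twin i \<in> V" "twin (twin i) = i" "c (twin i) = (if odd (c i) then c i + 1 else c i - 1)"
    "\<exists>x<length w. i = 2 * x + 1 \<and> twin i = 2 * x + 2 \<or> i = 2 * x + 2 \<and> twin i = 2 * x + 1"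
proof -
  have "i < 2 * length w + 2" using assms(1) by (simp add: V_def)
  then obtain x where x: "x < length w" "i = 2 * x + 1 \<and> twin i = 2 * x + 2 \<or> i = 2 * x + 2 \<and> twin i = 2 * x + 1"
    by (cases rule: half_edge_cases) (use assms c_0 c_last in \<open>auto simp: twin_def\<close>)
  show "\<exists>x<length w. i = 2 * x + 1 \<and> twin i = 2 * x + 2 \<or> i = 2 * x + 2 \<and> twin i = 2 * x + 1"
    using x by blast
  show "twin i \<in> V" using x by (auto simp: V_def)
  show "twin (twin i) = i" using x by (auto simp: twin_def)
  obtain k b where kb: "w ! x = (k, b)" by (cases "w ! x")
  have k: "1 \<le> k" using letter_range[OF x(1)] kb by simp
  show "c (twin i) = (if odd (c i) then c i + 1 else c i - 1)"
    using x c_in[OF x(1)] c_out[OF x(1)] kb k by (cases b) (auto simp: code_simps inv_letter.simps)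
qed

lemma crossings_nested:
  assumes "i \<in> V" "1 \<le> c i" "c i \<le> 2 * n" "j \<in> V" "1 \<le> c j" "c j \<le> 2 * n" "j \<noteq> i" "j \<noteq> twin i"
  shows "separates (q i) (q (twin i)) (q j) = separates (q i) (q (twin i)) (q (twin j))"
proof -
  obtain x where x: "x < length w" "i = 2 * x + 1 \<and> twin i = 2 * x + 2 \<or> i = 2 * x + 2 \<and> twin i = 2 * x + 1"
    using twin_props(4)[OF assms(1-3)] by blast
  obtain y where y: "y < length w" "j = 2 * y + 1 \<and> twin j = 2 * y + 2 \<or> j = 2 * y + 2 \<and> twin j = 2 * y + 1"
    using twin_props(4)[OF assms(4-6)] by blast
  have "x \<noteq> y" using x y assms(7,8) by auto
  then have "separates (q (2 * x + 1)) (q (2 * x + 2)) (q (2 * y + 1)) = separates (q (2 * x + 1)) (q (2 * x + 2)) (q (2 * y + 2))"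
    using draw x y by (simp add: index_drawing_def)
  then show ?thesis using x y separates_commute by auto
qed

text \<open>At every positive index one of \<open>mate\<close> and \<open>twin\<close> steps down by
  one, so a nonempty set closed under both contains \<open>0\<close>.\<close>

lemma no_closed_strand:
  assumes "R \<subseteq> V" "\<And>i. i \<in> R \<Longrightarrow> mate i \<in> R" "\<And>i. i \<in> R \<Longrightarrow> twin i \<in> R" "0 \<notin> R"
  shows "R = {}"
proof -
  have "i \<notin> R" for i
  proof (induction i)
    case 0
    show ?case using assms(4) .
  next
    case (Suc i)
    show ?case
    proof
      assume "Suc i \<in> R"
      then have "mate (Suc i) \<in> R" "twin (Suc i) \<in> R" using assms by auto
      with Suc show False by (cases "even i") (auto simp: mate_def twin_def)
    qed
  qed
  then show ?thesis by blast
qed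

lemma card_blk:
  assumes "k \<in> {1..n}"
  shows "card (blk (2 * k)) = length (filter (\<lambda>a. fst a = k) w)"
    "card (blk (2 * k - 1)) = length (filter (\<lambda>a. fst a = k) w)"
  using card_code_block[OF over_w assms] by (simp_all add: blk_def V_def c_def)

lemma blk_even_empty_iff: "k \<in> {1..n} \<Longrightarrow> blk (2 * k) = {} \<longleftrightarrow> blk (2 * k - 1) = {}"
  using card_blk[of k] by (metis card_0_eq finite_V(2))

lemma blk_last: "blk (2 * n + 1) = {2 * length w + 1}"
  using c_last c_le by (fastforce simp: blk_def V_def)

text \<open>The standard arcs, given by the codes of the left and right end. With
  \<open>x = 2 * n\<close> the arc into the end point is included, and the base point, of code
  \<open>0\<close>, may jump over empty blocks to the first block in use.\<close>

definition good :: "nat \<Rightarrow> nat \<Rightarrow> bool" where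
  "good x y \<longleftrightarrow> even x \<and> odd y \<and> (y = x + 1 \<or> x = 0 \<and> (\<forall>z. 0 < z \<and> z < y \<longrightarrow> blk z = {}))"

text \<open>Arcs with exactly one end in the interval of codes, represented by that end.\<close>

definition cut :: "nat \<Rightarrow> nat \<Rightarrow> nat set" where
  "cut lo hi = {i \<in> V. c i \<in> {lo..hi} \<and> c (mate i) \<notin> {lo..hi}}"

text \<open>
  A sortable \<open>k\<close> admits the move \<open>sig k\<close>, which exchanges the sizes of two neighbouring blocks or shortens the
  word.  For a shrinkable pair the move below, which is a Whitehead automorphism with the cut \<open>{t_k, ..., t_j}\<close>
  (containing the inverses of all these generators but the last), shortens the word.
\<close>

definition sortable :: "nat \<Rightarrow> bool" where
  "sortable k \<longleftrightarrow> 1 \<le> k \<and> k < n \<and> card (blk (2 * k + 1)) < card (blk (2 * k)) \<and>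
     (\<forall>i\<in>blk (2 * k + 1). c (mate i) = 2 * k)"

definition shrinkable :: "nat \<Rightarrow> nat \<Rightarrow> bool" where
  "shrinkable k j \<longleftrightarrow> 1 \<le> k \<and> k < j \<and> j \<le> n \<and> card (cut (2 * k - 1) (2 * j - 1)) < card (blk (2 * j))"

section \<open>Words that admit no move\<close>

context
  assumes not_sortable: "\<And>k. \<not> sortable k" and not_shrinkable: "\<And>k j. \<not> shrinkable k j"
begin

text \<open>If \<open>t_j\<close> occurs in either sign but \<open>t_{j+1}\<close> does not, then
  \<open>sortable j\<close> holds, its condition on arcs being vacuous.\<close>

lemma blk_nonempty_up:
  assumes "1 \<le> k" "k \<le> j" "j \<le> n" "blk (2 * k) \<noteq> {}"
  shows "blk (2 * j) \<noteq> {}"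
  using assms(2,3)
proof (induction j rule: dec_induct)
  case base
  show ?case using assms(4) .
next
  case (step j)
  then have "blk (2 * j) \<noteq> {}" by simp
  then have "0 < card (blk (2 * j))" by (simp add: card_gt_0_iff)
  then have "blk (2 * j + 1) \<noteq> {}"
    using not_sortable[of j] step assms(1) by (auto simp: sortable_def)
  then show ?case using blk_even_empty_iff[of "Suc j"] step by simp
qed

text \<open>Arcs do not cross, so an arc with one end under the arc from \<open>P\<close> to
  \<open>Q\<close> lies under it entirely; being shorter, it is good by minimality. In a good arc
  the left end has the even code, hence the distinction by parity.\<close>

lemma inner_arc_good:
  assumes min: "\<forall>i\<in>V. q i < q (mate i) \<longrightarrow> \<not> good (c i) (c (mate i)) \<longrightarrow>
      q Q - q P \<le> q (mate i) - q i"
    and P: "P \<in> V" "Q = mate P" "q P < q Q"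
    and i: "i \<in> V" "q P < q i" "q i < q Q"
  shows "q P < q (mate i)" "q (mate i) < q Q"
    "odd (c i) \<Longrightarrow> good (c (mate i)) (c i)" "even (c i) \<Longrightarrow> good (c i) (c (mate i))"
proof -
  have ne: "i \<noteq> P" "i \<noteq> Q" using i by auto
  then have ne': "mate i \<noteq> P" "mate i \<noteq> Q" using P(2) by auto
  have "separates (q P) (q Q) (q i) = separates (q P) (q Q) (q (mate i))"
    using arcs_nested[of P i] P i ne by simp
  then have "separates (q P) (q Q) (q (mate i))" using i by (simp add: separates_def)
  moreover have "q (mate i) \<noteq> q Q" using ne' q_eq_iff[of "mate i" Q] P i by auto
  ultimately show in': "q P < q (mate i)" "q (mate i) < q Q"
    using P(3) by (auto simp: separates_def)
  have "q i \<noteq> q (mate i)" using q_eq_iff[of i "mate i"] i by simp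
  then consider "q i < q (mate i)" | "q (mate i) < q i" by linarith
  then have "good (c i) (c (mate i)) \<or> good (c (mate i)) (c i)"
  proof cases
    case 1
    then show ?thesis using min[rule_format, of i] i in' by fastforce
  next
    case 2
    then show ?thesis using min[rule_format, of "mate i"] i in' by fastforce
  qed
  then show "odd (c i) \<Longrightarrow> good (c (mate i)) (c i)" "even (c i) \<Longrightarrow> good (c i) (c (mate i))"
    by (auto simp: good_def)
qed

lemma all_arcs_good:
  assumes "i \<in> V" "q i < q (mate i)"
  shows "good (c i) (c (mate i))"
proof (rule ccontr)
  \<comment> \<open>A bad arc of minimal span has only good arcs below it.  If its left end is an inverse letter or the
    base point, a sorting move applies; if both ends are positive letters, a shrinking move applies;
    otherwise the strands below it close up to a loop.\<close>
  assume "\<not> good (c i) (c (mate i))"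
  let ?bad = "\<lambda>i. i \<in> V \<and> q i < q (mate i) \<and> \<not> good (c i) (c (mate i))"
  have "?bad i" using assms \<open>\<not> good _ _\<close> by simp
  from ex_has_least_nat[of ?bad, OF this, of "\<lambda>i. nat (q (mate i) - q i)"]
  obtain P where P: "?bad P" and minP: "\<And>i. ?bad i \<Longrightarrow> nat (q (mate P) - q P) \<le> nat (q (mate i) - q i)"
    by blast
  define Q where "Q = mate P"
  have PV: "P \<in> V" "Q \<in> V" "Q = mate P" "q P < q Q" "mate Q = P" "Q \<noteq> P" using P by (simp_all add: Q_def)
  have bad: "\<not> good (c P) (c Q)" using P by (simp add: Q_def)
  have min: "\<forall>i\<in>V. q i < q (mate i) \<longrightarrow> \<not> good (c i) (c (mate i)) \<longrightarrow> q Q - q P \<le> q (mate i) - q i"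
  proof (intro ballI impI)
    fix i assume "i \<in> V" "q i < q (mate i)" "\<not> good (c i) (c (mate i))"
    then show "q Q - q P \<le> q (mate i) - q i"
      using minP[of i] PV(4) unfolding Q_def[symmetric] by simp
  qed
  note inner = inner_arc_good[OF min PV(1,3,4)]
  have lt: "c P < c Q" using q_less_code[OF PV(1,2,4)] c_mate_neq[OF PV(1)] by (simp add: Q_def)
  have inside: "q P < q i \<and> q i < q Q" if "i \<in> V" "c P < c i" "c i < c Q" for i
    using code_less_q PV that by blast
  \<comment> \<open>Under the arc the exception for the base point in \<open>good\<close> does not
    arise, because the base point is the leftmost half-edge.\<close>
  have even_up: "c (mate i) = c i + 1" if "i \<in> V" "q P < q i" "q i < q Q" "even (c i)" for i
  proof -
    have "i \<noteq> 0"
    proof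
      assume "i = 0"
      then have "c P \<le> 0" using q_less_code[OF PV(1) that(1,2)] c_0 by simp
      then have "P = 0" using c_pos[OF PV(1)] by linarith
      with \<open>i = 0\<close> that(2) show False by simp
    qed
    then have "1 \<le> c i" using c_pos that by simp
    then show ?thesis using inner(4)[OF that] by (simp add: good_def)
  qed
  have odd_down: "c (mate i) + 1 = c i" if "i \<in> V" "q P < q i" "q i < q Q" "odd (c i)" for i
    using even_up[of "mate i"] inner(1,2,3)[OF that(1-3)] that by (simp add: good_def)
  show False
  proof (cases "even (c P)")
    case True
    then obtain k where k: "c P = 2 * k" by (elim evenE)
    show False
    proof (cases "k = 0")
      case False
      then have "c Q \<noteq> 2 * k + 1" using bad k by (auto simp: good_def)
      then have Q2: "2 * k + 2 \<le> c Q" using lt k by linarith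
      then have kn: "k < n" using c_le_max[OF PV(2)] by linarith
      \<comment> \<open>The whole block of \<open>t_{k+1}\<close> lies under the arc, so its arcs
        lead to the block of the inverse of \<open>t_k\<close>, which contains \<open>P\<close> in
        addition.\<close>
      have down: "c (mate i) = 2 * k" if "i \<in> blk (2 * k + 1)" for i
      proof -
        have i: "i \<in> V" "c i = 2 * k + 1" using that by (auto simp: blk_def)
        then have "q P < q i \<and> q i < q Q" using inside[OF i(1)] k Q2 by simp
        then show ?thesis using odd_down[OF i(1)] i by simp
      qed
      have "mate ` blk (2 * k + 1) \<subseteq> blk (2 * k) - {P}"
        using down Q2 by (auto simp: blk_def Q_def)
      then have "card (mate ` blk (2 * k + 1)) \<le> card (blk (2 * k) - {P})" by (intro card_mono) auto
      moreover have "card (mate ` blk (2 * k + 1)) = card (blk (2 * k + 1))" by (intro card_image inj_onI) simp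
      moreover have "card (blk (2 * k) - {P}) < card (blk (2 * k))"
        by (intro card_Diff1_less) (use PV(1) k in \<open>auto simp: blk_def\<close>)
      ultimately have "sortable k" using False kn down by (auto simp: sortable_def)
      with not_sortable show False by blast
    next
      case True
      then have "c P = 0" using k by simp
      then have P0: "P = 0" using c_pos[OF PV(1)] by linarith
      \<comment> \<open>Badness at the base point means that some block below \<open>Q\<close> is in
        use; if \<open>c Q\<close> is even, the other block of the same generator is one. The first
        block in use has an odd code, and its arcs would lead to a still earlier one, a
        contradiction without any move.\<close>
      have "\<exists>z. 0 < z \<and> z < c Q \<and> blk z \<noteq> {}"
      proof (cases "odd (c Q)")
        case True
        then show ?thesis using bad \<open>c P = 0\<close> by (auto simp: good_def)
      next
        case False
        then obtain j where j: "c Q = 2 * j" by (auto elim: evenE)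
        have "Q \<in> blk (2 * j)" using PV j by (simp add: blk_def)
        moreover have jn: "j \<in> {1..n}" using j lt c_le_max[OF PV(2)] by auto
        ultimately have "blk (2 * j - 1) \<noteq> {}" using blk_even_empty_iff by blast
        moreover have "0 < 2 * j - 1 \<and> 2 * j - 1 < c Q" using j jn by auto
        ultimately show ?thesis by blast
      qed
      then obtain z0 where "0 < z0 \<and> z0 < c Q \<and> blk z0 \<noteq> {}" by blast
      from ex_has_least_nat[of "\<lambda>z. 0 < z \<and> z < c Q \<and> blk z \<noteq> {}", OF this, of "\<lambda>z. z"]
      obtain z where z: "0 < z" "z < c Q" "blk z \<noteq> {}" and zmin: "\<And>y. 0 < y \<Longrightarrow> y < z \<Longrightarrow> blk y = {}"
        by (metis (lifting) le_less_trans less_imp_le not_le order.strict_trans)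
      obtain i where i: "i \<in> V" "c i = z" using z by (auto simp: blk_def)
      have ins: "q P < q i" "q i < q Q" using inside[OF i(1)] i z \<open>c P = 0\<close> by auto
      have "odd z"
      proof
        assume "even z"
        then obtain j where j: "z = 2 * j" by (elim evenE)
        then have "j \<in> {1..n}" using z c_le_max[OF PV(2)] by auto
        then have "blk (2 * j - 1) \<noteq> {}" using blk_even_empty_iff j z by blast
        then show False using zmin[of "2 * j - 1"] j z by auto
      qed
      then have "c (mate i) + 1 = z" using odd_down[OF i(1) ins] i by simp
      moreover have "mate i \<noteq> 0" using inner(1)[OF i(1) ins] P0 by (metis less_irrefl)
      then have "1 \<le> c (mate i)" using c_pos i by simp
      moreover have "mate i \<in> blk (c (mate i))" using i by (simp add: blk_def)
      ultimately show False using zmin[of "c (mate i)"] by auto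
    qed
  next
    case False
    then obtain k0 where "c P = 2 * k0 + 1" by (elim oddE)
    define k where "k = k0 + 1"
    have k: "c P = 2 * k - 1" "1 \<le> k" using \<open>c P = 2 * k0 + 1\<close> by (simp_all add: k_def)
    have kn: "k \<le> n" using lt k c_le_max[OF PV(2)] by linarith
    have up: "c (mate i) = 2 * x + 1" if "i \<in> blk (2 * x)" "k \<le> x" "2 * x < c Q" for i x
    proof -
      have i: "i \<in> V" "c i = 2 * x" using that by (auto simp: blk_def)
      then have "q P < q i \<and> q i < q Q" using inside[OF i(1)] k that by simp
      then show ?thesis using even_up[OF i(1)] i by simp
    qed
    have down: "c (mate i) = 2 * x - 2" if "i \<in> blk (2 * x - 1)" "k < x" "2 * x - 1 < c Q" for i x
    proof -
      have i: "i \<in> V" "c i = 2 * x - 1" using that by (auto simp: blk_def)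
      then have "q P < q i \<and> q i < q Q" using inside[OF i(1)] k that by simp
      moreover have "odd (c i)" using i(2) that(2) by simp
      ultimately show ?thesis using odd_down[OF i(1)] i by simp
    qed
    show False
    proof (cases "odd (c Q)")
      case True
      then obtain j0 where "c Q = 2 * j0 + 1" by (elim oddE)
      define j where "j = j0 + 1"
      have j: "c Q = 2 * j - 1" "k < j" using \<open>c Q = 2 * j0 + 1\<close> lt k by (simp_all add: j_def)
      have jn: "j \<le> n + 1" using j c_le_max[OF PV(2)] by linarith
      show False
      proof (cases "j = n + 1")
        case True
        \<comment> \<open>Here \<open>Q\<close> is the end point. The block of the inverse of
          \<open>t_n\<close> is in use, and its arcs lead to the end point as well, which has room
          for a single arc.\<close>
        have "P \<in> blk (2 * k - 1)" using PV k by (simp add: blk_def)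
        then have "blk (2 * k) \<noteq> {}" using blk_even_empty_iff[of k] k kn by auto
        then have "blk (2 * n) \<noteq> {}" using blk_nonempty_up[of k n] k kn by simp
        then obtain i where i: "i \<in> blk (2 * n)" by blast
        then have "mate i \<in> blk (2 * n + 1)" using up[OF i kn] j True by (simp add: blk_def)
        moreover have "Q \<in> blk (2 * n + 1)" using PV j True by (simp add: blk_def)
        ultimately have "mate i = Q" using blk_last by simp
        then have "i = P" using PV by simp
        then show False using i k kn by (auto simp: blk_def)
      next
        case False
        then have jn: "j \<le> n" using jn by simp
        \<comment> \<open>\<open>O'\<close> and \<open>Ev\<close> are the half-edges of the cut with
          odd and even codes. Arcs match \<open>Ev\<close> into \<open>O'\<close>, and since the two
          blocks of each generator are equally large, \<open>card (blk (2 * j))\<close> elements of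
          \<open>O'\<close> remain. One of them is \<open>P\<close>, whose arc stays inside the
          cut.\<close>
        define O' where "O' = (\<Union>x\<in>{k..j}. blk (2 * x - 1))"
        define Ev where "Ev = (\<Union>x\<in>{k..<j}. blk (2 * x))"
        have fin: "finite O'" "finite Ev" by (simp_all add: O'_def Ev_def)
        have "card O' = (\<Sum>x\<in>{k..j}. card (blk (2 * x - 1)))"
          unfolding O'_def
        proof (rule card_UN_disjoint)
          show "\<forall>x\<in>{k..j}. \<forall>y\<in>{k..j}. x \<noteq> y \<longrightarrow> blk (2 * x - 1) \<inter> blk (2 * y - 1) = {}"
            using k(2) by (auto simp: blk_def)
        qed simp_all
        also have "\<dots> = (\<Sum>x\<in>{k..j}. card (blk (2 * x)))"
          using card_blk k(2) jn by (intro sum.cong) auto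
        also have "\<dots> = (\<Sum>x\<in>{k..<j}. card (blk (2 * x))) + card (blk (2 * j))"
          using j(2) by (simp add: sum.last_plus flip: atLeastLessThanSuc_atLeastAtMost)
        also have "(\<Sum>x\<in>{k..<j}. card (blk (2 * x))) = card Ev"
          unfolding Ev_def by (rule card_UN_disjoint[symmetric]) (auto simp: blk_def)
        finally have cardO: "card O' = card Ev + card (blk (2 * j))" .
        have subO: "mate ` Ev \<subseteq> O'"
        proof
          fix y assume "y \<in> mate ` Ev"
          then obtain i x where i: "y = mate i" "x \<in> {k..<j}" "i \<in> blk (2 * x)" by (auto simp: Ev_def)
          then have "c y = 2 * (x + 1) - 1" "y \<in> V" using up[OF i(3)] j by (auto simp: blk_def)
          then have "y \<in> blk (2 * (x + 1) - 1)" by (simp add: blk_def)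
          moreover have "x + 1 \<in> {k..j}" using i by simp
          ultimately show "y \<in> O'" unfolding O'_def by blast
        qed
        define X where "X = O' - mate ` Ev"
        have cardX: "card X = card (blk (2 * j))"
        proof -
          have "card X = card O' - card (mate ` Ev)" unfolding X_def using subO fin by (intro card_Diff_subset) auto
          moreover have "card (mate ` Ev) = card Ev" by (intro card_image inj_onI) simp
          ultimately show ?thesis using cardO by simp
        qed
        have PX: "P \<in> X"
        proof -
          have "P \<in> O'" unfolding O'_def using PV k j by (auto simp: blk_def intro!: bexI[of _ k])
          moreover have "P \<notin> mate ` Ev"
          proof
            assume "P \<in> mate ` Ev"
            then have "mate P \<in> Ev" by auto
            then have "even (c Q)" by (auto simp: Ev_def blk_def Q_def)
            with True show False by simp
          qed
          ultimately show ?thesis by (simp add: X_def)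
        qed
        have "cut (2 * k - 1) (2 * j - 1) \<subseteq> X - {P}"
        proof
          fix i assume "i \<in> cut (2 * k - 1) (2 * j - 1)"
          then have i: "i \<in> V" "2 * k - 1 \<le> c i" "c i \<le> 2 * j - 1" "\<not> (2 * k - 1 \<le> c (mate i) \<and> c (mate i) \<le> 2 * j - 1)"
            by (auto simp: cut_def)
          have "odd (c i)"
          proof
            assume "even (c i)"
            then obtain x where x: "c i = 2 * x" by (elim evenE)
            then have "k \<le> x" "x < j" using i k j by linarith+
            then have "c (mate i) = 2 * x + 1" using up[of i x] x i j by (simp add: blk_def)
            then show False using i \<open>k \<le> x\<close> \<open>x < j\<close> by linarith
          qed
          then obtain x where x: "c i = 2 * x + 1" by (elim oddE)
          have "i \<in> blk (2 * (x + 1) - 1)" "x + 1 \<in> {k..j}" using x i by (auto simp: blk_def)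
          then have "i \<in> O'" unfolding O'_def by blast
          moreover have "i \<notin> mate ` Ev"
          proof
            assume "i \<in> mate ` Ev"
            then have "mate i \<in> Ev" by auto
            then obtain y where "c (mate i) = 2 * y" "k \<le> y" "y < j" by (auto simp: Ev_def blk_def)
            then show False using i by linarith
          qed
          moreover have "i \<noteq> P" using i k j by (auto simp: Q_def[symmetric])
          ultimately show "i \<in> X - {P}" by (simp add: X_def)
        qed
        then have "card (cut (2 * k - 1) (2 * j - 1)) \<le> card (X - {P})"
          using fin by (intro card_mono) (auto simp: X_def)
        also have "\<dots> < card X" using PX fin by (intro card_Diff1_less) (auto simp: X_def)
        finally have "shrinkable k j" using cardX j k jn by (simp add: shrinkable_def)
        with not_shrinkable show False by blast
      qed
    next
      case False
      then obtain j where j: "c Q = 2 * j" by (auto elim: evenE)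
      have kj: "k \<le> j" "j \<le> n" using j lt k c_le_max[OF PV(2)] by linarith+
      \<comment> \<open>The innermost half-edges: the last of the block of \<open>t_x\<close> and
        the first of the block of its inverse. Crossings join \<open>rm x\<close> to
        \<open>lm x\<close>, arcs join \<open>lm x\<close> to \<open>rm (x + 1)\<close>, and the arc
        from \<open>P\<close> to \<open>Q\<close> joins the first of these to the last; together
        they form the closed loop \<open>R\<close>.\<close>
      define rm where "rm x i \<longleftrightarrow> i \<in> blk (2 * x - 1) \<and> (\<forall>y\<in>blk (2 * x - 1). q y \<le> q i)" for x i
      define lm where "lm x i \<longleftrightarrow> i \<in> blk (2 * x) \<and> (\<forall>y\<in>blk (2 * x). q i \<le> q y)" for x i
      define R where "R = {i. \<exists>x\<in>{k..j}. rm x i \<or> lm x i}"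
      have blkD: "i \<in> V" "c i = x" if "i \<in> blk x" for i x using that by (auto simp: blk_def)
      \<comment> \<open>A later half-edge of the same block would lie under the arc and be joined to
        the code \<open>2 * k - 2\<close>, which is too small for a position to the right of
        \<open>P\<close>.\<close>
      have rmP: "rm k P"
        unfolding rm_def
      proof (intro conjI ballI)
        show "P \<in> blk (2 * k - 1)" using PV k by (simp add: blk_def)
        fix y assume y: "y \<in> blk (2 * k - 1)"
        show "q y \<le> q P"
        proof (rule ccontr)
          assume "\<not> q y \<le> q P"
          then have 1: "q P < q y" "q y < q Q" using code_less_q[of y Q] blkD[OF y] PV k j kj by auto
          have "odd (c y)" using blkD[OF y] k by simp
          then have "c (mate y) + 1 = 2 * k - 1" using odd_down[OF blkD(1)[OF y] 1] blkD[OF y] by simp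
          moreover have "c P \<le> c (mate y)" using q_less_code[OF PV(1) _ inner(1)[OF blkD(1)[OF y] 1]] blkD[OF y] by simp
          ultimately show False using k by simp
        qed
      qed
      have lmQ: "lm j Q"
        unfolding lm_def
      proof (intro conjI ballI)
        show "Q \<in> blk (2 * j)" using PV j by (simp add: blk_def)
        fix y assume y: "y \<in> blk (2 * j)"
        show "q Q \<le> q y"
        proof (rule ccontr)
          assume "\<not> q Q \<le> q y"
          then have 1: "q P < q y" "q y < q Q" using code_less_q[of P y] blkD[OF y] PV k j kj by auto
          have "c (mate y) = 2 * j + 1" using even_up[OF blkD(1)[OF y] 1] blkD[OF y] by simp
          moreover have "c (mate y) \<le> c Q" using q_less_code[OF _ PV(2) inner(2)[OF blkD(1)[OF y] 1]] blkD[OF y] by simp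
          ultimately show False using j by simp
        qed
      qed
      have rm_unique: "i = i'" if "rm x i" "rm x i'" for x i i'
        using that q_eq_iff[of i i'] blkD unfolding rm_def by (meson order_antisym)
      have lm_unique: "i = i'" if "lm x i" "lm x i'" for x i i'
        using that q_eq_iff[of i i'] blkD unfolding lm_def by (meson order_antisym)
      \<comment> \<open>Crossings between two adjacent blocks are nested, so the innermost
        half-edges of the two blocks belong to the same crossing.\<close>
      have cross_rm: "lm x (twin i)" if "rm x i" "x \<in> {k..j}" for x i
      proof -
        have i: "i \<in> V" "c i = 2 * x - 1" using that blkD by (auto simp: rm_def)
        have x: "1 \<le> x" "x \<le> n" using that k kj by auto
        have ci: "1 \<le> c i" "c i \<le> 2 * n" using i x by linarith+
        note m = twin_props[OF i(1) ci]
        have mi: "twin i \<in> blk (2 * x)" using m(1,3) i x by (simp add: blk_def)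
        have "q (twin i) \<le> q y" if y: "y \<in> blk (2 * x)" for y
        proof (rule ccontr)
          assume less: "\<not> q (twin i) \<le> q y"
          have cy: "1 \<le> c y" "c y \<le> 2 * n" using blkD[OF y] x by auto
          note my = twin_props[OF blkD(1)[OF y] cy]
          have y': "twin y \<in> blk (2 * x - 1)" using my(1,3) blkD[OF y] x by (simp add: blk_def)
          have ne: "y \<noteq> twin i" "y \<noteq> i" using less blkD[OF y] i x by auto
          then have "twin y \<noteq> i" using my(2) by auto
          then have "q (twin y) < q i"
            using \<open>rm x i\<close> y' q_eq_iff[OF blkD(1)[OF y'] i(1)] unfolding rm_def by (metis order_le_less)
          moreover have "q i < q y" using code_less_q[OF i(1) blkD(1)[OF y]] i blkD[OF y] x by simp
          ultimately show False
            using crossings_nested[OF i(1) ci blkD(1)[OF y] cy ne(2,1)] less by (auto simp: separates_def)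
        qed
        with mi show ?thesis by (simp add: lm_def)
      qed
      have cross_lm: "rm x (twin i)" if "lm x i" "x \<in> {k..j}" for x i
      proof -
        have i: "i \<in> V" "c i = 2 * x" using that blkD by (auto simp: lm_def)
        have x: "1 \<le> x" "x \<le> n" using that k kj by auto
        have ci: "1 \<le> c i" "c i \<le> 2 * n" using i x by linarith+
        note m = twin_props[OF i(1) ci]
        have mi: "twin i \<in> blk (2 * x - 1)" using m(1,3) i x by (simp add: blk_def)
        have "q y \<le> q (twin i)" if y: "y \<in> blk (2 * x - 1)" for y
        proof (rule ccontr)
          assume less: "\<not> q y \<le> q (twin i)"
          have cy: "1 \<le> c y" "c y \<le> 2 * n" using blkD[OF y] x by linarith+
          note my = twin_props[OF blkD(1)[OF y] cy]
          have y': "twin y \<in> blk (2 * x)" using my(1,3) blkD[OF y] x by (simp add: blk_def)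
          have ne: "y \<noteq> twin i" "y \<noteq> i" using less blkD[OF y] i x by auto
          then have "twin y \<noteq> i" using my(2) by auto
          then have "q i < q (twin y)"
            using \<open>lm x i\<close> y' q_eq_iff[OF i(1) blkD(1)[OF y']] unfolding lm_def by (metis order_le_less)
          moreover have "q y < q i" using code_less_q[OF blkD(1)[OF y] i(1)] i blkD[OF y] x by simp
          ultimately show False
            using crossings_nested[OF i(1) ci blkD(1)[OF y] cy ne(2,1)] less by (auto simp: separates_def)
        qed
        with mi show ?thesis by (simp add: rm_def)
      qed
      \<comment> \<open>By \<open>up\<close> and \<open>down\<close> all arcs at these two blocks
        run between them; so they are nested too, and the innermost ends are mates.\<close>
      have arc_lm: "rm (x + 1) (mate i)" if "lm x i" "k \<le> x" "x < j" for x i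
      proof -
        have i: "i \<in> V" "c i = 2 * x" "i \<in> blk (2 * x)" using that blkD by (auto simp: lm_def)
        have mi: "mate i \<in> blk (2 * (x + 1) - 1)" using up[OF i(3)] that j i by (simp add: blk_def)
        have "q y \<le> q (mate i)" if y: "y \<in> blk (2 * (x + 1) - 1)" for y
        proof (rule ccontr)
          assume less: "\<not> q y \<le> q (mate i)"
          have y': "mate y \<in> blk (2 * x)" using down[OF y] \<open>k \<le> x\<close> \<open>x < j\<close> j blkD[OF y] by (simp add: blk_def)
          have ne: "y \<noteq> mate i" "y \<noteq> i" using less blkD[OF y] i by auto
          then have "mate y \<noteq> i" by auto
          then have "q i < q (mate y)"
            using \<open>lm x i\<close> y' q_eq_iff[OF i(1) blkD(1)[OF y']] unfolding lm_def by (metis order_le_less)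
          moreover have "q (mate y) < q (mate i)" using code_less_q[OF blkD(1)[OF y'] blkD(1)[OF mi]] blkD[OF y'] blkD[OF mi] by simp
          ultimately show False
            using arcs_nested[OF i(1) blkD(1)[OF y] ne(2,1)] less by (auto simp: separates_def)
        qed
        with mi show ?thesis by (simp add: rm_def)
      qed
      have arc_rm: "lm (x - 1) (mate i)" if "rm x i" "k < x" "x \<le> j" for x i
      proof -
        have i: "i \<in> V" "c i = 2 * x - 1" "i \<in> blk (2 * x - 1)" using that blkD by (auto simp: rm_def)
        have mi: "mate i \<in> blk (2 * (x - 1))" using down[OF i(3)] that j i by (simp add: blk_def algebra_simps)
        have "q (mate i) \<le> q y" if y: "y \<in> blk (2 * (x - 1))" for y
        proof (rule ccontr)
          assume less: "\<not> q (mate i) \<le> q y"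
          have y': "mate y \<in> blk (2 * x - 1)" using up[OF y] \<open>k < x\<close> \<open>x \<le> j\<close> j blkD[OF y] by (simp add: blk_def)
          have ne: "y \<noteq> mate i" "y \<noteq> i" using less blkD[OF y] i \<open>k < x\<close> by auto
          then have "mate y \<noteq> i" by auto
          then have "q (mate y) < q i"
            using \<open>rm x i\<close> y' q_eq_iff[OF blkD(1)[OF y'] i(1)] unfolding rm_def by (metis order_le_less)
          moreover have "q (mate i) < q (mate y)"
            using code_less_q[OF blkD(1)[OF mi] blkD(1)[OF y']] blkD[OF y'] blkD[OF mi] \<open>k < x\<close> by simp
          ultimately show False
            using arcs_nested[OF i(1) blkD(1)[OF y] ne(2,1)] less by (auto simp: separates_def)
        qed
        with mi show ?thesis by (simp add: lm_def)
      qed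
      have "R = {}"
      proof (rule no_closed_strand)
        show "R \<subseteq> V" by (auto simp: R_def rm_def lm_def blk_def)
        show "0 \<notin> R" using c_0 k(2) by (auto simp: R_def rm_def lm_def blk_def)
        fix i assume "i \<in> R"
        then obtain x where x: "x \<in> {k..j}" "rm x i \<or> lm x i" by (auto simp: R_def)
        show "twin i \<in> R" using x cross_rm cross_lm unfolding R_def by blast
        show "mate i \<in> R"
          using x(2)
        proof
          assume rm: "rm x i"
          show ?thesis
          proof (cases "x = k")
            case True
            then have "i = P" using rm rmP rm_unique by blast
            then show ?thesis using lmQ kj by (auto simp: R_def Q_def)
          next
            case False
            then have "lm (x - 1) (mate i)" using arc_rm[OF rm] x by auto
            moreover have "x - 1 \<in> {k..j}" using x False by auto
            ultimately show ?thesis by (auto simp: R_def)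
          qed
        next
          assume lm: "lm x i"
          show ?thesis
          proof (cases "x = j")
            case True
            then have "i = Q" using lm lmQ lm_unique by blast
            then show ?thesis using rmP kj PV by (auto simp: R_def)
          next
            case False
            then have "rm (x + 1) (mate i)" using arc_lm[OF lm] x by auto
            moreover have "x + 1 \<in> {k..j}" using x False by auto
            ultimately show ?thesis by (auto simp: R_def)
          qed
        qed
      qed
      then show False using rmP kj by (auto simp: R_def)
    qed
  qed
qed

lemma even_code_arc:
  assumes "i \<in> V" "even (c i)"
  shows "odd (c (mate i))"
proof -
  have "q i \<noteq> q (mate i)" using q_eq_iff[of i "mate i"] assms(1) by simp
  then consider "q i < q (mate i)" | "q (mate i) < q i" by linarith
  then show ?thesis
    using all_arcs_good[of i] all_arcs_good[of "mate i"] assms by cases (auto simp: good_def)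
qed

text \<open>Follow the path from the base point: from an even code the arc leads to an odd one, the
  entry of a positive letter, whose exit has an even code again.\<close>

lemma all_letters_positive: "j < length w \<Longrightarrow> \<not> snd (w ! j)"
proof -
  have pos: "\<not> snd (w ! j)" if "j < length w" "odd (c (2 * j + 1))" for j
    using that c_in[of j] by (cases "w ! j") (auto simp: code.simps)
  show "\<not> snd (w ! j)" if "j < length w" for j
    using that
  proof (induction j)
    case 0
    then show ?case using pos[of 0] even_code_arc[of 0] c_0 by (simp add: V_def mate_def)
  next
    case (Suc j)
    then have "even (c (2 * j + 2))" using c_out[of j] by (cases "w ! j") (auto simp: code.simps inv_letter.simps)
    moreover have "2 * j + 2 \<in> V" using Suc by (simp add: V_def)
    ultimately have "odd (c (2 * Suc j + 1))" using even_code_arc[of "2 * j + 2"] by (simp add: mate_def)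
    then show ?case using pos[of "Suc j"] Suc by simp
  qed
qed

end

end

section \<open>The simplifying moves\<close>

text \<open>
  A Whitehead automorphism with cut \<open>S\<close> and multiplier \<open>v\<close> maps a letter \<open>a\<close> to \<open>core a\<close>, preceded by the inverse of \<open>v\<close> if
  \<open>a\<close> lies in \<open>S\<close> and followed by \<open>v\<close> if the inverse of \<open>a\<close> lies in \<open>S\<close>.  After cancellation one \<open>v\<close> is left for
  each arc leaving \<open>S\<close>.
\<close>

fun cut_word :: "(nat \<Rightarrow> bool) \<Rightarrow> letter \<Rightarrow> (letter \<Rightarrow> word) \<Rightarrow> bool \<Rightarrow> word \<Rightarrow> word" where
  "cut_word S v core b [] = (if b then [v] else [])"
| "cut_word S v core b (a # w) = (if b = S (code a) then [] else if b then [v] else [inv_letter v]) @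
     core a @ cut_word S v core (S (code (inv_letter a))) w"

fun cut_count :: "(nat \<Rightarrow> bool) \<Rightarrow> bool \<Rightarrow> word \<Rightarrow> nat" where
  "cut_count S b [] = of_bool b"
| "cut_count S b (a # w) = of_bool (b \<noteq> S (code a)) + cut_count S (S (code (inv_letter a))) w"

text \<open>The flag \<open>b\<close> tells whether the preceding letter has left a \<open>v\<close>
  behind. It cancels exactly if the next letter lies in \<open>S\<close> and so brings
  \<open>inv_letter v\<close>.\<close>

lemma reduce_subst_eq_cut_word:
  assumes "\<And>a. a \<in> set w \<Longrightarrow> subst_letter h a =
    (if S (code a) then [inv_letter v] else []) @ core a @ (if S (code (inv_letter a)) then [v] else [])"
  shows "reduce ((if b then [v] else []) @ subst h w) = reduce (cut_word S v core b w)"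
  using assms
proof (induction w arbitrary: b)
  case (Cons a w)
  let ?pre = "if S (code a) then [inv_letter v] else []" and ?post = "if S (code (inv_letter a)) then [v] else []"
    and ?b = "if b then [v] else []" and ?x = "if b = S (code a) then [] else if b then [v] else [inv_letter v]"
  have "reduce (?b @ subst h (a # w)) = reduce ((?b @ ?pre) @ core a @ ?post @ subst h w)"
    using Cons.prems by (simp add: subst_Cons)
  also have "\<dots> = reduce (?x @ core a @ ?post @ subst h w)"
    by (rule reduce_append_cong) (auto simp: reduce_Cons)
  also have "\<dots> = reduce ((?x @ core a) @ cut_word S v core (S (code (inv_letter a))) w)"
    unfolding append.assoc[symmetric, of ?x]
    by (rule reduce_append_cong[OF refl]) (use Cons in auto)
  finally show ?case by simp
qed simp

lemma sum_list_cut_word: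
  fixes f :: "letter \<Rightarrow> nat"
  assumes "f (inv_letter v) = f v"
  shows "sum_list (map f (cut_word S v core b w)) = (\<Sum>a\<leftarrow>w. sum_list (map f (core a))) + f v * cut_count S b w"
  by (induction w arbitrary: b) (auto simp: assms)

lemma sum_list_endo_le:
  fixes f :: "letter \<Rightarrow> nat"
  assumes "\<And>a. a \<in> set w \<Longrightarrow> subst_letter h a =
    (if S (code a) then [inv_letter v] else []) @ core a @ (if S (code (inv_letter a)) then [v] else [])"
    and "f (inv_letter v) = f v"
  shows "sum_list (map f (endo h w)) \<le> (\<Sum>a\<leftarrow>w. sum_list (map f (core a))) + f v * cut_count S False w"
proof -
  have "endo h w = reduce (cut_word S v core False w)"
    unfolding endo_def using reduce_subst_eq_cut_word[OF assms(1), where b = False] by simp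
  then show ?thesis using sum_list_reduce_le sum_list_cut_word[OF assms(2)] by metis
qed

text \<open>The term for \<open>j\<close> is the arc into the letter with index \<open>j\<close>; at
  the left end \<open>b\<close> decides the side, and the right end counts as outside
  \<open>S\<close>.\<close>

lemma cut_count_eq_sum:
  "cut_count S b w = (\<Sum>j\<le>length w. of_bool ((if j = 0 then b else S (code (inv_letter (w ! (j - 1))))) \<noteq>
      (j < length w \<and> S (code (w ! j)))))"
proof (induction w arbitrary: b)
  case (Cons a w)
  have "(if j = 0 then S (code (inv_letter a)) else S (code (inv_letter (w ! (j - 1))))) = S (code (inv_letter ((a # w) ! j)))" for j
    by (cases j) auto
  then show ?case
    unfolding length_Cons sum.atMost_Suc_shift by (simp add: Cons)
qed simp

text \<open>The composite of \<open>sig_inv (j - 1)\<close>, ..., \<open>sig_inv k\<close>, applied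
  in this order. As a Whitehead automorphism its multiplier is the inverse of \<open>t_k\<close>;
  the image of \<open>t_j\<close> consists of the multiplier's inverse alone, so its core is
  empty.\<close>

definition beta :: "nat \<Rightarrow> nat \<Rightarrow> nat \<Rightarrow> word" where
  "beta k j i = (if i = j then gen k else if k \<le> i \<and> i < j then [(k, False), (i + 1, False), (k, True)] else gen i)"

lemma beta_braid:
  assumes "1 \<le> k" "k \<le> j" "j \<le> n"
  shows "\<exists>f\<in>braids n. \<forall>w\<in>FG n. f w = endo (beta k j) w"
  using assms(2,3)
proof (induction j rule: dec_induct)
  case base
  have "endo (beta k k) w = w" if "w \<in> FG n" for w
  proof -
    have "beta k k = gen" by (auto simp: beta_def)
    then show ?thesis using that by (simp add: endo_def FG_def)
  qed
  then show ?case by (intro bexI[OF _ braids.id]) auto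
next
  case (step j)
  then obtain f where f: "f \<in> braids n" "\<forall>w\<in>FG n. f w = endo (beta k j) w" by auto
  have j: "1 \<le> j" "j < n" using step assms(1) by auto
  have "f (endo (sig_inv j) w) = endo (beta k (Suc j)) w" if w: "w \<in> FG n" for w
  proof -
    have "endo (beta k j) (endo (sig_inv j) w) = endo (beta k (Suc j)) w"
    proof (rule endo_endo)
      show "over n w" using FG_D(1)[OF w] .
      fix i
      show "endo (beta k j) (sig_inv j i) = reduce (beta k (Suc j) i)"
        using step.hyps
        by (auto simp: endo_def sig_inv_def beta_def gen_def subst_Cons subst_letter_def inv_letter.simps)
    qed
    then show ?thesis using f(2) endo_sig_in_FG(2)[OF j w] by simp
  qed
  then show ?case using braids.sig_inv[OF f(1) j] by (intro bexI[of _ "\<lambda>w. f (endo (sig_inv j) w)"]) auto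
qed

text \<open>Replacing \<open>t_k\<close> by \<open>t_{k+1}\<close> lowers the height by one; a
  sorting move does this to more letters than it does the reverse.\<close>

definition height :: "nat \<Rightarrow> word \<Rightarrow> nat" where
  "height n w = (\<Sum>a\<leftarrow>w. n + 1 - fst a)"

section \<open>Effect of the moves on length and height\<close>

context reduced_drawing
begin

text \<open>An arc with its ends on different sides has one end in \<open>cut\<close>, from which
  \<open>i div 2\<close> recovers the arc. The bounds on \<open>lo\<close> and \<open>hi\<close> put
  the base point and the end point outside the interval.\<close>

lemma cut_count_le:
  assumes "1 \<le> lo" "hi \<le> 2 * n"
  shows "cut_count (\<lambda>x. x \<in> {lo..hi}) False w \<le> card (cut lo hi)"
proof -
  define P where "P j \<longleftrightarrow> (c (2 * j) \<in> {lo..hi}) \<noteq> (c (2 * j + 1) \<in> {lo..hi})" for j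
  have "((if j = 0 then False else code (inv_letter (w ! (j - 1))) \<in> {lo..hi}) \<noteq>
      (j < length w \<and> code (w ! j) \<in> {lo..hi})) = P j" if "j \<le> length w" for j
  proof -
    have "(if j = 0 then False else code (inv_letter (w ! (j - 1))) \<in> {lo..hi}) = (c (2 * j) \<in> {lo..hi})"
      using c_0 assms(1) c_out[of "j - 1"] that by (cases j) auto
    moreover have "(j < length w \<and> code (w ! j) \<in> {lo..hi}) = (c (2 * j + 1) \<in> {lo..hi})"
      using c_last assms(2) c_in[of j] that by (cases "j = length w") auto
    ultimately show ?thesis unfolding P_def by blast
  qed
  then have "cut_count (\<lambda>x. x \<in> {lo..hi}) False w = (\<Sum>j\<le>length w. of_bool (P j))"
    unfolding cut_count_eq_sum by (intro sum.cong) auto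
  also have "\<dots> = card {j \<in> {..length w}. P j}"
    by (simp add: of_bool_def sum.If_cases Int_def)
  also have "\<dots> \<le> card ((\<lambda>i. i div 2) ` cut lo hi)"
  proof (intro card_mono)
    show "finite ((\<lambda>i. i div 2) ` cut lo hi)" by (simp add: cut_def)
    show "{j \<in> {..length w}. P j} \<subseteq> (\<lambda>i. i div 2) ` cut lo hi"
    proof
      fix j assume "j \<in> {j \<in> {..length w}. P j}"
      then have j: "j \<le> length w" "P j" by auto
      have V: "2 * j \<in> V" "2 * j + 1 \<in> V" using j by (simp_all add: V_def)
      have m: "mate (2 * j) = 2 * j + 1" "mate (2 * j + 1) = 2 * j" by (simp_all add: mate_def)
      show "j \<in> (\<lambda>i. i div 2) ` cut lo hi"
      proof (cases "c (2 * j) \<in> {lo..hi}")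
        case True
        then have "2 * j \<in> cut lo hi" using j V m unfolding cut_def P_def by simp
        then show ?thesis by (intro image_eqI[of _ _ "2 * j"]) auto
      next
        case False
        then have "2 * j + 1 \<in> cut lo hi" using j V m unfolding cut_def P_def by auto
        then show ?thesis by (intro image_eqI[of _ _ "2 * j + 1"]) auto
      qed
    qed
  qed
  also have "\<dots> \<le> card (cut lo hi)" by (intro card_image_le) (simp add: cut_def)
  finally show ?thesis .
qed

text \<open>The letters \<open>t_j\<close> and their inverses are dropped, every other letter keeps
  one core letter, and each arc leaving the cut costs one multiplier; \<open>shrinkable\<close> says
  that fewer are inserted than dropped.\<close>

lemma shrink:
  assumes "shrinkable k j"
  shows "length (endo (beta k j) w) < length w"
proof -
  have k: "1 \<le> k" "k < j" "j \<le> n" and less: "card (cut (2 * k - 1) (2 * j - 1)) < card (blk (2 * j))"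
    using assms by (auto simp: shrinkable_def)
  let ?S = "\<lambda>x. x \<in> {2 * k - 1..2 * j - 1}" and ?v = "(k, True)"
  let ?core = "\<lambda>a :: letter. if fst a = j then [] else if k \<le> fst a \<and> fst a < j then [(fst a + 1, snd a)] else [a]"
  have sub: "subst_letter (beta k j) a =
    (if ?S (code a) then [inv_letter ?v] else []) @ ?core a @ (if ?S (code (inv_letter a)) then [?v] else [])"
    if a: "a \<in> set w" for a
  proof -
    obtain i b where ib: "a = (i, b)" by (cases a)
    have i: "1 \<le> i" "i \<le> n" using a over_w ib by (auto simp: over_def)
    have S: "?S (code (i, False)) \<longleftrightarrow> k \<le> i \<and> i \<le> j" "?S (code (i, True)) \<longleftrightarrow> k \<le> i \<and> i < j"
      using i k by (auto simp: code_simps)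
    show ?thesis unfolding ib using k
      by (cases b) (auto simp: S[simplified] subst_letter_def beta_def gen_def inv_letter.simps simp del: code.simps)
  qed
  have len: "length (endo (beta k j) w) \<le> (\<Sum>a\<leftarrow>w. length (?core a)) + cut_count ?S False w"
    using sum_list_endo_le[OF sub, where f = "\<lambda>_. 1"] by (simp add: sum_list_triv)
  have core: "(\<Sum>a\<leftarrow>u. length (?core a)) + length (filter (\<lambda>a. fst a = j) u) = length u" for u
    by (induction u) auto
  have "cut_count ?S False w \<le> card (cut (2 * k - 1) (2 * j - 1))"
    using k by (intro cut_count_le) auto
  moreover have "card (blk (2 * j)) = length (filter (\<lambda>a. fst a = j) w)"
    using k by (intro card_blk) auto
  ultimately show ?thesis using less len core[of w] by linarith
qed

text \<open>\<open>sig k\<close> is the Whitehead automorphism with cut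
  \<open>{2 * k..2 * k + 2}\<close> and multiplier \<open>t_{k+1}\<close>. All arcs at the block
  \<open>2 * k + 1\<close> run inside the cut to the block \<open>2 * k\<close>, so at most as many
  arcs leave it as there are letters of index \<open>k\<close>, whose cores are empty.\<close>

lemma sort:
  assumes "sortable k"
  shows "length (endo (sig k) w) \<le> length w" "height n (endo (sig k) w) < height n w"
proof -
  have k: "1 \<le> k" "k < n" and less: "card (blk (2 * k + 1)) < card (blk (2 * k))"
    and down: "\<And>i. i \<in> blk (2 * k + 1) \<Longrightarrow> c (mate i) = 2 * k"
    using assms by (auto simp: sortable_def)
  let ?S = "\<lambda>x. x \<in> {2 * k..2 * k + 2}" and ?v = "(k + 1, False)"
  let ?core = "\<lambda>a :: letter. if fst a = k then [] else if fst a = k + 1 then [(k, snd a)] else [a]"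
  let ?cnt = "\<lambda>j u. length (filter (\<lambda>a. fst a = j) u)"
  have sub: "subst_letter (sig k) a =
    (if ?S (code a) then [inv_letter ?v] else []) @ ?core a @ (if ?S (code (inv_letter a)) then [?v] else [])"
    if a: "a \<in> set w" for a
  proof -
    obtain i b where ib: "a = (i, b)" by (cases a)
    have i: "1 \<le> i" "i \<le> n" using a over_w ib by (auto simp: over_def)
    have S: "?S (code (i, False)) \<longleftrightarrow> i = k + 1" "?S (code (i, True)) \<longleftrightarrow> i = k \<or> i = k + 1"
      using i k by (auto simp: code_simps)
    show ?thesis unfolding ib using k
      by (cases b) (auto simp: S[simplified] subst_letter_def sig_def gen_def inv_letter.simps simp del: code.simps)
  qed
  have cards: "card (blk (2 * k)) = ?cnt k w" "card (blk (2 * k + 1)) = ?cnt (k + 1) w" "card (blk (2 * k + 2)) = ?cnt (k + 1) w"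
    using card_blk[of k] card_blk[of "k + 1"] k by auto
  have cut: "cut_count ?S False w \<le> ?cnt k w"
  proof -
    have "cut (2 * k) (2 * k + 2) \<subseteq> (blk (2 * k) - mate ` blk (2 * k + 1)) \<union> blk (2 * k + 2)"
    proof
      fix i assume i: "i \<in> cut (2 * k) (2 * k + 2)"
      then have "2 * k \<le> c i" "c i \<le> 2 * k + 2" by (auto simp: cut_def)
      then consider "c i = 2 * k" | "c i = 2 * k + 1" | "c i = 2 * k + 2" by linarith
      then show "i \<in> (blk (2 * k) - mate ` blk (2 * k + 1)) \<union> blk (2 * k + 2)"
      proof cases
        case 1
        have "i \<notin> mate ` blk (2 * k + 1)"
        proof
          assume "i \<in> mate ` blk (2 * k + 1)"
          then have "c (mate i) = 2 * k + 1" by (auto simp: blk_def)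
          then show False using i by (auto simp: cut_def)
        qed
        then show ?thesis using 1 i by (auto simp: blk_def cut_def)
      next
        case 2
        then have "i \<in> blk (2 * k + 1)" using i by (auto simp: blk_def cut_def)
        then show ?thesis using down[of i] i by (auto simp: cut_def)
      next
        case 3
        then show ?thesis using i by (auto simp: blk_def cut_def)
      qed
    qed
    then have "card (cut (2 * k) (2 * k + 2)) \<le> card ((blk (2 * k) - mate ` blk (2 * k + 1)) \<union> blk (2 * k + 2))"
      by (intro card_mono) auto
    also have "\<dots> \<le> card (blk (2 * k) - mate ` blk (2 * k + 1)) + card (blk (2 * k + 2))" by (rule card_Un_le)
    also have "card (blk (2 * k) - mate ` blk (2 * k + 1)) = card (blk (2 * k)) - card (mate ` blk (2 * k + 1))"
      using down by (intro card_Diff_subset) (auto simp: blk_def)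
    also have "card (mate ` blk (2 * k + 1)) = card (blk (2 * k + 1))" by (intro card_image inj_onI) simp
    finally have "card (cut (2 * k) (2 * k + 2)) \<le> ?cnt k w" using cards less by simp
    moreover have "cut_count ?S False w \<le> card (cut (2 * k) (2 * k + 2))" using k by (intro cut_count_le) auto
    ultimately show ?thesis by linarith
  qed
  have len: "length (endo (sig k) w) \<le> (\<Sum>a\<leftarrow>w. length (?core a)) + cut_count ?S False w"
    using sum_list_endo_le[OF sub, where f = "\<lambda>_. 1"] by (simp add: sum_list_triv)
  have core: "(\<Sum>a\<leftarrow>u. length (?core a)) + ?cnt k u = length u" for u
    by (induction u) auto
  show "length (endo (sig k) w) \<le> length w" using cut len core[of w] by linarith
  have "height n (endo (sig k) w) \<le> (\<Sum>a\<leftarrow>w. \<Sum>b\<leftarrow>?core a. n + 1 - fst b) + (n - k) * cut_count ?S False w"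
    using sum_list_endo_le[OF sub, where f = "\<lambda>a. n + 1 - fst a"] by (simp add: height_def)
  also have "\<dots> \<le> (\<Sum>a\<leftarrow>w. \<Sum>b\<leftarrow>?core a. n + 1 - fst b) + (n - k) * ?cnt k w" using cut by simp
  also have "\<dots> < height n w"
  proof -
    \<comment> \<open>Letters of index \<open>k\<close> are traded for multipliers of index
      \<open>k + 1\<close>, one unit lower each, and letters of index \<open>k + 1\<close> for core
      letters of index \<open>k\<close>, one unit higher.\<close>
    have "over n u \<Longrightarrow> (\<Sum>a\<leftarrow>u. \<Sum>b\<leftarrow>?core a. n + 1 - fst b) + (n - k) * ?cnt k u + ?cnt k u = height n u + ?cnt (k + 1) u" for u
      using k by (induction u) (auto simp: height_def)
    from this[OF over_w] show ?thesis using less cards by linarith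
  qed
  finally show "height n (endo (sig k) w) < height n w" .
qed

end

section \<open>Exponent sums and the descent to a generator\<close>

declare cyc_red.simps [simp del]

definition exp_sum :: "word \<Rightarrow> int" where
  "exp_sum w = (\<Sum>a\<leftarrow>w. if snd a then - 1 else 1)"

lemma exp_sum_append [simp]: "exp_sum (u @ v) = exp_sum u + exp_sum v"
  by (simp add: exp_sum_def)

lemma snd_inv_letter [simp]: "snd (inv_letter a) \<longleftrightarrow> \<not> snd a"
  by (cases a) (simp add: inv_letter.simps)

lemma exp_sum_reduce [simp]: "exp_sum (reduce w) = exp_sum w"
proof (induction w)
  case (Cons a w)
  have "exp_sum (red_cons a v) = exp_sum (a # v)" for v
    by (cases v) (auto simp: exp_sum_def)
  with Cons show ?case by (simp add: reduce_Cons exp_sum_def)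
qed simp

lemma exp_sum_winv [simp]: "exp_sum (winv w) = - exp_sum w"
  by (induction w) (auto simp: exp_sum_def)

lemma exp_sum_endo:
  assumes "\<And>k. exp_sum (h k) = 1"
  shows "exp_sum (endo h w) = exp_sum w"
proof -
  have "exp_sum (subst h w) = exp_sum w"
    by (induction w) (auto simp: subst_Cons subst_letter_def assms, auto simp: exp_sum_def)
  then show ?thesis by (simp add: endo_def)
qed

lemma exp_sum_braid: "f \<in> braids n \<Longrightarrow> exp_sum (f w) = exp_sum w"
proof (induction arbitrary: w rule: braids.induct)
  case (sig f i)
  have "exp_sum (sig i k) = 1" for k by (auto simp: sig_def gen_def exp_sum_def)
  with sig show ?case by (simp add: exp_sum_endo)
next
  case (sig_inv f i)
  have "exp_sum (sig_inv i k) = 1" for k by (auto simp: sig_inv_def gen_def exp_sum_def)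
  with sig_inv show ?case by (simp add: exp_sum_endo)
qed simp

lemma exp_sum_cyc_red: "exp_sum (cyc_red w) = exp_sum w"
proof (induction w rule: cyc_red.induct)
  case (1 w)
  show ?case
  proof (cases "2 \<le> length w \<and> last w = inv_letter (hd w)")
    case True
    then obtain u where u: "w = hd w # u @ [inv_letter (hd w)]"
      by (cases w; cases "tl w" rule: rev_cases) auto
    have "exp_sum w = exp_sum u"
      by (subst u) (simp add: exp_sum_def)
    moreover have "butlast (tl w) = u" by (subst u) simp
    moreover have "cyc_red w = cyc_red (butlast (tl w))" using True by (subst cyc_red.simps) (rule if_P)
    ultimately show ?thesis using 1[OF True] by (simp only:)
  next
    case False
    then have "cyc_red w = w" by (subst cyc_red.simps) (rule if_not_P)
    then show ?thesis by (simp only:)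
  qed
qed

text \<open>Braids preserve drawability and the exponent sum, so the hypotheses survive each move.
  The order is lexicographic in length and height.\<close>

theorem drawable_to_gen:
  assumes "w \<in> FG n" "drawable n w" "exp_sum w = 1"
  shows "\<exists>f\<in>braids n. \<exists>k\<in>{1..n}. f w = gen k"
proof -
  have "wf (inv_image (less_than <*lex*> less_than) (\<lambda>w. (length w, height n w)))" by auto
  then show ?thesis using assms
  proof (induction w rule: wf_induct_rule)
    case (less w)
    have step: ?case if f: "f \<in> braids n" "length (f w) < length w \<or> length (f w) \<le> length w \<and> height n (f w) < height n w" for f
    proof -
      have "(f w, w) \<in> inv_image (less_than <*lex*> less_than) (\<lambda>w. (length w, height n w))" using f(2) by auto
      from less.IH[OF this] obtain g k where g: "g \<in> braids n" "k \<in> {1..n}" "g (f w) = gen k"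
        using braids_in_FG[OF f(1)] braids_drawable[OF f(1)] exp_sum_braid[OF f(1)] less.prems by metis
      then show ?thesis using braids_comp[OF f(1) g(1)] by (intro bexI[of _ "\<lambda>w. g (f w)"]) auto
    qed
    obtain q where q: "index_drawing n w q" using less.prems(2) by (auto simp: drawable_iff_index_drawing)
    interpret reduced_drawing n w q
      using less.prems q by unfold_locales (auto simp: FG_def)
    consider k where "sortable k" | k j where "shrinkable k j" | "\<And>k. \<not> sortable k" "\<And>k j. \<not> shrinkable k j" by blast
    then show ?case
    proof cases
      case (1 k)
      have "(\<lambda>w. endo (sig k) w) \<in> braids n" using braids.sig[OF braids.id] 1 by (auto simp: sortable_def)
      from step[OF this] sort[OF 1] show ?thesis by simp
    next
      case (2 k j)
      then have "1 \<le> k" "k \<le> j" "j \<le> n" by (auto simp: shrinkable_def)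
      from beta_braid[OF this] obtain f where "f \<in> braids n" "f w = endo (beta k j) w" using less.prems(1) by blast
      then show ?thesis using step[of f] shrink[OF 2] by simp
    next
      case 3
      have "\<And>a. a \<in> set w \<Longrightarrow> \<not> snd a" 
        using all_letters_positive[OF 3] by (metis in_set_conv_nth)
      moreover have "exp_sum u = int (length u)" if "\<And>a. a \<in> set u \<Longrightarrow> \<not> snd a" for u
        using that by (induction u) (auto simp: exp_sum_def)
      ultimately have "exp_sum w = int (length w)" by blast
      then have "length w = 1" using less.prems(3) by simp
      then obtain a where a: "w = [a]" by (auto simp: length_Suc_conv)
      then have "w = gen (fst a)" using \<open>\<And>a. a \<in> set w \<Longrightarrow> \<not> snd a\<close> by (cases a) (auto simp: gen_def)
      moreover have "fst a \<in> {1..n}" using less.prems(1) a by (simp add: FG_def)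
      ultimately show ?thesis by (intro bexI[OF _ braids.id]) auto
    qed
  qed
qed

section \<open>The orbit of the first generator\<close>

lemma drawable_gen:
  assumes "k \<in> {1..n}"
  shows "drawable n (gen k)"
proof -
  have k: "1 \<le> k" "k \<le> n" using assms by auto
  have "drawing n 0 [((k, False), 1, 2)] 3"
    using k by (auto simp: drawing_def noncrossing_def labels_def separates_def code_simps inv_letter.simps)
  then show ?thesis unfolding drawable_def gen_def by (intro exI[of _ 0] exI[of _ "[((k, False), 1, 2)]"] exI[of _ 3]) simp
qed

theorem theoremA:
  fixes n :: nat and w :: word
  assumes "n \<ge> 1" and "over n w"
  shows "(\<exists>\<phi>\<in>Bn n. \<phi> (gen 1) = reduce w) \<longleftrightarrow>
         (cyc_red (reduce w) \<in> gen ` {1..n} \<and> planar n w)"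
proof
  assume "\<exists>\<phi>\<in>Bn n. \<phi> (gen 1) = reduce w"
  then obtain \<phi> where \<phi>: "\<phi> \<in> Bn n" "\<phi> (gen 1) = reduce w" by blast
  have one: "1 \<in> {1..n}" using assms(1) by simp
  have F: "reduce w \<in> FG n" using assms(2) by (rule reduce_in_FG)
  have "gen_conjugate n (reduce w)" using Bn_artin_endo[OF \<phi>(1)] \<phi>(2) one by (metis artin_endo_def)
  then obtain u j where "j \<in> {1..n}" "reduce w = u @ [(j, False)] @ winv u"
    using gen_conjugate_normal_form F by blast
  then have "cyc_red (reduce w) \<in> gen ` {1..n}" using cyc_red_conj_gen by simp
  moreover obtain f where "f \<in> braids n" "\<phi> (gen 1) = f (gen 1)"
    using artin_endo_is_braid[OF Bn_artin_endo[OF \<phi>(1)]] gen_in_FG[OF one] by blast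
  then have "drawable n (reduce w)"
    using braids_drawable[of f n "gen 1"] gen_in_FG[OF one] drawable_gen[OF one] \<phi>(2) by simp
  ultimately show "cyc_red (reduce w) \<in> gen ` {1..n} \<and> planar n w" by (simp add: planar_iff_drawable)
next
  assume *: "cyc_red (reduce w) \<in> gen ` {1..n} \<and> planar n w"
  have F: "reduce w \<in> FG n" using assms(2) by (rule reduce_in_FG)
  \<comment> \<open>Each step of the cyclic reduction removes a letter together with its inverse, so
    the exponent sum is that of a generator.\<close>
  have "exp_sum (reduce w) = exp_sum (cyc_red (reduce w))" by (simp only: exp_sum_cyc_red)
  also have "\<dots> = 1" using * by (auto simp: gen_def exp_sum_def)
  finally obtain f k where f: "f \<in> braids n" "k \<in> {1..n}" "f (reduce w) = gen k"
    using drawable_to_gen[OF F] * by (auto simp: planar_iff_drawable)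
  obtain g where g: "g \<in> braids n" "\<forall>w\<in>FG n. g (f w) = w \<and> f (g w) = w"
    using braids_inverse[OF f(1)] by blast
  obtain h where h: "h \<in> braids n" "h (gen 1) = gen k"
    using braids_gen_transitive[OF f(2)] by blast
  \<comment> \<open>\<open>h\<close> moves \<open>t_1\<close> to the generator reached by the
    simplifying braid \<open>f\<close>, and \<open>g\<close> undoes \<open>f\<close>.\<close>
  have "(\<lambda>w. g (h w)) \<in> Bn n" using braids_comp[OF h(1) g(1)] braids_subset_Bn by blast
  moreover have "g (h (gen 1)) = reduce w" using g(2) F h(2) f(3) by metis
  ultimately show "\<exists>\<phi>\<in>Bn n. \<phi> (gen 1) = reduce w" by (intro bexI[of _ "\<lambda>w. g (h w)"])
qed

end
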